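(* Let $\ell\in\{5,7,13\}$. There is an absolute constant $C>0$ such that for all integers $c,d$ with $c+\ell d\neq0$ there is a real number $\epsilon=\epsilon(c,d)$ with $|\epsilon|\le C\log|c+\ell d|$ such that, for every positive integer $r$ and every integer $n$ with $24n\equiv c+\ell d\pmod{\ell^r}$, $$p_{[1^c\ell^d]}(n)\equiv0\pmod{\ell^{\frac12\alpha_\ell r+\epsilon}},$$ where $\alpha_\ell$ depends on the residue of $c+\ell d$ modulo $24$ (represented in $\{1,\dots,24\}$) as follows. If $c+\ell d>0$: - $\ell=5$: $\alpha_5=2$ for residues $1,5,6$; $\alpha_5=1$ for residues $2,3,4,7,8,9,10,11,15,16,20,21$; $\alpha_5=0$ for all other residues. - $\ell=7$: $\alpha_7=2$ for residue $4$; $\alpha_7=1$ for residues $1,2,3,5,6,7,11,14,18,21$; $\alpha_7=0$ for all other residues. - $\ell=13$: $\alpha_{13}=1$ for residue $8$; $\alpha_{13}=0$ for all other residues. If $c+\ell d<0$, the values are the same except that for residue $24$ one has $\alpha_5=1$ and $\alpha_7=1$.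
   Context: For a prime $\ell$ and integers $c,d$, the integers $p_{[1^c\ell^d]}(n)$ are defined by $\sum_{n\ge 0}p_{[1^c\ell^d]}(n)q^n=\prod_{n\ge1}\frac{1}{(1-q^n)^c(1-q^{\ell n})^d}$, with $p_{[1^c\ell^d]}(n)=0$ for $n<0$. For real $x$, "$N\equiv 0\pmod{\ell^{x}}$" means that the $\ell$-adic valuation of the integer $N$ is at least $x$ (with the valuation of $0$ equal to $+\infty$). *)

theory Defs
  imports "HOL-Analysis.Analysis" "HOL-Number_Theory.Number_Theory"
begin

definition two_colour_factor :: "nat \<Rightarrow> int \<Rightarrow> int \<Rightarrow> nat \<Rightarrow> rat fps" where
  "two_colour_factor l c d m =
     1 / ((1 - fps_X ^ m) powi c * (1 - fps_X ^ (l * m)) powi d)"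

text \<open>
  Rational coefficients are used only because integer powers need an inverse on power series;
  the infinite product is the limit in the \<^const>\<open>fps_X\<close>-adic topology. Convergence for
  \<open>l > 0\<close> and integrality of the coefficients are shown below, so that taking the floor
  in the definition of \<open>two_colour_p\<close> loses nothing.
\<close>

definition two_colour_gf :: "nat \<Rightarrow> int \<Rightarrow> int \<Rightarrow> rat fps" where
  "two_colour_gf l c d = (\<Prod>m. two_colour_factor l c d (Suc m))"

definition two_colour_p :: "nat \<Rightarrow> int \<Rightarrow> int \<Rightarrow> int \<Rightarrow> int" where
  "two_colour_p l c d n =
     (if n < 0 then 0 else \<lfloor>fps_nth (two_colour_gf l c d) (nat n)\<rfloor>)"

text \<open>The congruence of \<open>N\<close> to 0 modulo the real power \<open>l\<close> to the \<open>x\<close>, as a bound on the valuation.\<close>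

definition zero_mod_real_power :: "int \<Rightarrow> nat \<Rightarrow> real \<Rightarrow> bool" where
  "zero_mod_real_power N l x \<longleftrightarrow> N = 0 \<or> x \<le> real (multiplicity (int l) N)"

definition residue24 :: "int \<Rightarrow> int" where
  "residue24 k = (if 24 dvd k then 24 else k mod 24)"

definition alpha_pos :: "nat \<Rightarrow> int \<Rightarrow> nat" where
  "alpha_pos l s =
     (if l = 5 then
        (if s \<in> {1, 5, 6} then 2
         else if s \<in> {2, 3, 4, 7, 8, 9, 10, 11, 15, 16, 20, 21} then 1 else 0)
      else if l = 7 then
        (if s = 4 then 2
         else if s \<in> {1, 2, 3, 5, 6, 7, 11, 14, 18, 21} then 1 else 0)
      else if l = 13 then (if s = 8 then 1 else 0)
      else 0)"

definition alpha :: "nat \<Rightarrow> int \<Rightarrow> nat" where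
  "alpha l k =
     (if k < 0 \<and> residue24 k = 24 \<and> l \<in> {5, 7} then 1
      else alpha_pos l (residue24 k))"


definition fps_one_upto :: "nat \<Rightarrow> rat fps \<Rightarrow> bool" where
  "fps_one_upto k F \<longleftrightarrow> (\<exists>G. F = 1 + fps_X ^ k * G)"

lemma fps_one_upto_mult:
  assumes "fps_one_upto k F" "fps_one_upto k G" shows "fps_one_upto k (F * G)"
proof -
  obtain A B where "F = 1 + fps_X ^ k * A" "G = 1 + fps_X ^ k * B"
    using assms by (auto simp: fps_one_upto_def)
  hence "F * G = 1 + fps_X ^ k * (A + B + fps_X ^ k * A * B)" by (simp add: algebra_simps)
  thus ?thesis unfolding fps_one_upto_def by blast
qed

lemma fps_one_upto_power: "fps_one_upto k F \<Longrightarrow> fps_one_upto k (F ^ n)"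
proof (induction n)
  case 0
  have "(1 :: rat fps) = 1 + fps_X ^ k * 0" by simp
  thus ?case unfolding fps_one_upto_def by (metis power_0)
qed (auto intro: fps_one_upto_mult)

lemma fps_one_upto_nth_0: "fps_one_upto k F \<Longrightarrow> k > 0 \<Longrightarrow> fps_nth F 0 = 1"
  by (auto simp: fps_one_upto_def fps_X_power_mult_nth)

lemma fps_one_upto_inverse:
  assumes "fps_one_upto k F" "k > 0" shows "fps_one_upto k (inverse F)"
proof -
  obtain A where A: "F = 1 + fps_X ^ k * A" using assms by (auto simp: fps_one_upto_def)
  have "F * inverse F = 1"
    using fps_one_upto_nth_0[OF assms] by (simp add: inverse_mult_eq_1')
  hence "inverse F = 1 + fps_X ^ k * (- A * inverse F)" unfolding A by (simp add: algebra_simps)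
  thus ?thesis unfolding fps_one_upto_def by blast
qed

lemma fps_one_upto_powi: "fps_one_upto k F \<Longrightarrow> k > 0 \<Longrightarrow> fps_one_upto k (F powi c)"
  by (simp add: power_int_def fps_one_upto_power fps_one_upto_inverse)

lemma fps_one_upto_factor:
  assumes "m > 0" "l > 0" shows "fps_one_upto m (two_colour_factor l c d m)"
proof -
  have 1: "fps_one_upto m (1 - fps_X ^ m)"
    unfolding fps_one_upto_def by (rule exI[of _ "-1"]) simp
  have "fps_X ^ (l * m) = (fps_X ^ m * fps_X ^ ((l - 1) * m) :: rat fps)"
    using assms by (cases l) (simp_all add: power_add)
  hence 2: "fps_one_upto m (1 - fps_X ^ (l * m))"
    unfolding fps_one_upto_def by (intro exI[of _ "- (fps_X ^ ((l - 1) * m))"]) simp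
  have 3: "fps_one_upto m ((1 - fps_X ^ m) powi c * (1 - fps_X ^ (l * m)) powi d)"
    using 1 2 assms by (intro fps_one_upto_mult fps_one_upto_powi)
  show ?thesis unfolding two_colour_factor_def
    using fps_one_upto_inverse[OF 3] fps_one_upto_nth_0[OF 3] assms
    by (simp add: fps_divide_unit)
qed

lemma two_colour_partial_stable:
  assumes "l > 0" "N \<ge> j"
  shows "fps_nth (\<Prod>m\<le>N. two_colour_factor l c d (Suc m)) j =
         fps_nth (\<Prod>m\<le>j. two_colour_factor l c d (Suc m)) j"
  using assms(2)
proof (induction N rule: dec_induct)
  case (step N)
  obtain G where "two_colour_factor l c d (Suc (Suc N)) = 1 + fps_X ^ Suc (Suc N) * G"
    using fps_one_upto_factor[of "Suc (Suc N)" l c d] assms(1) by (auto simp: fps_one_upto_def)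
  hence "(\<Prod>m\<le>Suc N. two_colour_factor l c d (Suc m)) =
      (\<Prod>m\<le>N. two_colour_factor l c d (Suc m)) +
      fps_X ^ Suc (Suc N) * (G * (\<Prod>m\<le>N. two_colour_factor l c d (Suc m)))"
    by (simp add: algebra_simps)
  thus ?case using step by (simp add: fps_X_power_mult_nth del: power_Suc prod.atMost_Suc)
qed simp

lemma two_colour_has_prod:
  assumes "l > 0"
  shows "(\<lambda>m. two_colour_factor l c d (Suc m)) has_prod two_colour_gf l c d"
proof -
  define P where "P = Abs_fps (\<lambda>j. fps_nth (\<Prod>m\<le>j. two_colour_factor l c d (Suc m)) j)"
  have lim: "(\<lambda>N. \<Prod>m\<le>N. two_colour_factor l c d (Suc m)) \<longlonglongrightarrow> P"
  proof (rule tendsto_fpsI)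
    fix j
    show "\<forall>\<^sub>F N in sequentially. fps_nth (\<Prod>m\<le>N. two_colour_factor l c d (Suc m)) j = fps_nth P j"
      using eventually_ge_at_top[of j]
      by eventually_elim (unfold P_def fps_nth_Abs_fps, rule two_colour_partial_stable[OF assms])
  qed
  have "fps_nth P 0 = 1"
    using fps_one_upto_nth_0[OF fps_one_upto_factor[of 1 l c d]] assms by (simp add: P_def)
  hence "P \<noteq> 0" by auto
  with lim have "(\<lambda>m. two_colour_factor l c d (Suc m)) has_prod P"
    by (simp add: has_prod_def raw_has_prod_def)
  thus ?thesis using has_prod_unique unfolding two_colour_gf_def by metis
qed

definition fps_Ints :: "rat fps \<Rightarrow> bool" where
  "fps_Ints F \<longleftrightarrow> (\<forall>n. fps_nth F n \<in> \<int>)"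

lemma fps_Ints_mult: "fps_Ints F \<Longrightarrow> fps_Ints G \<Longrightarrow> fps_Ints (F * G)"
  unfolding fps_Ints_def fps_mult_nth by (auto intro!: Ints_sum Ints_mult)

lemma fps_Ints_power: "fps_Ints F \<Longrightarrow> fps_Ints (F ^ n)"
proof (induction n)
  case 0
  show ?case by (auto simp: fps_Ints_def)
qed (auto intro: fps_Ints_mult)

lemma fps_Ints_inverse:
  assumes "fps_Ints F" "fps_nth F 0 = 1" shows "fps_Ints (inverse F)"
proof -
  have "fps_nth (inverse F) n \<in> \<int>" for n
  proof (induction n rule: less_induct)
    case (less n)
    show ?case
    proof (cases "n = 0")
      case False
      have "F * inverse F = 1" using assms by (simp add: inverse_mult_eq_1')
      hence "0 = (\<Sum>i=0..n. fps_nth F i * fps_nth (inverse F) (n - i))"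
        using False by (metis fps_mult_nth fps_one_nth)
      also have "\<dots> = fps_nth (inverse F) n +
          (\<Sum>i=Suc 0..n. fps_nth F i * fps_nth (inverse F) (n - i))"
        using assms by (simp add: sum.atLeast_Suc_atMost)
      finally have "fps_nth (inverse F) n =
          - (\<Sum>i=Suc 0..n. fps_nth F i * fps_nth (inverse F) (n - i))" by simp
      moreover have "(\<Sum>i=Suc 0..n. fps_nth F i * fps_nth (inverse F) (n - i)) \<in> \<int>"
        using assms less by (intro Ints_sum Ints_mult) (auto simp: fps_Ints_def)
      ultimately show ?thesis by simp
    qed (use assms in simp)
  qed
  thus ?thesis by (simp add: fps_Ints_def)
qed

lemma fps_Ints_powi:
  "fps_Ints F \<Longrightarrow> fps_nth F 0 = 1 \<Longrightarrow> fps_Ints (F powi c)"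
  by (simp add: power_int_def fps_Ints_power fps_Ints_inverse)

lemma fps_Ints_factor:
  assumes "m > 0" "l > 0" shows "fps_Ints (two_colour_factor l c d m)"
proof -
  have *: "fps_Ints (1 - fps_X ^ k)" "fps_nth (1 - fps_X ^ k :: rat fps) 0 = 1"
    if "k > 0" for k
    using that by (auto simp: fps_Ints_def fps_X_power_nth)
  define D where "D = (1 - fps_X ^ m :: rat fps) powi c * (1 - fps_X ^ (l * m)) powi d"
  have "fps_Ints D" unfolding D_def
    using assms by (intro fps_Ints_mult fps_Ints_powi *) auto
  moreover have "fps_nth ((1 - fps_X ^ k :: rat fps) powi e) 0 = 1" if "k > 0" for k e
  proof -
    have "fps_one_upto k (1 - fps_X ^ k)"
      unfolding fps_one_upto_def by (rule exI[of _ "-1"]) simp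
    thus ?thesis using that by (intro fps_one_upto_nth_0[OF fps_one_upto_powi])
  qed
  hence "fps_nth D 0 = 1" using assms by (simp add: D_def)
  ultimately show ?thesis unfolding two_colour_factor_def D_def[symmetric]
    using fps_Ints_inverse[of D] by (simp add: fps_divide_unit)
qed

lemma of_int_two_colour_p:
  assumes "l > 0"
  shows "of_int (two_colour_p l c d (int n)) = fps_nth (two_colour_gf l c d) n"
proof -
  have partial: "fps_Ints (\<Prod>m\<le>N. two_colour_factor l c d (Suc m))" for N
    using assms by (induction N) (auto intro: fps_Ints_mult fps_Ints_factor)
  have "raw_has_prod (\<lambda>m. two_colour_factor l c d (Suc m)) 0 (two_colour_gf l c d) \<or>
      (\<exists>i. two_colour_factor l c d (Suc i) = 0)"
    using two_colour_has_prod[OF assms] by (auto simp: has_prod_def)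
  moreover have "two_colour_factor l c d (Suc i) \<noteq> 0" for i
    using fps_one_upto_nth_0[OF fps_one_upto_factor[of "Suc i" l c d]] assms by auto
  ultimately have "(\<lambda>N. \<Prod>m\<le>N. two_colour_factor l c d (Suc m)) \<longlonglongrightarrow> two_colour_gf l c d"
    by (auto simp: raw_has_prod_def)
  hence "\<forall>\<^sub>F N in sequentially. fps_nth (\<Prod>m\<le>N. two_colour_factor l c d (Suc m)) n =
      fps_nth (two_colour_gf l c d) n" by (simp add: tendsto_fps_iff)
  then obtain N where "fps_nth (\<Prod>m\<le>N. two_colour_factor l c d (Suc m)) n =
      fps_nth (two_colour_gf l c d) n" by (auto simp: eventually_at_top_linorder)
  hence "fps_nth (two_colour_gf l c d) n \<in> \<int>" using partial by (metis fps_Ints_def)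
  thus ?thesis by (auto simp: two_colour_p_def elim!: Ints_cases)
qed

end

theory Submission
  imports Defs
begin

text \<open>
  Write \<open>k = c + l d\<close> and \<open>E(q)\<close> for Euler's product \<open>(1 - q) (1 - q^2) (1 - q^3) ...\<close>.
  Up to a power of \<open>q\<close> the generating function is \<open>eta(\<tau>) to the power -c\<close> times
  \<open>eta(l \<tau>) to the power -d\<close>, an eta quotient whose order at infinity is \<open>-k/24\<close>. If the coefficient of
  index \<open>n\<close> is placed at \<open>24 n - k\<close>, the operator \<open>U\<close>, which keeps the coefficients at multiples of \<open>l\<close>
  and divides their places by \<open>l\<close>, turns the congruence for \<open>n\<close> into a statement about all coefficients
  of the \<open>r\<close>-fold image under \<open>U\<close>.

  For \<open>l = 5, 7, 13\<close> the modular curve of level \<open>l\<close> has genus 0, with Hauptmodul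
  \<open>g = q (E(q^l) / E(q))^(24/(l-1))\<close>. Multiplication by \<open>g\<close> keeps \<open>c + d\<close> and raises the order by one,
  and \<open>U\<close> maps an eta quotient of order \<open>n/24\<close> to an integer combination of eta quotients with the same
  \<open>c + d\<close> and with orders \<open>n'/24\<close>, where \<open>l n' = n + 24 m\<close> and \<open>m \<ge> 0\<close>. The key estimate, lemma
  \<open>eta_coeff_step\<close>, is that the coefficient in this combination is divisible by \<open>l\<close> to the power
  \<open>(m - 1)/(2 s)\<close>, rounded down, with \<open>s = (l^2 - 1)/24\<close>, whatever the value of \<open>c + d\<close>. It comes from
  the modular equation: \<open>\<phi> = q^s E(q^(l^2)) / E(q)\<close> is a root of a monic polynomial of degree \<open>l\<close> over the
  integer polynomials in \<open>g(q^l)\<close>, and the coefficients of this polynomial are divisible by the powers of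
  \<open>l\<close> that a grading by orders predicts. Newton's identities carry the grading over to the traces of the
  powers of \<open>\<phi>\<close> (lemma \<open>U_power_expansion\<close>). The trace is \<open>l\<close> times \<open>U\<close>, which costs one factor \<open>l\<close>.

  The modular equation is proved with formal power series alone. Ramanujan's differential equations for the
  Eisenstein series \<open>E2, E4, E6\<close> follow from Skoruppa's combinatorial identity. A series \<open>y\<close> is defined by
  the equation \<open>j = a(y) b(y)^3 / y\<close> that the Hauptmodul ought to satisfy. Certain algebraic expressions in
  \<open>y\<close> and the Eisenstein series then solve Ramanujan's system again, with the initial values of
  \<open>l E2(q^l), l^2 E4(q^l), l^3 E6(q^l)\<close>, and the uniqueness of the solution identifies the two. This gives
  \<open>y = g\<close> by logarithmic derivatives and expresses \<open>j(q^l)\<close> as a rational function of \<open>g(q)\<close>. It is the same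
  as the value at \<open>g(q^l)\<close> of the first rational function, and as \<open>g(q) g(q^l)\<close> is a power of \<open>\<phi>\<close>, the
  difference is a polynomial relation between \<open>\<phi>\<close> and \<open>g(q^l)\<close>. The polynomial factors, and lowest
  coefficients show which factor vanishes.

  The rest is bookkeeping on orders. Each application of \<open>U\<close> divides the order by \<open>l\<close> unless it pays with
  factors \<open>l\<close>, so after about \<open>log |k|\<close> applications the orders are positive and bounded, except for terms
  that carry the factors they paid for (lemma \<open>first_steps\<close>). From then on the class of the order modulo 24
  alternates between two values, and a potential function shows that two successive applications gain
  \<open>\<alpha>\<close> factors of \<open>l\<close> (definition \<open>steady\<close>, lemma \<open>gain_table\<close>). For \<open>l = 13\<close> an additional
  factor 13 at order \<open>16/24\<close> is needed. It is due to Jacobi's formula for the cube of Euler's product, in which the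
  coefficient of \<open>q^8\<close> vanishes. The powers of \<open>\<phi>\<close> have natural exponents, so \<open>c\<close> must not become negative;
  this is arranged beforehand with the congruence of \<open>E(q)^l\<close> and \<open>E(q^l)\<close> modulo \<open>l\<close>
  (lemma \<open>two_colour_gf_shift_congruence\<close>).
\<close>

section \<open>A combinatorial identity for divisor sums\<close>

definition quads :: "nat \<Rightarrow> (nat \<times> nat \<times> nat \<times> nat) set" where
  "quads n = {(a, b, x, y). a > 0 \<and> b > 0 \<and> x > 0 \<and> y > 0 \<and> a * x + b * y = n}"

lemma finite_quads: "finite (quads n)"
proof (rule finite_subset)
  show "quads n \<subseteq> {..n} \<times> {..n} \<times> {..n} \<times> {..n}"
  proof
    fix t assume "t \<in> quads n"
    then obtain a b x y where t: "t = (a, b, x, y)" "a > 0" "b > 0" "x > 0" "y > 0" "a * x + b * y = n"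
      by (auto simp: quads_def)
    have "a \<le> a * x" "x \<le> a * x" "b \<le> b * y" "y \<le> b * y" using t by auto
    hence "a \<le> n" "b \<le> n" "x \<le> n" "y \<le> n" using t(6) by linarith+
    thus "t \<in> {..n} \<times> {..n} \<times> {..n} \<times> {..n}" using t by auto
  qed
qed auto

lemma sum_quads_swap:
  "(\<Sum>(a, b, x, y) \<in> {(a, b, x, y) \<in> quads n. R b a y x}. F b a)
   = (\<Sum>(a, b, x, y) \<in> {(a, b, x, y) \<in> quads n. R a b x y}. F a b)"
  by (rule sum.reindex_bij_witness[where i = "\<lambda>(a, b, x, y). (b, a, y, x)"
        and j = "\<lambda>(a, b, x, y). (b, a, y, x)"]) (auto simp: quads_def add.commute)

lemma sum_quads_split:
  fixes F :: "nat \<Rightarrow> nat \<Rightarrow> rat" and p q :: "nat \<times> nat \<times> nat \<times> nat \<Rightarrow> nat"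
  shows "(\<Sum>(a, b, x, y) \<in> quads n. F a b) =
     (\<Sum>(a, b, x, y) \<in> {t \<in> quads n. p t > q t}. F a b)
   + (\<Sum>(a, b, x, y) \<in> {t \<in> quads n. p t < q t}. F a b)
   + (\<Sum>(a, b, x, y) \<in> {t \<in> quads n. p t = q t}. F a b)"
proof -
  have "quads n = {t \<in> quads n. p t > q t} \<union> {t \<in> quads n. p t < q t} \<union> {t \<in> quads n. p t = q t}"
    by auto
  hence "(\<Sum>(a, b, x, y) \<in> quads n. F a b) = (\<Sum>(a, b, x, y) \<in>
     {t \<in> quads n. p t > q t} \<union> {t \<in> quads n. p t < q t} \<union> {t \<in> quads n. p t = q t}. F a b)"
    by simp
  also have "\<dots> = (\<Sum>(a, b, x, y) \<in> {t \<in> quads n. p t > q t} \<union> {t \<in> quads n. p t < q t}. F a b)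
      + (\<Sum>(a, b, x, y) \<in> {t \<in> quads n. p t = q t}. F a b)"
    by (rule sum.union_disjoint) (auto simp: finite_quads)
  also have "(\<Sum>(a, b, x, y) \<in> {t \<in> quads n. p t > q t} \<union> {t \<in> quads n. p t < q t}. F a b)
     = (\<Sum>(a, b, x, y) \<in> {t \<in> quads n. p t > q t}. F a b)
   + (\<Sum>(a, b, x, y) \<in> {t \<in> quads n. p t < q t}. F a b)"
    by (rule sum.union_disjoint) (auto simp: finite_quads)
  finally show ?thesis .
qed

lemma sum_quads_ab:
  fixes F :: "nat \<Rightarrow> nat \<Rightarrow> rat"
  assumes sym: "\<And>a b. F a b = F b a"
  shows "(\<Sum>(a, b, x, y) \<in> quads n. F a b) =
     2 * (\<Sum>(a, b, x, y) \<in> {(a, b, x, y) \<in> quads n. a > b}. F a b)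
   + (\<Sum>(a, b, x, y) \<in> {(a, b, x, y) \<in> quads n. a = b}. F a b)"
proof -
  have "(\<Sum>(a, b, x, y) \<in> {(a, b, x, y) \<in> quads n. a < b}. F a b)
      = (\<Sum>(a, b, x, y) \<in> {(a, b, x, y) \<in> quads n. b < a}. F a b)"
    using sum_quads_swap[where n = n and F = F and R = "\<lambda>a b x y. b < a"] sym by simp
  thus ?thesis
    using sum_quads_split[where F = F and n = n and p = "\<lambda>(a, b, x, y). a" and q = "\<lambda>(a, b, x, y). b"]
    by (simp add: case_prod_unfold)
qed

lemma sum_quads_xy:
  fixes F :: "nat \<Rightarrow> nat \<Rightarrow> rat"
  assumes sym: "\<And>a b. F a b = F b a"
  shows "(\<Sum>(a, b, x, y) \<in> quads n. F a b) =
     2 * (\<Sum>(a, b, x, y) \<in> {(a, b, x, y) \<in> quads n. y > x}. F a b)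
   + (\<Sum>(a, b, x, y) \<in> {(a, b, x, y) \<in> quads n. x = y}. F a b)"
proof -
  have "(\<Sum>(a, b, x, y) \<in> {(a, b, x, y) \<in> quads n. y < x}. F a b)
      = (\<Sum>(a, b, x, y) \<in> {(a, b, x, y) \<in> quads n. x < y}. F a b)"
    using sum_quads_swap[where n = n and F = F and R = "\<lambda>a b x y. x < y"] sym by simp
  thus ?thesis
    using sum_quads_split[where F = F and n = n and p = "\<lambda>(a, b, x, y). x" and q = "\<lambda>(a, b, x, y). y"]
    by (simp add: case_prod_unfold)
qed

text \<open>
  The map \<open>(a, b, x, y) \<mapsto> (a - b, b, x, x + y)\<close> preserves \<open>a x + b y\<close>, and it trades the condition that
  orders \<open>a\<close> and \<open>b\<close> for one that orders \<open>x\<close> and \<open>y\<close>.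
\<close>

lemma sum_quads_subtract:
  "(\<Sum>(a, b, x, y) \<in> {(a, b, x, y) \<in> quads n. a > b}. G (a - b) b)
   = (\<Sum>(a, b, x, y) \<in> {(a, b, x, y) \<in> quads n. y > x}. G a b)"
proof (rule sum.reindex_bij_witness[where j = "\<lambda>(a, b, x, y). (a - b, b, x, x + y)"
        and i = "\<lambda>(a, b, x, y). (a + b, b, x, y - x)"])
  fix t assume "t \<in> {(a, b, x, y) \<in> quads n. a > b}"
  then obtain a b x y where t: "t = (a, b, x, y)" "(a, b, x, y) \<in> quads n" "a > b" by auto
  then obtain c where c: "a = b + c" "c > 0" using less_imp_add_positive by blast
  show "(case t of (a, b, x, y) \<Rightarrow> (a - b, b, x, x + y)) \<in> {(a, b, x, y) \<in> quads n. y > x}"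
    using t c by (auto simp: quads_def algebra_simps)
next
  fix t assume "t \<in> {(a, b, x, y) \<in> quads n. y > x}"
  then obtain a b x y where t: "t = (a, b, x, y)" "(a, b, x, y) \<in> quads n" "y > x" by auto
  then obtain c where c: "y = x + c" "c > 0" using less_imp_add_positive by blast
  show "(case t of (a, b, x, y) \<Rightarrow> (a + b, b, x, y - x)) \<in> {(a, b, x, y) \<in> quads n. a > b}"
    using t c by (auto simp: quads_def algebra_simps)
qed auto

lemma sum_quads_diag_ab:
  fixes H :: "nat \<Rightarrow> rat"
  assumes "n > 0"
  shows "(\<Sum>(a, b, x, y) \<in> {(a, b, x, y) \<in> quads n. a = b}. H a)
     = (\<Sum>d | d dvd n. (rat_of_nat n / rat_of_nat d - 1) * H d)"
proof -
  have fin: "finite {d. d dvd n}" using assms by simp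
  have "(\<Sum>d | d dvd n. (rat_of_nat n / rat_of_nat d - 1) * H d)
      = (\<Sum>d | d dvd n. \<Sum>x \<in> {1..<n div d}. H d)"
  proof (rule sum.cong)
    fix d assume "d \<in> {d. d dvd n}"
    then obtain k where k: "n = d * k" by auto
    with assms have "d > 0" "k > 0" by auto
    thus "(rat_of_nat n / rat_of_nat d - 1) * H d = (\<Sum>x \<in> {1..<n div d}. H d)"
      using k by (simp add: of_nat_diff)
  qed simp
  also have "\<dots> = (\<Sum>(d, x) \<in> Sigma {d. d dvd n} (\<lambda>d. {1..<n div d}). H d)"
    using fin by (subst sum.Sigma) auto
  also have "\<dots> = (\<Sum>(a, b, x, y) \<in> {(a, b, x, y) \<in> quads n. a = b}. H a)"
  proof (rule sum.reindex_bij_witness[where j = "\<lambda>(d, x). (d, d, x, n div d - x)"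
        and i = "\<lambda>(a, b, x, y). (a, x)"])
    fix t assume "t \<in> Sigma {d. d dvd n} (\<lambda>d. {1..<n div d})"
    then obtain d x where t0: "t = (d, x)" "d dvd n" "x \<ge> 1" "x < n div d" by auto
    then obtain k where t: "t = (d, x)" "n = d * k" "x \<ge> 1" "x < n div d" by blast
    hence "d > 0" using assms by auto
    hence "x < k" using t by simp
    then obtain z where z: "k = x + z" "z > 0" using less_imp_add_positive by blast
    show "(case t of (d, x) \<Rightarrow> (d, d, x, n div d - x)) \<in> {(a, b, x, y) \<in> quads n. a = b}"
      using t z \<open>d > 0\<close> by (auto simp: quads_def algebra_simps)
  next
    fix t assume "t \<in> {(a, b, x, y) \<in> quads n. a = b}"
    then obtain a x y where t: "t = (a, a, x, y)" "a > 0" "x > 0" "y > 0" "n = a * (x + y)"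
      by (auto simp: quads_def algebra_simps)
    thus "(case t of (a, b, x, y) \<Rightarrow> (a, x)) \<in> Sigma {d. d dvd n} (\<lambda>d. {1..<n div d})"
      by auto
    show "(case (case t of (a, b, x, y) \<Rightarrow> (a, x)) of (d, x) \<Rightarrow> (d, d, x, n div d - x)) = t"
      using t by auto
  qed auto
  finally show ?thesis ..
qed

lemma sum_quads_diag_xy:
  fixes G :: "nat \<Rightarrow> nat \<Rightarrow> rat"
  assumes "n > 0"
  shows "(\<Sum>(a, b, x, y) \<in> {(a, b, x, y) \<in> quads n. x = y}. G a b)
     = (\<Sum>d | d dvd n. \<Sum>j \<in> {1..<d}. G j (d - j))"
proof -
  have fin: "finite {d. d dvd n}" using assms by simp
  have "(\<Sum>d | d dvd n. \<Sum>j \<in> {1..<d}. G j (d - j))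
     = (\<Sum>(d, j) \<in> Sigma {d. d dvd n} (\<lambda>d. {1..<d}). G j (d - j))"
    using fin by (subst sum.Sigma) auto
  also have "\<dots> = (\<Sum>(a, b, x, y) \<in> {(a, b, x, y) \<in> quads n. x = y}. G a b)"
  proof (rule sum.reindex_bij_witness[where j = "\<lambda>(d, j). (j, d - j, n div d, n div d)"
        and i = "\<lambda>(a, b, x, y). (a + b, a)"])
    fix t assume "t \<in> Sigma {d. d dvd n} (\<lambda>d. {1..<d})"
    then obtain d j k where t: "t = (d, j)" "n = d * k" "j \<ge> 1" "j < d" by auto
    then obtain z where z: "d = j + z" "z > 0" using less_imp_add_positive by blast
    have k: "d > 0" "k > 0" using t assms by auto
    hence "n div d = k" using t by simp
    thus "(case t of (d, j) \<Rightarrow> (j, d - j, n div d, n div d)) \<in> {(a, b, x, y) \<in> quads n. x = y}"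
      using t z k by (auto simp: quads_def algebra_simps)
  next
    fix t assume "t \<in> {(a, b, x, y) \<in> quads n. x = y}"
    then obtain a b x where t: "t = (a, b, x, x)" "a > 0" "b > 0" "x > 0" "n = (a + b) * x"
      by (auto simp: quads_def algebra_simps)
    thus "(case t of (a, b, x, y) \<Rightarrow> (a + b, a)) \<in> Sigma {d. d dvd n} (\<lambda>d. {1..<d})"
      by auto
    show "(case (case t of (a, b, x, y) \<Rightarrow> (a + b, a)) of (d, j) \<Rightarrow> (j, d - j, n div d, n div d)) = t"
      using t by (auto simp del: mult_Suc mult_Suc_right)
  qed auto
  finally show ?thesis ..
qed

text \<open>
  Split the sum of \<open>G a b\<close> once by the order of \<open>a\<close> and \<open>b\<close>, once by the order of \<open>x\<close> and \<open>y\<close>. The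
  substitution above matches the off-diagonal parts up to \<open>K\<close>, and the diagonal parts are sums over divisors.
  The idea is due to Skoruppa; it replaces the theory of modular forms of weight at most 8.
\<close>

lemma skoruppa:
  fixes G K :: "nat \<Rightarrow> nat \<Rightarrow> rat"
  assumes n: "n > 0"
    and symG: "\<And>a b. G a b = G b a" and symK: "\<And>a b. K a b = K b a"
    and KG: "\<And>a b. a \<ge> b \<Longrightarrow> K a b = G a b - G (a - b) b"
  shows "(\<Sum>(a, b, x, y) \<in> quads n. K a b) =
     (\<Sum>d | d dvd n. (\<Sum>j \<in> {1..<d}. G j (d - j)) - (rat_of_nat n / rat_of_nat d - 1) * G 0 d)"
proof -
  have 1: "(\<Sum>(a, b, x, y) \<in> {(a, b, x, y) \<in> quads n. a > b}. K a b)
     = (\<Sum>(a, b, x, y) \<in> {(a, b, x, y) \<in> quads n. a > b}. G a b)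
     - (\<Sum>(a, b, x, y) \<in> {(a, b, x, y) \<in> quads n. y > x}. G a b)"
    unfolding sum_quads_subtract[symmetric] sum_subtractf[symmetric]
    by (rule sum.cong) (auto simp: KG)
  have diag: "(\<Sum>(a, b, x, y) \<in> {(a, b, x, y) \<in> quads n. a = b}. F a b)
      = (\<Sum>(a, b, x, y) \<in> {(a, b, x, y) \<in> quads n. a = b}. F a a)" for F :: "nat \<Rightarrow> nat \<Rightarrow> rat"
    by (rule sum.cong) auto
  have 2: "(\<Sum>(a, b, x, y) \<in> {(a, b, x, y) \<in> quads n. a = b}. K a b)
     = (\<Sum>(a, b, x, y) \<in> {(a, b, x, y) \<in> quads n. a = b}. G a b)
     - (\<Sum>d | d dvd n. (rat_of_nat n / rat_of_nat d - 1) * G 0 d)"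
    unfolding sum_quads_diag_ab[OF n, symmetric] sum_subtractf[symmetric]
    by (rule sum.cong) (auto simp: KG)
  have "(\<Sum>(a, b, x, y) \<in> quads n. K a b)
    = 2 * ((\<Sum>(a, b, x, y) \<in> {(a, b, x, y) \<in> quads n. a > b}. G a b)
     - (\<Sum>(a, b, x, y) \<in> {(a, b, x, y) \<in> quads n. y > x}. G a b))
     + (\<Sum>(a, b, x, y) \<in> {(a, b, x, y) \<in> quads n. a = b}. G a b)
     - (\<Sum>d | d dvd n. (rat_of_nat n / rat_of_nat d - 1) * G 0 d)"
    using sum_quads_ab[where F = K and n = n, OF symK] 1 2 by simp
  also have "\<dots> = (\<Sum>(a, b, x, y) \<in> {(a, b, x, y) \<in> quads n. x = y}. G a b)
     - (\<Sum>d | d dvd n. (rat_of_nat n / rat_of_nat d - 1) * G 0 d)"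
    using sum_quads_ab[where F = G and n = n, OF symG] sum_quads_xy[where F = G and n = n, OF symG] by simp
  finally show ?thesis
    unfolding sum_quads_diag_xy[OF n] sum_subtractf by simp
qed

section \<open>Ramanujan's differential equations\<close>

definition divisor_power_sum :: "nat \<Rightarrow> nat \<Rightarrow> rat" where
  "divisor_power_sum k n = (\<Sum>d | d dvd n. rat_of_nat d ^ k)"

lemma divisor_power_sum_0 [simp]: "divisor_power_sum k 0 = 0"
  by (simp add: divisor_power_sum_def)

lemma sum_quads_powers:
  "(\<Sum>(a, b, x, y) \<in> quads n. rat_of_nat a ^ i * rat_of_nat b ^ j)
    = (\<Sum>m\<le>n. divisor_power_sum i m * divisor_power_sum j (n - m))"
proof -
  have "(\<Sum>m\<le>n. divisor_power_sum i m * divisor_power_sum j (n - m))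
     = (\<Sum>m\<in>{0<..<n}. divisor_power_sum i m * divisor_power_sum j (n - m))"
    by (rule sum.mono_neutral_right) auto
  also have "\<dots> = (\<Sum>m\<in>{0<..<n}. \<Sum>(a, b) \<in> {a. a dvd m} \<times> {b. b dvd n - m}. rat_of_nat a ^ i * rat_of_nat b ^ j)"
    by (simp add: divisor_power_sum_def sum_product sum.cartesian_product)
  also have "\<dots> = (\<Sum>(m, a, b) \<in> Sigma {0<..<n} (\<lambda>m. {a. a dvd m} \<times> {b. b dvd n - m}). rat_of_nat a ^ i * rat_of_nat b ^ j)"
    by (subst sum.Sigma) (auto simp: case_prod_unfold)
  also have "\<dots> = (\<Sum>(a, b, x, y) \<in> quads n. rat_of_nat a ^ i * rat_of_nat b ^ j)"
  proof (rule sum.reindex_bij_witness[where j = "\<lambda>(m, a, b). (a, b, m div a, (n - m) div b)"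
        and i = "\<lambda>(a, b, x, y). (a * x, a, b)"])
    fix t assume "t \<in> Sigma {0<..<n} (\<lambda>m. {a. a dvd m} \<times> {b. b dvd n - m})"
    then obtain m a b where t0: "t = (m, a, b)" "a dvd m" "b dvd n - m" "0 < m" "m < n"
      by auto
    then obtain x y where t: "t = (m, a, b)" "m = a * x" "n - m = b * y" "0 < m" "m < n"
      by (metis dvd_def)
    have "b * y > 0" using t by linarith
    hence pos: "a > 0" "x > 0" "b > 0" "y > 0" using t by auto
    show "(case t of (m, a, b) \<Rightarrow> (a, b, m div a, (n - m) div b)) \<in> quads n"
      using t pos by (auto simp: quads_def)
    show "(case (case t of (m, a, b) \<Rightarrow> (a, b, m div a, (n - m) div b)) of (a, b, x, y) \<Rightarrow> (a * x, a, b)) = t"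
      using t pos by auto
  next
    fix t assume "t \<in> quads n"
    then obtain a b x y where t: "t = (a, b, x, y)" "a > 0" "b > 0" "x > 0" "y > 0" "a * x + b * y = n"
      by (auto simp: quads_def)
    have *: "n - a * x = b * y" "a * x < n" using t by (auto simp: algebra_simps)
    show "(case t of (a, b, x, y) \<Rightarrow> (a * x, a, b)) \<in> Sigma {0<..<n} (\<lambda>m. {a. a dvd m} \<times> {b. b dvd n - m})"
      using t * by auto
    show "(case (case t of (a, b, x, y) \<Rightarrow> (a * x, a, b)) of (m, a, b) \<Rightarrow> (a, b, m div a, (n - m) div b)) = t"
      using t * by auto
  qed auto
  finally show ?thesis ..
qed

definition conv_divisor_sum :: "nat \<Rightarrow> nat \<Rightarrow> nat \<Rightarrow> rat" where
  "conv_divisor_sum i j n = (\<Sum>m\<le>n. divisor_power_sum i m * divisor_power_sum j (n - m))"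

lemma sum_powers_lessThan:
  fixes d :: nat
  assumes "d > 0"
  shows "(\<Sum>j\<in>{1..<d}. rat_of_nat j) = (of_nat d ^ 2 - of_nat d) / 2"
    "(\<Sum>j\<in>{1..<d}. rat_of_nat j ^ 2) = (2 * of_nat d ^ 3 - 3 * of_nat d ^ 2 + of_nat d) / 6"
    "(\<Sum>j\<in>{1..<d}. rat_of_nat j ^ 3) = (of_nat d ^ 4 - 2 * of_nat d ^ 3 + of_nat d ^ 2) / 4"
    "(\<Sum>j\<in>{1..<d}. rat_of_nat j ^ 4) = (6 * of_nat d ^ 5 - 15 * of_nat d ^ 4 + 10 * of_nat d ^ 3 - of_nat d) / 30"
    "(\<Sum>j\<in>{1..<d}. rat_of_nat j ^ 5) = (2 * of_nat d ^ 6 - 6 * of_nat d ^ 5 + 5 * of_nat d ^ 4 - of_nat d ^ 2) / 12"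
    "(\<Sum>j\<in>{1..<d}. rat_of_nat j ^ 6) = (6 * of_nat d ^ 7 - 21 * of_nat d ^ 6 + 21 * of_nat d ^ 5 - 7 * of_nat d ^ 3 + of_nat d) / 42"
  using assms
  by (induction d rule: nat_induct_non_zero) (auto simp: field_simps power_numeral_reduce)

lemma divisor_sum_cong:
  fixes n :: nat and f g :: "nat \<Rightarrow> rat"
  assumes "n > 0" "\<And>d. d > 0 \<Longrightarrow> f d = g d"
  shows "(\<Sum>d | d dvd n. f d) = (\<Sum>d | d dvd n. g d)"
  by (rule sum.cong) (use assms dvd_pos_nat[of n] in auto)

lemma skoruppa_conv:
  fixes G K :: "nat \<Rightarrow> nat \<Rightarrow> rat" and S :: "nat \<Rightarrow> rat"
  assumes n: "n > 0"
    and symG: "\<And>a b. G a b = G b a" and symK: "\<And>a b. K a b = K b a"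
    and KG: "\<And>a b. a \<ge> b \<Longrightarrow> K a b = G a b - G (a - b) b"
    and S: "\<And>d. d > 0 \<Longrightarrow> (\<Sum>j \<in> {1..<d}. G j (d - j)) = S d"
  shows "(\<Sum>(a, b, x, y) \<in> quads n. K a b) =
     (\<Sum>d | d dvd n. S d - (rat_of_nat n / rat_of_nat d - 1) * G 0 d)"
proof -
  have "(\<Sum>(a, b, x, y) \<in> quads n. K a b) =
     (\<Sum>d | d dvd n. (\<Sum>j \<in> {1..<d}. G j (d - j)) - (rat_of_nat n / rat_of_nat d - 1) * G 0 d)"
    by (rule skoruppa[OF n]) (fact symG symK KG)+
  also have "\<dots> = (\<Sum>d | d dvd n. S d - (rat_of_nat n / rat_of_nat d - 1) * G 0 d)"
    by (rule divisor_sum_cong[OF n]) (simp only: S)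
  finally show ?thesis .
qed

lemma sum_quads_monomial:
  "(\<Sum>(a, b, x, y) \<in> quads n. c * (rat_of_nat a ^ i * rat_of_nat b ^ j)) = c * conv_divisor_sum i j n"
  unfolding conv_divisor_sum_def sum_quads_powers[symmetric] sum_distrib_left
  by (simp add: case_prod_unfold)

lemma conv_divisor_sum_commute: "conv_divisor_sum i j n = conv_divisor_sum j i n"
  unfolding conv_divisor_sum_def
  by (rule sum.reindex_bij_witness[where i = "\<lambda>m. n - m" and j = "\<lambda>m. n - m"]) (auto simp: mult.commute)

text \<open>
  In this and the next three identities \<open>G\<close> is chosen such that \<open>G (a - b) b\<close> is symmetric in \<open>a\<close> and \<open>b\<close>:
  it is a polynomial in \<open>x^2 + x y + y^2\<close> and \<open>x^2 y^2 (x + y)^2\<close>, the latter in \<open>conv_3_3\<close>. The difference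
  \<open>K\<close> then contains only monomials that are odd in both variables.
\<close>

lemma conv_1_1:
  assumes "n > 0"
  shows "12 * conv_divisor_sum 1 1 n = 5 * divisor_power_sum 3 n
     + (1 - 6 * of_nat n) * divisor_power_sum 1 n"
proof -
  define G where "G = (\<lambda>a b. rat_of_nat a ^ 2 + rat_of_nat a * rat_of_nat b + rat_of_nat b ^ 2)"
  define K where "K = (\<lambda>a b. 2 * (rat_of_nat a ^ 1 * rat_of_nat b ^ 1))"
  have S: "(\<Sum>j \<in> {1..<d}. G j (d - j)) = (5 * of_nat d ^ 3 - 6 * of_nat d ^ 2 + of_nat d) / 6"
    if d: "d > 0" for d
  proof -
    have "(\<Sum>j \<in> {1..<d}. G j (d - j)) = (\<Sum>j \<in> {1..<d}. of_nat d ^ 2 - of_nat d * of_nat j + of_nat j ^ 2)"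
      by (rule sum.cong) (auto simp: G_def of_nat_diff algebra_simps power2_eq_square)
    also have "\<dots> = (of_nat d - 1) * of_nat d ^ 2 - of_nat d * (\<Sum>j \<in> {1..<d}. of_nat j) + (\<Sum>j \<in> {1..<d}. of_nat j ^ 2)"
      using d by (simp add: sum.distrib sum_subtractf sum_distrib_left of_nat_diff)
    finally show ?thesis
      unfolding sum_powers_lessThan[OF d] by (simp add: field_simps power_numeral_reduce)
  qed
  have "2 * conv_divisor_sum 1 1 n = (\<Sum>(a, b, x, y) \<in> quads n. K a b)"
    unfolding K_def sum_quads_monomial ..
  also have "\<dots> = (\<Sum>d | d dvd n. (5 * of_nat d ^ 3 - 6 * of_nat d ^ 2 + of_nat d) / 6
      - (rat_of_nat n / rat_of_nat d - 1) * G 0 d)"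
    by (rule skoruppa_conv[OF assms _ _ _ S])
       (auto simp: G_def K_def of_nat_diff algebra_simps power2_eq_square)
  also have "\<dots> = (\<Sum>d | d dvd n. 5 / 6 * rat_of_nat d ^ 3 + (1 / 6 - of_nat n) * rat_of_nat d ^ 1)"
    by (rule divisor_sum_cong[OF assms]) (simp add: G_def field_simps power_numeral_reduce)
  also have "\<dots> = 5 / 6 * divisor_power_sum 3 n + (1 / 6 - of_nat n) * divisor_power_sum 1 n"
    by (simp only: divisor_power_sum_def sum.distrib sum_distrib_left)
  finally show ?thesis by (simp add: algebra_simps)
qed

lemma conv_1_3:
  assumes "n > 0"
  shows "240 * conv_divisor_sum 1 3 n = 21 * divisor_power_sum 5 n
     + (10 - 30 * of_nat n) * divisor_power_sum 3 n - divisor_power_sum 1 n"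
proof -
  define G where "G = (\<lambda>a b. (rat_of_nat a ^ 2 + rat_of_nat a * rat_of_nat b + rat_of_nat b ^ 2) ^ 2)"
  define K where "K = (\<lambda>a b. 4 * (rat_of_nat a ^ 1 * rat_of_nat b ^ 3) + 4 * (rat_of_nat a ^ 3 * rat_of_nat b ^ 1))"
  have S: "(\<Sum>j \<in> {1..<d}. G j (d - j))
     = (21 * of_nat d ^ 5 - 30 * of_nat d ^ 4 + 10 * of_nat d ^ 3 - of_nat d) / 30"
    if d: "d > 0" for d
  proof -
    have "(\<Sum>j \<in> {1..<d}. G j (d - j)) = (\<Sum>j \<in> {1..<d}. of_nat d ^ 4 - (2 * of_nat d ^ 3) * of_nat j
       + (3 * of_nat d ^ 2) * of_nat j ^ 2 - (2 * of_nat d) * of_nat j ^ 3 + of_nat j ^ 4)"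
      by (rule sum.cong) (auto simp: G_def of_nat_diff algebra_simps power_numeral_reduce)
    also have "\<dots> = (of_nat d - 1) * of_nat d ^ 4 - (2 * of_nat d ^ 3) * (\<Sum>j \<in> {1..<d}. of_nat j)
       + (3 * of_nat d ^ 2) * (\<Sum>j \<in> {1..<d}. of_nat j ^ 2) - (2 * of_nat d) * (\<Sum>j \<in> {1..<d}. of_nat j ^ 3)
       + (\<Sum>j \<in> {1..<d}. of_nat j ^ 4)"
      using d unfolding sum_distrib_left by (simp add: sum.distrib sum_subtractf of_nat_diff)
    finally show ?thesis
      unfolding sum_powers_lessThan[OF d] by (simp add: field_simps power_numeral_reduce)
  qed
  have "8 * conv_divisor_sum 1 3 n = 4 * conv_divisor_sum 1 3 n + 4 * conv_divisor_sum 3 1 n"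
    using conv_divisor_sum_commute[of 1 3 n] by simp
  also have "\<dots> = (\<Sum>(a, b, x, y) \<in> quads n. K a b)"
    unfolding K_def sum_quads_monomial[symmetric] sum.distrib[symmetric]
    by (simp add: case_prod_unfold)
  also have "\<dots> = (\<Sum>d | d dvd n. (21 * of_nat d ^ 5 - 30 * of_nat d ^ 4 + 10 * of_nat d ^ 3 - of_nat d) / 30
      - (rat_of_nat n / rat_of_nat d - 1) * G 0 d)"
    by (rule skoruppa_conv[OF assms _ _ _ S])
       (auto simp: G_def K_def of_nat_diff algebra_simps power_numeral_reduce)
  also have "\<dots> = (\<Sum>d | d dvd n. 7 / 10 * rat_of_nat d ^ 5 + (1 / 3 - of_nat n) * rat_of_nat d ^ 3
      + (- 1 / 30) * rat_of_nat d ^ 1)"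
    by (rule divisor_sum_cong[OF assms]) (simp add: G_def field_simps power_numeral_reduce)
  also have "\<dots> = 7 / 10 * divisor_power_sum 5 n + (1 / 3 - of_nat n) * divisor_power_sum 3 n
      + (- 1 / 30) * divisor_power_sum 1 n"
    by (simp only: divisor_power_sum_def sum.distrib sum_distrib_left)
  finally show ?thesis by (simp add: algebra_simps)
qed

lemma conv_3_3:
  assumes "n > 0"
  shows "120 * conv_divisor_sum 3 3 n = divisor_power_sum 7 n - divisor_power_sum 3 n"
proof -
  define G where "G = (\<lambda>a b. rat_of_nat a ^ 2 * rat_of_nat b ^ 2 * (rat_of_nat a + rat_of_nat b) ^ 2)"
  define K where "K = (\<lambda>a b. 4 * (rat_of_nat a ^ 3 * rat_of_nat b ^ 3))"
  have S: "(\<Sum>j \<in> {1..<d}. G j (d - j)) = (of_nat d ^ 7 - of_nat d ^ 3) / 30"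
    if d: "d > 0" for d
  proof -
    have "(\<Sum>j \<in> {1..<d}. G j (d - j)) = (\<Sum>j \<in> {1..<d}. of_nat d ^ 4 * of_nat j ^ 2
       - (2 * of_nat d ^ 3) * of_nat j ^ 3 + of_nat d ^ 2 * of_nat j ^ 4)"
      by (rule sum.cong) (auto simp: G_def of_nat_diff algebra_simps power_numeral_reduce)
    also have "\<dots> = of_nat d ^ 4 * (\<Sum>j \<in> {1..<d}. of_nat j ^ 2)
       - (2 * of_nat d ^ 3) * (\<Sum>j \<in> {1..<d}. of_nat j ^ 3) + of_nat d ^ 2 * (\<Sum>j \<in> {1..<d}. of_nat j ^ 4)"
      unfolding sum_distrib_left by (simp add: sum.distrib sum_subtractf)
    finally show ?thesis
      unfolding sum_powers_lessThan[OF d] by (simp add: field_simps power_numeral_reduce)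
  qed
  have "4 * conv_divisor_sum 3 3 n = (\<Sum>(a, b, x, y) \<in> quads n. K a b)"
    unfolding K_def sum_quads_monomial ..
  also have "\<dots> = (\<Sum>d | d dvd n. (of_nat d ^ 7 - of_nat d ^ 3) / 30
      - (rat_of_nat n / rat_of_nat d - 1) * G 0 d)"
    by (rule skoruppa_conv[OF assms _ _ _ S])
       (auto simp: G_def K_def of_nat_diff algebra_simps power_numeral_reduce)
  also have "\<dots> = (\<Sum>d | d dvd n. 1 / 30 * rat_of_nat d ^ 7 + (- 1 / 30) * rat_of_nat d ^ 3)"
    by (rule divisor_sum_cong[OF assms]) (simp add: G_def field_simps)
  also have "\<dots> = 1 / 30 * divisor_power_sum 7 n + (- 1 / 30) * divisor_power_sum 3 n"
    by (simp only: divisor_power_sum_def sum.distrib sum_distrib_left)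
  finally show ?thesis by (simp add: algebra_simps)
qed

text \<open>
  The cube of \<open>x^2 + x y + y^2\<close> also brings in the convolution of cubes, which \<open>conv_3_3\<close> eliminates.
\<close>

lemma conv_1_5:
  assumes "n > 0"
  shows "504 * conv_divisor_sum 1 5 n = 20 * divisor_power_sum 7 n
     + (21 - 42 * of_nat n) * divisor_power_sum 5 n + divisor_power_sum 1 n"
proof -
  define G where "G = (\<lambda>a b. (rat_of_nat a ^ 2 + rat_of_nat a * rat_of_nat b + rat_of_nat b ^ 2) ^ 3)"
  define K where "K = (\<lambda>a b. 6 * (rat_of_nat a ^ 1 * rat_of_nat b ^ 5) + 14 * (rat_of_nat a ^ 3 * rat_of_nat b ^ 3)
     + 6 * (rat_of_nat a ^ 5 * rat_of_nat b ^ 1))"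
  have S: "(\<Sum>j \<in> {1..<d}. G j (d - j)) = 83 / 140 * of_nat d ^ 7 - of_nat d ^ 6 + of_nat d ^ 5 / 2
      - 7 / 60 * of_nat d ^ 3 + of_nat d / 42"
    if d: "d > 0" for d
  proof -
    have "(\<Sum>j \<in> {1..<d}. G j (d - j)) = (\<Sum>j \<in> {1..<d}. of_nat d ^ 6 - (3 * of_nat d ^ 5) * of_nat j
       + (6 * of_nat d ^ 4) * of_nat j ^ 2 - (7 * of_nat d ^ 3) * of_nat j ^ 3
       + (6 * of_nat d ^ 2) * of_nat j ^ 4 - (3 * of_nat d) * of_nat j ^ 5 + of_nat j ^ 6)"
      by (rule sum.cong) (auto simp: G_def of_nat_diff algebra_simps power_numeral_reduce)
    also have "\<dots> = (of_nat d - 1) * of_nat d ^ 6 - (3 * of_nat d ^ 5) * (\<Sum>j \<in> {1..<d}. of_nat j)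
       + (6 * of_nat d ^ 4) * (\<Sum>j \<in> {1..<d}. of_nat j ^ 2) - (7 * of_nat d ^ 3) * (\<Sum>j \<in> {1..<d}. of_nat j ^ 3)
       + (6 * of_nat d ^ 2) * (\<Sum>j \<in> {1..<d}. of_nat j ^ 4) - (3 * of_nat d) * (\<Sum>j \<in> {1..<d}. of_nat j ^ 5)
       + (\<Sum>j \<in> {1..<d}. of_nat j ^ 6)"
      using d unfolding sum_distrib_left by (simp add: sum.distrib sum_subtractf of_nat_diff)
    finally show ?thesis
      unfolding sum_powers_lessThan[OF d] by (simp add: field_simps power_numeral_reduce)
  qed
  have "12 * conv_divisor_sum 1 5 n + 14 * conv_divisor_sum 3 3 n
      = 6 * conv_divisor_sum 1 5 n + 14 * conv_divisor_sum 3 3 n + 6 * conv_divisor_sum 5 1 n"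
    using conv_divisor_sum_commute[of 1 5 n] by simp
  also have "\<dots> = (\<Sum>(a, b, x, y) \<in> quads n. K a b)"
    unfolding K_def sum_quads_monomial[symmetric] sum.distrib[symmetric]
    by (simp add: case_prod_unfold)
  also have "\<dots> = (\<Sum>d | d dvd n. (83 / 140 * of_nat d ^ 7 - of_nat d ^ 6 + of_nat d ^ 5 / 2
      - 7 / 60 * of_nat d ^ 3 + of_nat d / 42)
      - (rat_of_nat n / rat_of_nat d - 1) * G 0 d)"
    by (rule skoruppa_conv[OF assms _ _ _ S])
       (auto simp: G_def K_def of_nat_diff algebra_simps power_numeral_reduce)
  also have "\<dots> = (\<Sum>d | d dvd n. 83 / 140 * rat_of_nat d ^ 7 + (1 / 2 - of_nat n) * rat_of_nat d ^ 5
      + (- 7 / 60) * rat_of_nat d ^ 3 + 1 / 42 * rat_of_nat d ^ 1)"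
    by (rule divisor_sum_cong[OF assms]) (simp add: G_def field_simps power_numeral_reduce)
  also have "\<dots> = 83 / 140 * divisor_power_sum 7 n + (1 / 2 - of_nat n) * divisor_power_sum 5 n
      + (- 7 / 60) * divisor_power_sum 3 n + 1 / 42 * divisor_power_sum 1 n"
    by (simp only: divisor_power_sum_def sum.distrib sum_distrib_left)
  finally show ?thesis using conv_3_3[OF assms] by (simp add: algebra_simps)
qed

definition qD :: "'a::comm_ring_1 fps \<Rightarrow> 'a fps" where
  "qD f = fps_X * fps_deriv f"

lemma fps_nth_qD [simp]: "fps_nth (qD f) n = of_nat n * fps_nth f n"
  by (cases n) (simp_all add: qD_def)

lemma qD_add: "qD (f + g) = qD f + qD g"
  and qD_diff: "qD (f - g) = qD f - qD g"
  and qD_minus: "qD (- f) = - qD f"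
  and qD_mult: "qD (f * g) = qD f * g + f * qD g"
  and qD_numeral [simp]: "qD (numeral k) = 0"
  and qD_1 [simp]: "qD 1 = 0"
  and qD_0 [simp]: "qD 0 = 0"
  and qD_const [simp]: "qD (fps_const c) = 0"
  by (simp_all add: qD_def algebra_simps)

lemma qD_power: "qD (f ^ n) = of_nat n * f ^ (n - 1) * qD f"
  by (simp add: qD_def fps_deriv_power' algebra_simps)

definition sigma_fps :: "nat \<Rightarrow> rat fps" where
  "sigma_fps k = Abs_fps (divisor_power_sum k)"

definition E2 :: "rat fps" where "E2 = 1 - 24 * sigma_fps 1"
definition E4 :: "rat fps" where "E4 = 1 + 240 * sigma_fps 3"
definition E6 :: "rat fps" where "E6 = 1 - 504 * sigma_fps 5"

lemma sigma_fps_mult: "fps_nth (sigma_fps i * sigma_fps j) n = conv_divisor_sum i j n"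
  by (simp add: fps_mult_nth sigma_fps_def conv_divisor_sum_def atMost_atLeast0)

lemma conv_divisor_sum_0 [simp]: "conv_divisor_sum i j 0 = 0"
  by (simp add: conv_divisor_sum_def)

lemma sigma_fps_conv:
  "12 * (sigma_fps 1 * sigma_fps 1) = 5 * sigma_fps 3 + sigma_fps 1 - 6 * qD (sigma_fps 1)"
  "240 * (sigma_fps 1 * sigma_fps 3) = 21 * sigma_fps 5 + 10 * sigma_fps 3 - 30 * qD (sigma_fps 3) - sigma_fps 1"
  "120 * (sigma_fps 3 * sigma_fps 3) = sigma_fps 7 - sigma_fps 3"
  "504 * (sigma_fps 1 * sigma_fps 5) = 20 * sigma_fps 7 + 21 * sigma_fps 5 - 42 * qD (sigma_fps 5) + sigma_fps 1"
proof -
  have *: "F = G" if "fps_nth F 0 = fps_nth G 0" "\<And>n. n > 0 \<Longrightarrow> fps_nth F n = fps_nth G n" for F G :: "rat fps"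
    using that by (metis fps_ext neq0_conv)
  show "12 * (sigma_fps 1 * sigma_fps 1) = 5 * sigma_fps 3 + sigma_fps 1 - 6 * qD (sigma_fps 1)"
    by (rule *) (simp_all add: sigma_fps_mult fps_numeral_nth numeral_fps_const conv_1_1 del: One_nat_def, simp_all add: sigma_fps_def algebra_simps)
  show "240 * (sigma_fps 1 * sigma_fps 3) = 21 * sigma_fps 5 + 10 * sigma_fps 3 - 30 * qD (sigma_fps 3) - sigma_fps 1"
    by (rule *) (simp_all add: sigma_fps_mult numeral_fps_const conv_1_3 del: One_nat_def, simp_all add: sigma_fps_def algebra_simps)
  show "120 * (sigma_fps 3 * sigma_fps 3) = sigma_fps 7 - sigma_fps 3"
    by (rule *) (simp_all add: sigma_fps_mult numeral_fps_const conv_3_3 del: One_nat_def, simp_all add: sigma_fps_def algebra_simps)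
  show "504 * (sigma_fps 1 * sigma_fps 5) = 20 * sigma_fps 7 + 21 * sigma_fps 5 - 42 * qD (sigma_fps 5) + sigma_fps 1"
    by (rule *) (simp_all add: sigma_fps_mult numeral_fps_const conv_1_5 del: One_nat_def, simp_all add: sigma_fps_def algebra_simps)
qed

lemma ramanujan_odes:
  "12 * qD E2 = E2 ^ 2 - E4"
  "3 * qD E4 = E2 * E4 - E6"
  "2 * qD E6 = E2 * E6 - E4 ^ 2"
proof -
  have "48 * (12 * (sigma_fps 1 * sigma_fps 1)) = 48 * (5 * sigma_fps 3 + sigma_fps 1 - 6 * qD (sigma_fps 1))"
    by (simp only: sigma_fps_conv)
  thus "12 * qD E2 = E2 ^ 2 - E4"
    unfolding E2_def E4_def qD_add qD_diff qD_mult qD_1 qD_numeral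
    by (simp add: algebra_simps power2_eq_square)
  have "24 * (240 * (sigma_fps 1 * sigma_fps 3)) = 24 * (21 * sigma_fps 5 + 10 * sigma_fps 3 - 30 * qD (sigma_fps 3) - sigma_fps 1)"
    by (simp only: sigma_fps_conv)
  thus "3 * qD E4 = E2 * E4 - E6"
    unfolding E2_def E4_def E6_def qD_add qD_diff qD_mult qD_1 qD_numeral
    by (simp add: algebra_simps power2_eq_square)
  have "24 * (504 * (sigma_fps 1 * sigma_fps 5)) = 24 * (20 * sigma_fps 7 + 21 * sigma_fps 5 - 42 * qD (sigma_fps 5) + sigma_fps 1)"
    "480 * (120 * (sigma_fps 3 * sigma_fps 3)) = 480 * (sigma_fps 7 - sigma_fps 3)"
    by (simp_all only: sigma_fps_conv)
  thus "2 * qD E6 = E2 * E6 - E4 ^ 2"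
    unfolding E2_def E4_def E6_def qD_add qD_diff qD_mult qD_1 qD_numeral
    by (simp add: algebra_simps power2_eq_square)
qed

section \<open>Uniqueness for Ramanujan's system\<close>

lemma fps_nth_mult_vanishing_below:
  fixes f g :: "'a::comm_ring_1 fps"
  assumes "\<And>i. i < n \<Longrightarrow> fps_nth f i = 0"
  shows "fps_nth (f * g) n = fps_nth f n * fps_nth g 0"
proof -
  have "fps_nth (f * g) n = (\<Sum>i\<in>{n}. fps_nth f i * fps_nth g (n - i))"
    unfolding fps_mult_nth using assms by (intro sum.mono_neutral_right) auto
  thus ?thesis by simp
qed

lemma fps_nth_mult_diff:
  fixes f g f' g' :: "'a::comm_ring_1 fps"
  assumes "\<And>i. i < n \<Longrightarrow> fps_nth f i = fps_nth f' i" "\<And>i. i < n \<Longrightarrow> fps_nth g i = fps_nth g' i" "n > 0"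
  shows "fps_nth (f * g) n - fps_nth (f' * g') n
    = (fps_nth f n - fps_nth f' n) * fps_nth g 0 + fps_nth f 0 * (fps_nth g n - fps_nth g' n)"
proof -
  have "f * g - f' * g' = (f - f') * g + (g - g') * f'" by (simp add: algebra_simps)
  hence "fps_nth (f * g) n - fps_nth (f' * g') n = fps_nth ((f - f') * g) n + fps_nth ((g - g') * f') n"
    by (metis fps_add_nth fps_sub_nth)
  also have "\<dots> = fps_nth (f - f') n * fps_nth g 0 + fps_nth (g - g') n * fps_nth f' 0"
    using assms by (subst (1 2) fps_nth_mult_vanishing_below) auto
  finally show ?thesis using assms by (simp add: algebra_simps)
qed

definition ramanujan_system :: "rat fps \<Rightarrow> rat fps \<Rightarrow> rat fps \<Rightarrow> bool" where
  "ramanujan_system A B C \<longleftrightarrow>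
     12 * qD A = A ^ 2 - B \<and> 3 * qD B = A * B - C \<and> 2 * qD C = A * C - B ^ 2"

text \<open>
  In the \<open>n\<close>-th coefficients the difference of two solutions satisfies a homogeneous linear system whose
  determinant is proportional to \<open>n^2 (n - l)\<close>. So the only freedom left by the constant terms is at \<open>n = l\<close>, and
  there the coefficient of the discriminant decides.
\<close>

lemma ramanujan_system_unique:
  fixes l :: nat
  assumes S: "ramanujan_system A B C" and S': "ramanujan_system A' B' C'" and l: "l > 0"
    and init: "fps_nth A 0 = of_nat l" "fps_nth B 0 = of_nat l ^ 2" "fps_nth C 0 = of_nat l ^ 3"
    and init': "fps_nth A' 0 = of_nat l" "fps_nth B' 0 = of_nat l ^ 2" "fps_nth C' 0 = of_nat l ^ 3"
    and disc: "fps_nth (B ^ 3 - C ^ 2) l = fps_nth (B' ^ 3 - C' ^ 2) l"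
  shows "A = A' \<and> B = B' \<and> C = C'"
proof -
  have "fps_nth A n = fps_nth A' n \<and> fps_nth B n = fps_nth B' n \<and> fps_nth C n = fps_nth C' n" for n
  proof (induction n rule: less_induct)
    case (less n)
    show ?case
    proof (cases "n = 0")
      case False
      define \<alpha> where "\<alpha> = fps_nth A n - fps_nth A' n"
      define \<beta> where "\<beta> = fps_nth B n - fps_nth B' n"
      define \<gamma> where "\<gamma> = fps_nth C n - fps_nth C' n"
      define L :: rat where "L = of_nat l"
      define N :: rat where "N = of_nat n"
      have L: "L \<noteq> 0" using l by (simp add: L_def)
      have N: "N \<noteq> 0" using False by (simp add: N_def)
      note z = init init'
      have IH: "\<And>i. i < n \<Longrightarrow> fps_nth A i = fps_nth A' i" "\<And>i. i < n \<Longrightarrow> fps_nth B i = fps_nth B' i"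
        "\<And>i. i < n \<Longrightarrow> fps_nth C i = fps_nth C' i" using less by blast+
      have n: "n > 0" using False by simp
      have eqn: "fps_nth F n - fps_nth F' n = fps_nth G n - fps_nth G' n" if "F = G" "F' = G'" for F G F' G' :: "rat fps"
        using that by simp
      note m = fps_nth_mult_diff[OF _ _ n]
      have e1: "12 * N * \<alpha> = 2 * L * \<alpha> - \<beta>"
      proof -
        have "12 * N * \<alpha> = fps_nth (12 * qD A) n - fps_nth (12 * qD A') n"
          by (simp add: numeral_fps_const N_def \<alpha>_def algebra_simps)
        also have "\<dots> = (fps_nth (A * A) n - fps_nth (A' * A') n) - \<beta>"
          using S S' by (simp add: ramanujan_system_def power2_eq_square \<beta>_def)
        finally show ?thesis using m[of A A' A A'] IH z by (simp add: \<alpha>_def L_def algebra_simps)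
      qed
      have e2: "3 * N * \<beta> = L ^ 2 * \<alpha> + L * \<beta> - \<gamma>"
      proof -
        have "3 * N * \<beta> = fps_nth (3 * qD B) n - fps_nth (3 * qD B') n"
          by (simp add: numeral_fps_const N_def \<beta>_def algebra_simps)
        also have "\<dots> = (fps_nth (A * B) n - fps_nth (A' * B') n) - \<gamma>"
          using S S' by (simp add: ramanujan_system_def \<gamma>_def)
        finally show ?thesis using m[of A A' B B'] IH z by (simp add: \<alpha>_def \<beta>_def L_def algebra_simps)
      qed
      have e3: "2 * N * \<gamma> = L ^ 3 * \<alpha> + L * \<gamma> - 2 * L ^ 2 * \<beta>"
      proof -
        have "2 * N * \<gamma> = fps_nth (2 * qD C) n - fps_nth (2 * qD C') n"
          by (simp add: numeral_fps_const N_def \<gamma>_def algebra_simps)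
        also have "\<dots> = (fps_nth (A * C) n - fps_nth (A' * C') n) - (fps_nth (B * B) n - fps_nth (B' * B') n)"
          using S S' by (simp add: ramanujan_system_def power2_eq_square)
        finally show ?thesis using m[of A A' C C'] m[of B B' B B'] IH z
          by (simp add: \<alpha>_def \<beta>_def \<gamma>_def L_def algebra_simps)
      qed
      have "\<beta> = (2 * L - 12 * N) * \<alpha>" using e1 by (simp add: algebra_simps)
      moreover have "\<gamma> = L ^ 2 * \<alpha> + (L - 3 * N) * \<beta>"
        using e2 by (simp add: algebra_simps)
      ultimately have \<beta>\<gamma>: "\<beta> = (2 * L - 12 * N) * \<alpha>" "\<gamma> = (L ^ 2 + (L - 3 * N) * (2 * L - 12 * N)) * \<alpha>"
        by (simp_all only: distrib_right mult.assoc)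
      have "72 * N ^ 2 * (N - L) * \<alpha> = 0"
        using e3 unfolding \<beta>\<gamma> by (simp add: algebra_simps power2_eq_square power3_eq_cube)
      hence "\<alpha> = 0 \<or> N = L" using N by auto
      moreover have "\<alpha> = 0" if NL: "N = L"
      proof -
        have nl: "n = l" using NL by (simp add: N_def L_def)
        have sq: "fps_nth (B * B) n - fps_nth (B' * B') n = 2 * L ^ 2 * \<beta>"
          using m[of B B' B B'] IH z by (simp add: \<beta>_def L_def algebra_simps)
        have lower: "fps_nth (B * B) i = fps_nth (B' * B') i" if "i < n" for i
          unfolding fps_mult_nth using that IH by (intro sum.cong) auto
        have cb: "fps_nth (B * B * B) n - fps_nth (B' * B' * B') n = 3 * L ^ 4 * \<beta>"
          using m[of "B * B" "B' * B'" B B'] IH z lower sq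
          by (simp add: \<beta>_def L_def algebra_simps power_numeral_reduce)
        have sc: "fps_nth (C * C) n - fps_nth (C' * C') n = 2 * L ^ 3 * \<gamma>"
          using m[of C C' C C'] IH z by (simp add: \<gamma>_def L_def algebra_simps)
        have "3 * L ^ 4 * \<beta> = 2 * L ^ 3 * \<gamma>"
          using disc cb sc unfolding nl by (simp add: power2_eq_square power3_eq_cube mult.assoc)
        hence "72 * L ^ 5 * \<alpha> = 0" unfolding \<beta>\<gamma> NL by (simp add: algebra_simps power_numeral_reduce)
        thus ?thesis using L by simp
      qed
      ultimately have "\<alpha> = 0" by blast
      with \<beta>\<gamma> show ?thesis by (simp add: \<alpha>_def \<beta>_def \<gamma>_def)
    qed (use init init' in simp)
  qed
  thus ?thesis by (auto simp: fps_eq_iff)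
qed

lemma ramanujan_system_Eisenstein: "ramanujan_system E2 E4 E6"
  using ramanujan_odes by (simp add: ramanujan_system_def)

subsection \<open>The substitution $q \mapsto q^l$\<close>

definition fps_V :: "nat \<Rightarrow> 'a::comm_ring_1 fps \<Rightarrow> 'a fps" where
  "fps_V l f = Abs_fps (\<lambda>n. if l dvd n then fps_nth f (n div l) else 0)"

lemma fps_V_compose:
  assumes "l > 0"
  shows "fps_V l (f :: 'a::idom fps) = fps_compose f (fps_X ^ l)"
proof (rule fps_ext)
  fix n
  have "fps_nth (fps_compose f (fps_X ^ l)) n = (\<Sum>i = 0..n. fps_nth f i * (if n = l * i then 1 else 0))"
    by (simp add: fps_compose_nth power_mult[symmetric] fps_X_power_nth)
  also have "\<dots> = (\<Sum>i \<in> {i. n = l * i}. fps_nth f i)"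
    by (rule sum.mono_neutral_cong_right) (use assms in auto)
  also have "{i. n = l * i} = (if l dvd n then {n div l} else {})" using assms by auto
  finally show "fps_nth (fps_V l f) n = fps_nth (fps_compose f (fps_X ^ l)) n" by (simp add: fps_V_def)
qed

context
  fixes l :: nat
  assumes l: "l > 0"
begin

lemma fps_V_add: "fps_V l (f + g :: 'a::idom fps) = fps_V l f + fps_V l g"
  and fps_V_diff: "fps_V l (f - g :: 'a::idom fps) = fps_V l f - fps_V l g"
  and fps_V_mult: "fps_V l (f * g :: 'a::idom fps) = fps_V l f * fps_V l g"
  and fps_V_power: "fps_V l (f ^ k :: 'a::idom fps) = fps_V l f ^ k"
  and fps_V_1 [simp]: "fps_V l (1 :: 'a::idom fps) = 1"
  and fps_V_0 [simp]: "fps_V l (0 :: 'a::idom fps) = 0"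
  and fps_V_numeral [simp]: "fps_V l (numeral w :: 'a::idom fps) = numeral w"
  and fps_V_const [simp]: "fps_V l (fps_const c :: 'a::idom fps) = fps_const c"
  and fps_V_X [simp]: "fps_V l (fps_X :: 'a::idom fps) = fps_X ^ l"
  using l by (simp_all add: fps_V_compose fps_compose_add_distrib fps_compose_sub_distrib
    fps_compose_mult_distrib fps_compose_power fps_X_power_nth numeral_fps_const)

lemma fps_V_nth_0 [simp]: "fps_nth (fps_V l f) 0 = fps_nth f 0"
  by (simp add: fps_V_def)

lemma qD_fps_V: "qD (fps_V l f) = of_nat l * fps_V l (qD f)"
  using l by (intro fps_ext) (auto simp: fps_V_def fps_of_nat[symmetric])

lemma fps_V_injective: "fps_V l f = fps_V l g \<Longrightarrow> f = g"
proof (rule fps_ext)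
  fix n assume "fps_V l f = fps_V l g"
  hence "fps_nth (fps_V l f) (l * n) = fps_nth (fps_V l g) (l * n)" by simp
  thus "fps_nth f n = fps_nth g n" using l by (simp add: fps_V_def)
qed

lemma ramanujan_system_fps_V:
  assumes "ramanujan_system A B C"
  shows "ramanujan_system (of_nat l * fps_V l A) (of_nat l ^ 2 * fps_V l B) (of_nat l ^ 3 * fps_V l C)"
proof -
  have "fps_V l (12 * qD A) = fps_V l (A ^ 2 - B)" "fps_V l (3 * qD B) = fps_V l (A * B - C)"
    "fps_V l (2 * qD C) = fps_V l (A * C - B ^ 2)" using assms by (simp_all add: ramanujan_system_def)
  hence *: "12 * fps_V l (qD A) = fps_V l A ^ 2 - fps_V l B" 
    "3 * fps_V l (qD B) = fps_V l A * fps_V l B - fps_V l C"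
    "2 * fps_V l (qD C) = fps_V l A * fps_V l C - fps_V l B ^ 2"
    by (simp_all add: fps_V_add fps_V_diff fps_V_mult fps_V_power)
  have qn: "qD (of_nat l ^ k * f) = of_nat l ^ k * qD f" for k and f :: "rat fps"
    by (rule fps_ext) (simp add: fps_of_nat[symmetric] fps_const_power)
  have "12 * qD (of_nat l * fps_V l A) = of_nat l ^ 2 * (12 * fps_V l (qD A))"
    "3 * qD (of_nat l ^ 2 * fps_V l B) = of_nat l ^ 3 * (3 * fps_V l (qD B))"
    "2 * qD (of_nat l ^ 3 * fps_V l C) = of_nat l ^ 4 * (2 * fps_V l (qD C))"
    using qn[of 1 "fps_V l A"] qn[of 2 "fps_V l B"] qn[of 3 "fps_V l C"]
    by (simp_all add: qD_fps_V power_numeral_reduce algebra_simps)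
  thus ?thesis unfolding ramanujan_system_def *
    by (simp add: power_numeral_reduce algebra_simps)
qed

end

section \<open>An algebraic solution of the transformed system\<close>

lemma qD_inverse:
  fixes a p :: "rat fps"
  assumes "a * p = 1"
  shows "qD p = - (p ^ 2 * qD a)"
proof -
  have "qD (a * p) = 0" by (simp add: assms)
  hence "a * qD p = - (qD a * p)" by (simp add: qD_mult eq_neg_iff_add_eq_0 add.commute)
  hence "p * (a * qD p) = p * (- (qD a * p))" by simp
  hence "(a * p) * qD p = - (p ^ 2 * qD a)" by (simp add: algebra_simps power2_eq_square)
  thus ?thesis using assms by simp
qed

text \<open>
  Here \<open>P, Q, R\<close> are the Eisenstein series, \<open>e\<close> is the logarithmic derivative of the Hauptmodul, and the
  other letters are polynomials in the Hauptmodul, with derivatives \<open>Da e\<close> and so on. The assumptions on \<open>Q\<close>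
  and \<open>R\<close> express them by the Hauptmodul. The new solution stands for the Eisenstein series at \<open>q^l\<close>, and
  \<open>N1, N2, N3\<close> are what its three differential equations become after division by common factors.
\<close>

lemma ramanujan_system_transformed:
  fixes P Q R e a b c h b' d' Da Db Dc Db' Dd' p q l :: "rat fps"
  assumes sys: "ramanujan_system P Q R"
    and qD: "qD a = Da * e" "qD b = Db * e" "qD c = Dc * e" "qD b' = Db' * e" "qD d' = Dd' * e"
      "qD l = 0"
    and nz: "a \<noteq> 0" "b \<noteq> 0" "e \<noteq> 0"
    and p: "a * p = 1" and q: "c * q = 1"
    and Q: "a * c * Q = b * e ^ 2"
    and R: "R * a * b = - (3 * a * Db + b * h) * e * Q"
    and N1: "3 * Db' * a + b' * h = (l - 1) * b' * a - l * d'"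
    and N2: "2 * (l - 1) * (h * c + 3 * Da * c + 3 * Dc * a) - b = (l - 1) ^ 2 * a * c - l ^ 2 * b'"
    and N3: "2 * Dd' * a * c - d' * Da * c + d' * Dc * a + d' * h * c = (l - 1) * d' * a * c - l * b' ^ 2 * a"
  shows "ramanujan_system (P + (l - 1) * e) (l ^ 2 * b' * e ^ 2 * p * q) (l ^ 3 * d' * e ^ 3 * p ^ 2 * q)"
proof -
  have P': "12 * qD P = P ^ 2 - Q" and Q': "3 * qD Q = P * Q - R"
    using sys by (auto simp: ramanujan_system_def)
  have R1: "a * a * c * R = - (3 * a * Db + b * h) * e ^ 3"
  proof -
    have "b * (a * a * c * R) = a * c * (R * a * b)" by (simp add: algebra_simps)
    also have "\<dots> = - (3 * a * Db + b * h) * e * (a * c * Q)" unfolding R by (simp add: algebra_simps)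
    also have "\<dots> = b * (- (3 * a * Db + b * h) * e ^ 3)"
      unfolding Q by (simp add: algebra_simps power2_eq_square power3_eq_cube)
    finally show ?thesis using nz(2) mult_left_cancel by blast
  qed
  have "3 * qD (a * c * Q) = 3 * qD (b * e ^ 2)" using Q by simp
  hence "3 * (Da * c * e * Q + a * Dc * e * Q) + a * c * (3 * qD Q) = 3 * (Db * e ^ 3 + 2 * b * e * qD e)"
    by (simp add: qD_mult qD qD_power algebra_simps power2_eq_square power3_eq_cube)
  hence 1: "3 * (Da * c * e * Q + a * Dc * e * Q) + a * c * (P * Q - R) = 3 * (Db * e ^ 3 + 2 * b * e * qD e)"
    unfolding Q' .
  have "3 * a * (Da * c + a * Dc) * e * (a * c * Q) + a * (a * c) * P * (a * c * Q) - a * c * (a * a * c * R)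
     = a * (a * c) * (3 * (Da * c * e * Q + a * Dc * e * Q) + a * c * (P * Q - R))"
    by (simp add: algebra_simps)
  also have "\<dots> = a * (a * c) * (3 * (Db * e ^ 3 + 2 * b * e * qD e))" unfolding 1 ..
  finally have "(b * e * a) * (6 * a * c * qD e)
      = (b * e * a) * (e * (a * c * P + (h * c + 3 * Da * c + 3 * Dc * a) * e))"
    unfolding R1 Q by (simp add: algebra_simps power2_eq_square power3_eq_cube)
  hence 2: "6 * a * c * qD e = e * (a * c * P + (h * c + 3 * Da * c + 3 * Dc * a) * e)"
    using nz by simp
  have "6 * (a * p) * (c * q) * qD e = p * q * (6 * a * c * qD e)" by (simp add: algebra_simps)
  also have "\<dots> = e * ((a * p) * (c * q) * P + (h * p * (c * q) + 3 * Da * p * (c * q) + 3 * Dc * q * (a * p)) * e)"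
    unfolding 2 by (simp add: algebra_simps)
  finally have w: "6 * qD e = e * P + e ^ 2 * (h * p + 3 * Da * p + 3 * Dc * q)"
    by (simp add: p q algebra_simps power2_eq_square)
  have ap: "qD p = - (p ^ 2 * Da * e)" and cq: "qD q = - (q ^ 2 * Dc * e)"
    using qD_inverse[OF p] qD_inverse[OF q] qD by (simp_all add: algebra_simps)
  have Qpq: "Q = b * e ^ 2 * p * q"
  proof -
    have "Q = (a * p) * (c * q) * Q" by (simp add: p q)
    also have "\<dots> = p * q * (a * c * Q)" by (simp add: algebra_simps)
    finally show ?thesis unfolding Q by (simp add: algebra_simps)
  qed
  have 3: "qD (l - 1) = 0" by (simp add: qD_diff qD)
  have A: "12 * qD (P + (l - 1) * e) = (P + (l - 1) * e) ^ 2 - l ^ 2 * b' * e ^ 2 * p * q"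
  proof -
    have "p * q * (2 * (l - 1) * (h * c + 3 * Da * c + 3 * Dc * a) - b) = p * q * ((l - 1) ^ 2 * a * c - l ^ 2 * b')"
      using N2 by simp
    hence "2 * (l - 1) * (h * p * (c * q) + 3 * Da * p * (c * q) + 3 * Dc * q * (a * p)) - b * p * q
      = (l - 1) ^ 2 * (a * p) * (c * q) - l ^ 2 * b' * p * q" by (simp add: algebra_simps)
    hence N2': "2 * (l - 1) * (h * p + 3 * Da * p + 3 * Dc * q) = (l - 1) ^ 2 - l ^ 2 * b' * p * q + b * p * q"
      by (simp add: p q algebra_simps)
    have "12 * qD (P + (l - 1) * e) = 12 * qD P + 2 * (l - 1) * (6 * qD e)"
      by (simp only: qD_add qD_mult 3) (simp add: algebra_simps)
    also have "\<dots> = P ^ 2 - Q + 2 * (l - 1) * e * P + e ^ 2 * (2 * (l - 1) * (h * p + 3 * Da * p + 3 * Dc * q))"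
      unfolding P' w by (simp add: algebra_simps)
    also have "\<dots> = (P + (l - 1) * e) ^ 2 - l ^ 2 * b' * e ^ 2 * p * q"
      unfolding N2' Qpq by (simp add: algebra_simps power2_eq_square)
    finally show ?thesis .
  qed
  have B: "3 * qD (l ^ 2 * b' * e ^ 2 * p * q) = (P + (l - 1) * e) * (l ^ 2 * b' * e ^ 2 * p * q) - l ^ 3 * d' * e ^ 3 * p ^ 2 * q"
  proof -
    have "p * (3 * Db' * a + b' * h) = p * ((l - 1) * b' * a - l * d')" using N1 by simp
    hence "3 * Db' * (a * p) + b' * h * p = (l - 1) * b' * (a * p) - l * d' * p" by (simp add: algebra_simps)
    hence N1': "3 * Db' = (l - 1) * b' - l * d' * p - b' * h * p" by (simp add: p algebra_simps)
    have "3 * qD (l ^ 2 * b' * e ^ 2 * p * q) = l ^ 2 * p * q * e * ((3 * Db') * e ^ 2 + b' * (6 * qD e)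
        - 3 * b' * e ^ 2 * p * Da - 3 * b' * e ^ 2 * q * Dc)"
      by (simp add: qD_mult qD_power qD ap cq algebra_simps power2_eq_square)
    also have "\<dots> = (P + (l - 1) * e) * (l ^ 2 * b' * e ^ 2 * p * q) - l ^ 3 * d' * e ^ 3 * p ^ 2 * q"
      unfolding N1' w by (simp add: algebra_simps power2_eq_square power3_eq_cube)
    finally show ?thesis .
  qed
  have C: "2 * qD (l ^ 3 * d' * e ^ 3 * p ^ 2 * q) = (P + (l - 1) * e) * (l ^ 3 * d' * e ^ 3 * p ^ 2 * q) - (l ^ 2 * b' * e ^ 2 * p * q) ^ 2"
  proof -
    have "p * q * (2 * Dd' * a * c - d' * Da * c + d' * Dc * a + d' * h * c)
        = p * q * ((l - 1) * d' * a * c - l * b' ^ 2 * a)" using N3 by simp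
    hence "2 * Dd' * (a * p) * (c * q) - d' * Da * p * (c * q) + d' * Dc * q * (a * p) + d' * h * p * (c * q)
        = (l - 1) * d' * (a * p) * (c * q) - l * b' ^ 2 * q * (a * p)" by (simp add: algebra_simps)
    hence N3': "2 * Dd' = d' * Da * p - d' * Dc * q - d' * h * p + (l - 1) * d' - l * b' ^ 2 * q"
      by (simp add: p q algebra_simps)
    have "2 * qD (l ^ 3 * d' * e ^ 3 * p ^ 2 * q) = l ^ 3 * e ^ 2 * p ^ 2 * q * ((2 * Dd') * e ^ 2 + d' * (6 * qD e)
        - 4 * d' * e ^ 2 * p * Da - 2 * d' * e ^ 2 * q * Dc)"
      by (simp add: qD_mult qD_power qD ap cq algebra_simps power_numeral_reduce)
    also have "\<dots> = (P + (l - 1) * e) * (l ^ 3 * d' * e ^ 3 * p ^ 2 * q) - (l ^ 2 * b' * e ^ 2 * p * q) ^ 2"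
      unfolding N3' w by (simp add: algebra_simps power_numeral_reduce)
    finally show ?thesis .
  qed
  show ?thesis using A B C by (simp add: ramanujan_system_def)
qed

section \<open>The Hauptmodul\<close>

lemma ramanujan_system_disc:
  assumes "ramanujan_system P Q R"
  shows "qD (Q ^ 3 - R ^ 2) = P * (Q ^ 3 - R ^ 2)"
proof -
  have "3 * qD Q = P * Q - R" "2 * qD R = P * R - Q ^ 2"
    using assms by (auto simp: ramanujan_system_def)
  moreover have "qD (Q ^ 3 - R ^ 2) = Q ^ 2 * (3 * qD Q) - R * (2 * qD R)"
    by (simp add: qD_diff qD_power algebra_simps)
  ultimately have "qD (Q ^ 3 - R ^ 2) = Q ^ 2 * (P * Q - R) - R * (P * R - Q ^ 2)" by simp
  thus ?thesis by (simp add: algebra_simps power2_eq_square power3_eq_cube)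
qed

lemma E_nth: "fps_nth E2 0 = 1" "fps_nth E4 0 = 1" "fps_nth E6 0 = 1"
  "fps_nth E4 1 = 240" "fps_nth E6 1 = -504"
  by (simp_all add: E2_def E4_def E6_def sigma_fps_def numeral_fps_const divisor_power_sum_def)

lemma E_nz: "E4 \<noteq> 0" "E6 \<noteq> 0"
  using E_nth by auto

lemma E4_E6_disc: "fps_nth (E4 ^ 3 - E6 ^ 2) 0 = 0" "fps_nth (E4 ^ 3 - E6 ^ 2) 1 = 1728"
  by (simp_all add: fps_mult_nth_1 E_nth power2_eq_square power3_eq_cube del: One_nat_def)

text \<open>
  The function on the right of \<open>1 / j = y / \<Phi>(y)\<close> has a compositional inverse, since \<open>\<Phi>\<close> has constant
  term 1.
\<close>

lemma exists_hauptmodul: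
  fixes \<Phi> :: "rat fps"
  assumes "fps_nth \<Phi> 0 = 1"
  shows "\<exists>y. fps_nth y 0 = 0 \<and> fps_nth y 1 = 1
     \<and> (E4 ^ 3 - E6 ^ 2) * fps_compose \<Phi> y = 1728 * y * E4 ^ 3"
proof -
  define \<psi> where "\<psi> = fps_const 1728 * fps_X * inverse \<Phi>"
  define \<Delta> where "\<Delta> = E4 ^ 3 - E6 ^ 2"
  have \<Delta>: "fps_nth \<Delta> 0 = 0" "fps_nth \<Delta> 1 = 1728" using E4_E6_disc by (simp_all only: \<Delta>_def)
  define t where "t = \<Delta> * inverse (E4 ^ 3)"
  define y where "y = fps_compose (fps_inv \<psi>) t"
  have \<psi>0: "fps_nth \<psi> 0 = 0" and \<psi>1: "fps_nth \<psi> 1 = 1728"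
    using assms by (simp_all add: \<psi>_def mult.assoc)
  have t0: "fps_nth t 0 = 0" and t1: "fps_nth t 1 = 1728"
    using \<Delta> by (simp_all add: t_def fps_mult_nth_1 E_nth fps_power_zeroth del: One_nat_def)
  have i0: "fps_nth (fps_inv \<psi>) 0 = 0" by (simp add: fps_inv_def)
  have i1: "fps_nth (fps_inv \<psi>) 1 = 1 / 1728"
    using \<psi>1 by (simp add: fps_inv_def)
  have y0: "fps_nth y 0 = 0" by (simp add: y_def i0)
  have y1: "fps_nth y 1 = 1" using i1 t1 t0 by (simp add: y_def fps_compose_nth)
  have "fps_compose \<psi> y = fps_compose (fps_compose \<psi> (fps_inv \<psi>)) t"
    unfolding y_def using t0 i0 by (simp add: fps_compose_assoc)
  also have "\<dots> = t" using fps_inv_right[of \<psi>] \<psi>0 \<psi>1 t0 by simp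
  finally have "fps_compose \<psi> y = t" .
  moreover have "fps_compose \<psi> y = 1728 * y * inverse (fps_compose \<Phi> y)"
    using y0 assms by (simp add: \<psi>_def fps_compose_mult_distrib fps_inverse_compose numeral_fps_const)
  ultimately have "1728 * y * inverse (fps_compose \<Phi> y) = \<Delta> * inverse (E4 ^ 3)"
    by (simp add: t_def)
  hence "1728 * y * E4 ^ 3 * (inverse (fps_compose \<Phi> y) * fps_compose \<Phi> y)
      = \<Delta> * fps_compose \<Phi> y * (inverse (E4 ^ 3) * E4 ^ 3)"
    by (simp add: algebra_simps)
  moreover have "inverse (fps_compose \<Phi> y) * fps_compose \<Phi> y = 1"
    using assms by (intro inverse_mult_eq_1) simp
  moreover have "inverse (E4 ^ 3) * E4 ^ 3 = 1"
    by (intro inverse_mult_eq_1) (simp add: E_nth)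
  ultimately show ?thesis using y0 y1 unfolding \<Delta>_def by (intro exI[of _ y]) simp
qed

lemma exists_log_derivative:
  fixes y :: "rat fps"
  assumes "fps_nth y 0 = 0" "fps_nth y 1 = 1"
  shows "\<exists>e. qD y = y * e \<and> fps_nth e 0 = 1"
proof -
  define z where "z = fps_shift 1 y"
  have z: "y = fps_X * z" "fps_nth z 0 = 1"
    using assms by (auto simp: z_def fps_eq_iff)
  define e where "e = 1 + qD z * inverse z"
  have "z * inverse z = 1" using z by (simp add: inverse_mult_eq_1')
  moreover have "qD y = fps_X * z + fps_X * qD z" by (simp add: z qD_mult) (simp add: qD_def)
  ultimately have "qD y = y * e" by (simp add: e_def z algebra_simps)
  moreover have "fps_nth e 0 = 1" by (simp add: e_def)
  ultimately show ?thesis by blast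
qed

text \<open>
  The quotient of \<open>a b^3\<close> by \<open>y\<close> is \<open>j\<close>, and that of \<open>c d^2\<close> by \<open>y\<close> is \<open>j - 1728\<close>. The
  logarithmic derivative of \<open>j\<close> is \<open>- R / Q\<close>, and comparing it with the one computed from \<open>y\<close> gives the
  first relation. The second follows from it because \<open>R^2 / Q^3\<close> is the quotient of \<open>j - 1728\<close> and \<open>j\<close>.
\<close>

lemma hauptmodul_relations:
  fixes y e a b c d Da Db Dc P Q R :: "rat fps"
  assumes sys: "ramanujan_system P Q R"
    and nz: "Q \<noteq> 0" "R \<noteq> 0" "b \<noteq> 0" "c \<noteq> 0" "d \<noteq> 0" "Q ^ 3 \<noteq> R ^ 2"
    and y: "(Q ^ 3 - R ^ 2) * (a * b ^ 3) = 1728 * y * Q ^ 3"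
    and e: "qD y = y * e"
    and cd: "a * b ^ 3 - 1728 * y = c * d ^ 2"
    and D: "qD (a * b ^ 3) = (a * b ^ 3 + b ^ 2 * d) * e"
  shows "R * a * b = - d * e * Q" "a * c * Q = b * e ^ 2"
proof -
  define \<Delta> where "\<Delta> = Q ^ 3 - R ^ 2"
  define \<pi> where "\<pi> = a * b ^ 3"
  have \<Delta>: "qD \<Delta> = P * \<Delta>" "\<Delta> \<noteq> 0"
    using ramanujan_system_disc[OF sys] nz by (simp_all add: \<Delta>_def)
  have y': "\<Delta> * \<pi> = 1728 * y * Q ^ 3" using y by (simp add: \<Delta>_def \<pi>_def)
  have Q': "3 * qD Q = P * Q - R" using sys by (simp add: ramanujan_system_def)
  have "qD (\<Delta> * \<pi>) = qD (1728 * y * Q ^ 3)" using y' by simp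
  hence "P * (\<Delta> * \<pi>) + \<Delta> * ((\<pi> + b ^ 2 * d) * e) = e * (1728 * y * Q ^ 3) + 1728 * y * Q ^ 2 * (3 * qD Q)"
    using D[folded \<pi>_def] by (simp add: qD_mult qD_power \<Delta> e algebra_simps)
  also have "\<dots> = e * (1728 * y * Q ^ 3) + P * (1728 * y * Q ^ 3) - 1728 * y * Q ^ 2 * R"
    unfolding Q' by (simp add: algebra_simps power2_eq_square power3_eq_cube)
  also have "\<dots> = e * (\<Delta> * \<pi>) + P * (\<Delta> * \<pi>) - 1728 * y * Q ^ 2 * R" unfolding y' ..
  finally have "\<Delta> * b ^ 2 * d * e = - (1728 * y * Q ^ 2 * R)" by (simp add: algebra_simps eq_neg_iff_add_eq_0)
  hence "Q * (\<Delta> * b ^ 2 * d * e) = Q * (- (1728 * y * Q ^ 2 * R))" by simp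
  hence "\<Delta> * b ^ 2 * (d * e * Q) = - R * (1728 * y * Q ^ 3)"
    by (simp add: algebra_simps power2_eq_square power3_eq_cube)
  also have "\<dots> = \<Delta> * b ^ 2 * (- R * a * b)" unfolding y'[symmetric]
    by (simp add: \<pi>_def algebra_simps power2_eq_square power3_eq_cube)
  finally have "\<Delta> * b ^ 2 * (d * e * Q) = \<Delta> * b ^ 2 * (- R * a * b)" .
  moreover have "\<Delta> * b ^ 2 \<noteq> 0" using \<Delta> nz by simp
  ultimately have 1: "d * e * Q = - R * a * b" using mult_left_cancel by blast
  thus "R * a * b = - d * e * Q" by simp
  have "1728 * y = \<pi> - c * d ^ 2" using cd by (simp add: \<pi>_def algebra_simps)
  hence "(Q ^ 3 - R ^ 2) * \<pi> = (\<pi> - c * d ^ 2) * Q ^ 3"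
    using y' by (simp only: \<Delta>_def)
  hence 2: "R ^ 2 * \<pi> = c * d ^ 2 * Q ^ 3" by (simp add: algebra_simps)
  have "d ^ 2 * Q ^ 2 * (b * e ^ 2) = b * (d * e * Q) ^ 2" by (simp add: algebra_simps power2_eq_square)
  also have "\<dots> = a * (R ^ 2 * \<pi>)" unfolding 1 by (simp add: \<pi>_def algebra_simps power2_eq_square power3_eq_cube)
  also have "\<dots> = d ^ 2 * Q ^ 2 * (a * c * Q)" unfolding 2 by (simp add: algebra_simps power2_eq_square power3_eq_cube)
  finally have "b * e ^ 2 = a * c * Q" using nz by simp
  thus "a * c * Q = b * e ^ 2" by simp
qed

text \<open>
  The transformed system has the constant terms and the discriminant coefficient of the Eisenstein series at
  \<open>q^l\<close>, hence coincides with them. The first components give the first conclusion, the other two the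
  value of \<open>j(q^l)\<close> as \<open>a b'^3 / y^l\<close>, and the defining equation of \<open>y\<close> at \<open>q^l\<close> gives it a second time.
\<close>

lemma hauptmodul_isogeny:
  fixes y e a b c d h b' d' Da Db Dc Db' Dd' :: "rat fps" and l :: nat
  assumes l: "l > 0"
    and y0: "fps_nth y 0 = 0" "fps_nth y 1 = 1"
    and y: "(E4 ^ 3 - E6 ^ 2) * (a * b ^ 3) = 1728 * y * E4 ^ 3"
    and e: "qD y = y * e" "fps_nth e 0 = 1"
    and qD: "qD a = Da * e" "qD b = Db * e" "qD c = Dc * e" "qD b' = Db' * e" "qD d' = Dd' * e"
    and nth_0: "fps_nth a 0 = 1" "fps_nth b 0 = 1" "fps_nth c 0 = 1" "fps_nth d 0 = -1" 
      "fps_nth b' 0 = 1" "fps_nth d' 0 = 1"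
    and cd: "a * b ^ 3 - 1728 * y = c * d ^ 2"
    and h: "3 * a * Db + b * h = d"
    and D: "Da * b + 3 * a * Db = a * b + d"
    and N1: "3 * Db' * a + b' * h = (of_nat l - 1) * b' * a - of_nat l * d'"
    and N2: "2 * (of_nat l - 1) * (h * c + 3 * Da * c + 3 * Dc * a) - b
       = (of_nat l - 1) ^ 2 * a * c - of_nat l ^ 2 * b'"
    and N3: "2 * Dd' * a * c - d' * Da * c + d' * Dc * a + d' * h * c
       = (of_nat l - 1) * d' * a * c - of_nat l * b' ^ 2 * a"
    and N4: "a * b' ^ 3 - c * d' ^ 2 = 1728 * y ^ l"
  shows "of_nat l * fps_V l E2 = E2 + (of_nat l - 1) * e"
    and "y ^ l * fps_V l (a * b ^ 3) = fps_V l y * (a * b' ^ 3)"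
proof -
  define p where "p = inverse a"
  define q where "q = inverse c"
  have p: "a * p = 1" "fps_nth p 0 = 1" using nth_0 by (simp_all add: p_def inverse_mult_eq_1')
  have q: "c * q = 1" "fps_nth q 0 = 1" using nth_0 by (simp_all add: q_def inverse_mult_eq_1')
  have nz: "a \<noteq> 0" "b \<noteq> 0" "c \<noteq> 0" "d \<noteq> 0" "e \<noteq> 0" "b' \<noteq> 0" using nth_0 e by auto
  have E46: "E4 ^ 3 \<noteq> E6 ^ 2"
  proof
    assume "E4 ^ 3 = E6 ^ 2"
    hence "fps_nth (E4 ^ 3 - E6 ^ 2) 1 = 0" by (simp del: fps_sub_nth)
    thus False using E4_E6_disc(2) by linarith
  qed
  have D': "qD (a * b ^ 3) = (a * b ^ 3 + b ^ 2 * d) * e"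
  proof -
    have "qD (a * b ^ 3) = b ^ 2 * (Da * b + 3 * a * Db) * e"
      by (simp add: qD_mult qD_power qD algebra_simps power2_eq_square power3_eq_cube)
    thus ?thesis unfolding D by (simp add: algebra_simps power2_eq_square power3_eq_cube)
  qed
  note rel = hauptmodul_relations[OF ramanujan_system_Eisenstein E_nz nz(2-4) E46 y e(1) cd D']
  have R: "E6 * a * b = - (3 * a * Db + b * h) * e * E4" unfolding h by (rule rel(1))
  have Q: "a * c * E4 = b * e ^ 2" by (rule rel(2))
  define A where "A = E2 + (of_nat l - 1) * e"
  define B where "B = of_nat l ^ 2 * b' * e ^ 2 * p * q"
  define C where "C = of_nat l ^ 3 * d' * e ^ 3 * p ^ 2 * q"
  define \<Lambda> :: "rat fps" where "\<Lambda> = of_nat l"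
  have ofnat: "(of_nat k :: rat fps) = fps_const (of_nat k)" for k by (rule fps_of_nat[symmetric])
  have ql: "qD (of_nat l :: rat fps) = 0" unfolding ofnat by (rule qD_const)
  have sys: "ramanujan_system A B C"
    unfolding A_def B_def C_def
    by (rule ramanujan_system_transformed[OF ramanujan_system_Eisenstein qD ql nz(1,2,5) p(1) q(1) Q R N1 N2 N3])
  have disc: "B ^ 3 - C ^ 2 = of_nat l ^ 6 * e ^ 6 * p ^ 4 * q ^ 3 * (1728 * y ^ l)"
  proof -
    have "B ^ 3 - C ^ 2 = (a * p) * B ^ 3 - (c * q) * C ^ 2" unfolding p q by simp
    also have "\<dots> = of_nat l ^ 6 * e ^ 6 * p ^ 4 * q ^ 3 * (a * b' ^ 3 - c * d' ^ 2)"
      by (simp add: B_def C_def algebra_simps power_numeral_reduce)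
    finally show ?thesis unfolding N4 .
  qed
  obtain z where z: "y = fps_X * z" "fps_nth z 0 = 1"
  proof -
    have "y = fps_X * fps_shift 1 y" "fps_nth (fps_shift 1 y) 0 = 1"
      using y0 by (auto simp: fps_eq_iff)
    thus ?thesis using that by blast
  qed
  have d1: "fps_nth (B ^ 3 - C ^ 2) l = 1728 * of_nat l ^ 6"
  proof -
    have "B ^ 3 - C ^ 2 = fps_X ^ l * (fps_const (1728 * of_nat l ^ 6) * (e ^ 6 * p ^ 4 * q ^ 3 * z ^ l))"
    proof -
      have "fps_const (1728 * of_nat l ^ 6) = (1728 * of_nat l ^ 6 :: rat fps)"
        by (simp add: numeral_fps_const ofnat del: fps_of_nat)
      thus ?thesis unfolding disc z by (simp only: power_mult_distrib) (simp add: algebra_simps)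
    qed
    thus ?thesis by (simp add: fps_X_power_mult_nth fps_power_zeroth e p q z del: fps_const_mult)
  qed
  have d2: "(of_nat l ^ 2 * fps_V l E4) ^ 3 - (of_nat l ^ 3 * fps_V l E6) ^ 2 = of_nat l ^ 6 * fps_V l (E4 ^ 3 - E6 ^ 2)"
    using l by (simp add: fps_V_diff fps_V_power algebra_simps power_mult_distrib power_mult[symmetric])
  have "fps_nth (of_nat l ^ 6 * fps_V l (E4 ^ 3 - E6 ^ 2)) l = of_nat l ^ 6 * fps_nth (fps_V l (E4 ^ 3 - E6 ^ 2)) l"
    by (simp only: ofnat fps_const_power fps_mult_left_const_nth)
  also have "\<dots> = 1728 * of_nat l ^ 6"
    using l E4_E6_disc(2) by (simp add: fps_V_def)
  finally have d3: "fps_nth ((of_nat l ^ 2 * fps_V l E4) ^ 3 - (of_nat l ^ 3 * fps_V l E6) ^ 2) l = 1728 * of_nat l ^ 6"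
    unfolding d2 .
  have "A = of_nat l * fps_V l E2 \<and> B = of_nat l ^ 2 * fps_V l E4 \<and> C = of_nat l ^ 3 * fps_V l E6"
  proof (rule ramanujan_system_unique[OF sys ramanujan_system_fps_V[OF l ramanujan_system_Eisenstein] l])
    show "fps_nth (B ^ 3 - C ^ 2) l
        = fps_nth ((of_nat l ^ 2 * fps_V l E4) ^ 3 - (of_nat l ^ 3 * fps_V l E6) ^ 2) l"
      unfolding d1 d3 ..
  qed (use l in \<open>simp_all add: fps_power_zeroth A_def B_def C_def E_nth e nth_0 p q\<close>)
  hence ABC: "A = of_nat l * fps_V l E2" "B = of_nat l ^ 2 * fps_V l E4" "C = of_nat l ^ 3 * fps_V l E6"
    by blast+
  from ABC(1) show "of_nat l * fps_V l E2 = E2 + (of_nat l - 1) * e" by (simp add: A_def)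
  define \<Delta> where "\<Delta> = fps_V l (E4 ^ 3 - E6 ^ 2)"
  define F where "F = fps_V l E4 ^ 3"
  have l_nz: "(of_nat l :: rat fps) \<noteq> 0" using l by simp
  have F_nz: "F \<noteq> 0" 
  proof -
    have "fps_nth (fps_V l E4) 0 \<noteq> 0" by (simp add: fps_V_nth_0[OF l] E_nth)
    hence "fps_V l E4 \<noteq> 0" by (metis fps_zero_nth)
    thus ?thesis by (simp add: F_def)
  qed
  have \<Delta>_nz: "\<Delta> \<noteq> 0"
    unfolding \<Delta>_def using fps_V_injective[OF l, of "E4 ^ 3 - E6 ^ 2" 0] fps_V_0[OF l] E46 right_minus_eq by metis
  have "of_nat l ^ 6 * (\<Delta> * (a * b' ^ 3)) = (B ^ 3 - C ^ 2) * (a * b' ^ 3)"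
    unfolding ABC \<Delta>_def d2 by (simp add: algebra_simps)
  also have "\<dots> = (a * p) * (1728 * y ^ l * B ^ 3)"
    unfolding disc unfolding B_def by (simp add: algebra_simps power_numeral_reduce)
  also have "\<dots> = of_nat l ^ 6 * (1728 * y ^ l * F)"
    unfolding p ABC F_def by (simp add: algebra_simps power_mult_distrib power_mult[symmetric])
  finally have 1: "\<Delta> * (a * b' ^ 3) = 1728 * y ^ l * F" using l_nz by simp
  have "fps_V l ((E4 ^ 3 - E6 ^ 2) * (a * b ^ 3)) = fps_V l (1728 * y * E4 ^ 3)" using y by simp
  hence 2: "\<Delta> * fps_V l (a * b ^ 3) = 1728 * fps_V l y * F"
    by (simp add: \<Delta>_def F_def fps_V_mult[OF l] fps_V_power[OF l] fps_V_numeral[OF l])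
  have "(\<Delta> * 1728 * F) * (y ^ l * fps_V l (a * b ^ 3)) = (1728 * y ^ l * F) * (\<Delta> * fps_V l (a * b ^ 3))"
    by (simp add: algebra_simps)
  also have "\<dots> = (\<Delta> * 1728 * F) * (fps_V l y * (a * b' ^ 3))"
    unfolding 1[symmetric] 2 by (simp add: algebra_simps)
  finally show "y ^ l * fps_V l (a * b ^ 3) = fps_V l y * (a * b' ^ 3)"
    using F_nz \<Delta>_nz by simp
qed

section \<open>Integer polynomials in two variables as lists of coefficients\<close>

fun ladd :: "int list \<Rightarrow> int list \<Rightarrow> int list" where
  "ladd [] ys = ys"
| "ladd xs [] = xs"
| "ladd (x # xs) (y # ys) = (x + y) # ladd xs ys"

fun lmul :: "int list \<Rightarrow> int list \<Rightarrow> int list" where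
  "lmul [] ys = []"
| "lmul (x # xs) ys = (if x = 0 then 0 # lmul xs ys else ladd (map ((*) x) ys) (0 # lmul xs ys))"

fun lladd :: "int list list \<Rightarrow> int list list \<Rightarrow> int list list" where
  "lladd [] ys = ys"
| "lladd xs [] = xs"
| "lladd (x # xs) (y # ys) = ladd x y # lladd xs ys"

fun llmul :: "int list list \<Rightarrow> int list list \<Rightarrow> int list list" where
  "llmul [] ys = []"
| "llmul (x # xs) ys = (if x = [] then [] # llmul xs ys else lladd (map (lmul x) ys) ([] # llmul xs ys))"

definition leval :: "'a::comm_ring_1 \<Rightarrow> int list \<Rightarrow> 'a" where
  "leval x cs = foldr (\<lambda>c s. of_int c + x * s) cs 0"

definition lleval :: "'a::comm_ring_1 \<Rightarrow> 'a \<Rightarrow> int list list \<Rightarrow> 'a" where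
  "lleval p x css = foldr (\<lambda>c s. leval x c + p * s) css 0"

lemma leval_simps [simp]: "leval x [] = 0" "leval x (c # cs) = of_int c + x * leval x cs"
  by (simp_all add: leval_def)

lemma lleval_simps [simp]: "lleval p x [] = 0" "lleval p x (c # cs) = leval x c + p * lleval p x cs"
  by (simp_all add: lleval_def)

lemma leval_ladd [simp]: "leval x (ladd a b) = leval x a + leval x b"
  by (induction a b rule: ladd.induct) (simp_all add: algebra_simps)

lemma leval_map_mult [simp]: "leval x (map ((*) c) b) = of_int c * leval x b"
  by (induction b) (simp_all add: algebra_simps)

lemma leval_lmul [simp]: "leval x (lmul a b) = leval x a * leval x b"
  by (induction a b rule: lmul.induct) (simp_all add: algebra_simps)

lemma lleval_lladd [simp]: "lleval p x (lladd a b) = lleval p x a + lleval p x b"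
  by (induction a b rule: lladd.induct) (simp_all add: algebra_simps)

lemma lleval_map_lmul [simp]: "lleval p x (map (lmul c) b) = leval x c * lleval p x b"
  by (induction b) (simp_all add: algebra_simps)

lemma lleval_llmul [simp]: "lleval p x (llmul a b) = lleval p x a * lleval p x b"
  by (induction a b rule: llmul.induct) (simp_all add: algebra_simps)

text \<open>
  A comparison by the difference, because the lists may carry trailing zeros.
\<close>

definition same_values :: "int list list \<Rightarrow> int list list \<Rightarrow> bool" where
  "same_values a b \<longleftrightarrow> list_all (list_all (\<lambda>c. c = 0)) (lladd a (llmul [[- 1]] b))"

lemma same_valuesD:
  assumes "same_values a b"
  shows "lleval p x a = lleval p x b"
proof -
  have 1: "leval x c = 0" if "list_all (\<lambda>c. c = 0) c" for c using that by (induction c) simp_all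
  have "lleval p x c = 0" if "list_all (list_all (\<lambda>c. c = 0)) c" for c
    using that by (induction c) (simp_all add: 1)
  from this[OF assms[unfolded same_values_def]] show ?thesis by simp
qed

declare lmul.simps [simp del] llmul.simps [simp del] ladd.simps [simp del] lladd.simps [simp del]

definition same_list :: "int list \<Rightarrow> int list \<Rightarrow> bool" where
  "same_list xs ys \<longleftrightarrow> list_all (\<lambda>c. c = 0) (ladd xs (map ((*) (- 1)) ys))"

lemma same_listD:
  assumes "same_list xs ys"
  shows "leval x xs = leval x ys"
proof -
  have "leval x c = 0" if "list_all (\<lambda>c. c = 0) c" for c using that by (induction c) simp_all
  from this[OF assms[unfolded same_list_def]] show ?thesis by simp
qed

text \<open>
  With \<open>k = 0\<close> the derivation \<open>y d/dy\<close> on lists of coefficients.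
\<close>

fun euler_deriv :: "int \<Rightarrow> int list \<Rightarrow> int list" where
  "euler_deriv k [] = []"
| "euler_deriv k (c # cs) = (k * c) # euler_deriv (k + 1) cs"

lemma leval_euler_deriv_Suc: "leval x (euler_deriv (k + 1) cs) = leval x (euler_deriv k cs) + leval x cs"
proof (induction cs arbitrary: k)
  case (Cons c cs)
  show ?case by (simp only: euler_deriv.simps leval_simps Cons.IH) (simp add: algebra_simps)
qed simp

lemma qD_leval:
  assumes "qD y = y * e"
  shows "qD (leval y cs) = leval y (euler_deriv 0 cs) * e"
proof (induction cs)
  case (Cons c cs)
  have "qD (of_int c) = 0" unfolding fps_of_int[symmetric] by (rule qD_const)
  hence "qD (leval y (c # cs)) = y * (leval y (euler_deriv 0 cs) + leval y cs) * e"
    using Cons assms by (simp add: qD_add qD_mult algebra_simps)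
  thus ?case using leval_euler_deriv_Suc[of y 0 cs] by simp
qed simp

text \<open>
  The lists are the polynomials in the Hauptmodul \<open>y\<close> that occur in \<open>hauptmodul_isogeny\<close>. The quotients of
  \<open>a b^3\<close> and \<open>c d^2\<close> by \<open>y\<close> are \<open>j\<close> and \<open>j - 1728\<close>. The Fricke involution sends \<open>y\<close> to
  \<open>1 / (M y)\<close> with \<open>M = l^(12/(l-1))\<close>; up to constants and powers of \<open>y\<close> it fixes \<open>a\<close> and \<open>c\<close>, and it maps
  \<open>b\<close> and \<open>d\<close> to \<open>b'\<close> and \<open>d'\<close>. The auxiliary \<open>h\<close> is a quotient that turns divisibilities into equations.
\<close>

definition isogeny_data :: "nat \<Rightarrow> int list \<Rightarrow> int list \<Rightarrow> int list \<Rightarrow> int list \<Rightarrow> int list \<Rightarrow> int list \<Rightarrow> int list \<Rightarrow> bool" where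
  "isogeny_data l a b c d h b' d' \<longleftrightarrow>
    map (\<lambda>xs. take 1 xs) [a, b, c, d, b', d'] = [[1], [1], [1], [- 1], [1], [1]] \<and>
    same_list (lmul a (lmul b (lmul b b))) (ladd [0, 1728] (lmul c (lmul d d))) \<and>
    same_list (ladd (lmul [3] (lmul a (euler_deriv 0 b))) (lmul b h)) d \<and>
    same_list (ladd (lmul (euler_deriv 0 a) b) (lmul [3] (lmul a (euler_deriv 0 b)))) (ladd (lmul a b) d) \<and>
    same_list (ladd (ladd (lmul [3] (lmul (euler_deriv 0 b') a)) (lmul b' h)) (lmul [int l] d')) (lmul [int l - 1] (lmul b' a)) \<and>
    same_list (ladd (lmul [2 * (int l - 1)] (ladd (lmul h c) (ladd (lmul [3] (lmul (euler_deriv 0 a) c)) (lmul [3] (lmul (euler_deriv 0 c) a)))))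
        (lmul [int l ^ 2] b')) (ladd b (lmul [(int l - 1) ^ 2] (lmul a c))) \<and>
    same_list (ladd (ladd (lmul [2] (lmul (euler_deriv 0 d') (lmul a c))) (lmul [- 1] (lmul d' (lmul (euler_deriv 0 a) c))))
        (ladd (ladd (lmul d' (lmul (euler_deriv 0 c) a)) (lmul d' (lmul h c))) (lmul [int l] (lmul b' (lmul b' a)))))
        (lmul [int l - 1] (lmul d' (lmul a c))) \<and>
    same_list (lmul a (lmul b' (lmul b' b'))) (ladd (replicate l 0 @ [1728]) (lmul c (lmul d' d')))"

lemma leval_single: "leval x (replicate n 0 @ [c]) = of_int c * x ^ n"
  by (induction n) (simp_all add: algebra_simps)

lemma hauptmodul_exists:
  assumes l: "l > 0" and data: "isogeny_data l a b c d h b' d'"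
  shows "\<exists>y e :: rat fps. fps_nth y 0 = 0 \<and> fps_nth y 1 = 1 \<and> qD y = y * e
     \<and> of_nat l * fps_V l E2 = E2 + (of_nat l - 1) * e
     \<and> y ^ l * fps_V l (leval y a * leval y b ^ 3) = fps_V l y * (leval y a * leval y b' ^ 3)"
proof -
  have nth_0: "fps_nth (leval y xs) 0 = of_int v" if "take 1 xs = [v]" "fps_nth y 0 = 0" for y :: "rat fps" and xs v
    using that by (cases xs) auto
  have heads: "take 1 a = [1]" "take 1 b = [1]" "take 1 c = [1]" "take 1 d = [- 1]" "take 1 b' = [1]" "take 1 d' = [1]"
    using data by (simp_all add: isogeny_data_def)
  define \<Phi> :: "rat fps" where "\<Phi> = leval fps_X a * leval fps_X b ^ 3"
  have "fps_nth \<Phi> 0 = 1"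
    using nth_0[OF heads(1), of fps_X] nth_0[OF heads(2), of fps_X] by (simp add: \<Phi>_def fps_power_zeroth)
  from exists_hauptmodul[OF this] obtain y where y: "fps_nth y 0 = 0" "fps_nth y 1 = 1"
    "(E4 ^ 3 - E6 ^ 2) * fps_compose \<Phi> y = 1728 * y * E4 ^ 3" by blast
  obtain e where e: "qD y = y * e" "fps_nth e 0 = 1" using exists_log_derivative[OF y(1,2)] by blast
  have comp: "fps_compose (leval fps_X xs) y = leval y xs" for xs
  proof (induction xs)
    case (Cons v xs)
    have "fps_compose (of_int v) y = of_int v" unfolding fps_of_int[symmetric] by simp
    thus ?case using Cons y(1) by (simp add: fps_compose_add_distrib fps_compose_mult_distrib)
  qed simp
  have \<Phi>: "fps_compose \<Phi> y = leval y a * leval y b ^ 3"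
    using y(1) by (simp add: \<Phi>_def comp fps_compose_mult_distrib fps_compose_power[symmetric])
  note D = data[unfolded isogeny_data_def, THEN conjunct2]
  note [simp] = power2_eq_square power3_eq_cube algebra_simps
  have 1: "leval y a * leval y b ^ 3 - 1728 * y = leval y c * leval y d ^ 2"
    using D[THEN conjunct1, THEN same_listD, of y] by simp
  have 2: "3 * leval y a * leval y (euler_deriv 0 b) + leval y b * leval y h = leval y d"
    using D[THEN conjunct2, THEN conjunct1, THEN same_listD, of y] by simp
  have 3: "leval y (euler_deriv 0 a) * leval y b + 3 * leval y a * leval y (euler_deriv 0 b) = leval y a * leval y b + leval y d"
    using D[THEN conjunct2, THEN conjunct2, THEN conjunct1, THEN same_listD, of y] by simp
  note D' = D[THEN conjunct2, THEN conjunct2, THEN conjunct2]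
  have 4: "3 * leval y (euler_deriv 0 b') * leval y a + leval y b' * leval y h
      = (of_nat l - 1) * leval y b' * leval y a - of_nat l * leval y d'"
    using D'[THEN conjunct1, THEN same_listD, of y] by (simp add: eq_diff_eq)
  have 5: "2 * (of_nat l - 1) * (leval y h * leval y c + 3 * leval y (euler_deriv 0 a) * leval y c
        + 3 * leval y (euler_deriv 0 c) * leval y a) - leval y b
      = (of_nat l - 1) ^ 2 * leval y a * leval y c - of_nat l ^ 2 * leval y b'"
    using D'[THEN conjunct2, THEN conjunct1, THEN same_listD, of y] by (simp add: eq_diff_eq diff_eq_eq)
  have 6: "2 * leval y (euler_deriv 0 d') * leval y a * leval y c - leval y d' * leval y (euler_deriv 0 a) * leval y c
        + leval y d' * leval y (euler_deriv 0 c) * leval y a + leval y d' * leval y h * leval y c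
      = (of_nat l - 1) * leval y d' * leval y a * leval y c - of_nat l * leval y b' ^ 2 * leval y a"
    using D'[THEN conjunct2, THEN conjunct2, THEN conjunct1, THEN same_listD, of y] by (simp add: eq_diff_eq diff_eq_eq)
  have 7: "leval y a * leval y b' ^ 3 - leval y c * leval y d' ^ 2 = 1728 * y ^ l"
    using D'[THEN conjunct2, THEN conjunct2, THEN conjunct2, THEN same_listD, of y] by (simp add: leval_single)
  note n = nth_0[OF _ y(1)]
  have n0: "fps_nth (leval y a) 0 = 1" "fps_nth (leval y b) 0 = 1" "fps_nth (leval y c) 0 = 1"
    "fps_nth (leval y d) 0 = - 1" "fps_nth (leval y b') 0 = 1" "fps_nth (leval y d') 0 = 1"
    using n[OF heads(1)] n[OF heads(2)] n[OF heads(3)] n[OF heads(4)] n[OF heads(5)] n[OF heads(6)] by simp_all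
  note * = hauptmodul_isogeny[OF l y(1,2) y(3)[unfolded \<Phi>] e qD_leval[OF e(1)] qD_leval[OF e(1)] qD_leval[OF e(1)]
    qD_leval[OF e(1)] qD_leval[OF e(1)] n0 1 2 3 4 5 6 7]
  show ?thesis using y(1,2) e(1) * by (intro exI[of _ y] exI[of _ e] conjI)
qed

lemma isogeny_data_5:
  "isogeny_data 5 [1] [1, 250, 3125] [1, 22, 125]
     [-1, 500, 15625] [-1] [1, 10, 5] [1, 4, -1]"
  by code_simp

lemma isogeny_data_7:
  "isogeny_data 7 [1, 13, 49] [1, 245, 2401] [1]
     [-1, 490, 21609, 235298, 823543] [-1, 0, 49] [1, 5, 1] [1, 14, 63, 70, -7]"
  by code_simp

lemma isogeny_data_13:
  "isogeny_data 13 [1, 5, 13] [1, 247, 3380, 15379, 28561] [1, 6, 13]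
     [-1, 494, 20618, 237276, 1313806, 3712930, 4826809] [-1, 0, 13] [1, 7, 20, 19, 1] [1, 10, 46, 108, 122, 38, -1]"
  by code_simp

section \<open>Powers of Euler's product\<close>

lemma fps_powi_diff:
  fixes u :: "rat fps"
  assumes "fps_nth u 0 \<noteq> 0"
  shows "u powi (int n - int m) = u ^ n * inverse u ^ m"
proof -
  have uw: "u ^ k * inverse u ^ k = 1" for k
    using assms by (simp add: power_mult_distrib[symmetric] inverse_mult_eq_1')
  show ?thesis
  proof (cases "n \<ge> m")
    case True
    then obtain k where k: "n = m + k" using le_iff_add by auto
    have "u powi (int n - int m) = u ^ k" by (simp add: power_int_def k)
    also have "\<dots> = u ^ k * (u ^ m * inverse u ^ m)" by (simp add: uw)
    finally show ?thesis by (simp add: k power_add algebra_simps)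
  next
    case False
    then obtain k where k: "m = n + k" "k > 0" using less_imp_add_positive[of n m] by auto
    have "u powi (int n - int m) = inverse u ^ k" using k by (simp add: power_int_def)
    also have "\<dots> = (u ^ n * inverse u ^ n) * inverse u ^ k" by (simp add: uw)
    finally show ?thesis by (simp add: k power_add algebra_simps)
  qed
qed

lemma fps_powi_add:
  fixes u :: "rat fps"
  assumes "fps_nth u 0 \<noteq> 0"
  shows "u powi (a + b) = u powi a * u powi b"
proof -
  obtain n m n' m' where "a = int n - int m" "b = int n' - int m'"
    by (metis int_diff_cases)
  moreover have "int n - int m + (int n' - int m') = int (n + n') - int (m + m')" by simp
  ultimately show ?thesis
    unfolding fps_powi_diff[OF assms] by (simp only: fps_powi_diff[OF assms] power_add) (simp add: algebra_simps)
qed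

lemma fps_powi_inverse:
  fixes u :: "rat fps"
  assumes "fps_nth u 0 \<noteq> 0"
  shows "inverse (u powi a) = u powi (- a)"
proof -
  have "u powi a * u powi (- a) = 1" by (simp add: fps_powi_add[OF assms, symmetric])
  thus ?thesis by (rule fps_inverse_unique)
qed

lemma fps_V_powi:
  fixes u :: "rat fps"
  assumes "l > 0" "fps_nth u 0 \<noteq> 0"
  shows "fps_V l (u powi a) = fps_V l u powi a"
proof -
  have "fps_V l u * fps_V l (inverse u) = 1"
    unfolding fps_V_mult[OF assms(1), symmetric] using assms by (simp add: inverse_mult_eq_1' fps_V_1[OF assms(1)])
  hence "inverse (fps_V l u) = fps_V l (inverse u)" by (rule fps_inverse_unique)
  thus ?thesis by (simp add: power_int_def fps_V_power[OF assms(1)])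
qed

lemma two_colour_gf_nth:
  assumes "l > 0" "N \<ge> j"
  shows "fps_nth (two_colour_gf l c d) j = fps_nth (\<Prod>m\<le>N. two_colour_factor l c d (Suc m)) j"
proof -
  have "raw_has_prod (\<lambda>m. two_colour_factor l c d (Suc m)) 0 (two_colour_gf l c d) \<or>
      (\<exists>i. two_colour_factor l c d (Suc i) = 0)"
    using two_colour_has_prod[OF assms(1)] by (auto simp: has_prod_def)
  moreover have "two_colour_factor l c d (Suc i) \<noteq> 0" for i
    using fps_one_upto_nth_0[OF fps_one_upto_factor[of "Suc i" l c d]] assms by auto
  ultimately have "(\<lambda>N. \<Prod>m\<le>N. two_colour_factor l c d (Suc m)) \<longlonglongrightarrow> two_colour_gf l c d"
    by (auto simp: raw_has_prod_def)
  hence "\<forall>\<^sub>F N in sequentially. fps_nth (\<Prod>m\<le>N. two_colour_factor l c d (Suc m)) j =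
      fps_nth (two_colour_gf l c d) j" by (simp add: tendsto_fps_iff)
  then obtain N0 where "\<And>N. N \<ge> N0 \<Longrightarrow> fps_nth (\<Prod>m\<le>N. two_colour_factor l c d (Suc m)) j =
      fps_nth (two_colour_gf l c d) j" by (auto simp: eventually_at_top_linorder)
  from this[of "max N0 j"] show ?thesis
    using two_colour_partial_stable[OF assms(1), of j "max N0 j"] two_colour_partial_stable[OF assms, of c d] by simp
qed

lemma fps_mult_nth_cong:
  assumes "\<And>i. i \<le> j \<Longrightarrow> fps_nth f i = fps_nth f' i" "\<And>i. i \<le> j \<Longrightarrow> fps_nth g i = fps_nth g' i"
  shows "fps_nth (f * g) j = fps_nth (f' * g') j"
  unfolding fps_mult_nth using assms by (intro sum.cong) auto

lemma two_colour_factor_powi: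
  assumes "m > 0" "l > 0"
  shows "two_colour_factor l c d m = (1 - fps_X ^ m) powi (- c) * (1 - fps_X ^ (l * m)) powi (- d)"
proof -
  have 0: "fps_nth (1 - fps_X ^ k :: rat fps) 0 \<noteq> 0" if "k > 0" for k
    using that by (simp add: fps_X_power_nth)
  have 1: "fps_nth ((1 - fps_X ^ k :: rat fps) powi e) 0 = 1" if "k > 0" for k e
  proof -
    have "fps_one_upto k (1 - fps_X ^ k)"
      unfolding fps_one_upto_def by (rule exI[of _ "-1"]) simp
    thus ?thesis using that by (intro fps_one_upto_nth_0[OF fps_one_upto_powi])
  qed
  have "l * m > 0" using assms by simp
  thus ?thesis using assms unfolding two_colour_factor_def
    by (simp add: fps_divide_unit 1 fps_inverse_mult fps_powi_inverse 0)
qed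

text \<open>
  The power of the generating function of partitions, so that Euler's product itself has exponent \<open>-1\<close>.
\<close>

definition euler_pow :: "int \<Rightarrow> rat fps" where
  "euler_pow c = two_colour_gf 1 c 0"

lemma euler_pow_nth:
  assumes "N \<ge> j"
  shows "fps_nth (euler_pow c) j = fps_nth (\<Prod>m\<le>N. (1 - fps_X ^ Suc m) powi (- c)) j"
  using two_colour_gf_nth[of 1 j N c 0] assms
  by (simp add: euler_pow_def two_colour_factor_powi del: power_Suc)

lemma fps_V_minus: "fps_V l (- f) = - fps_V l f"
  by (rule fps_ext) (simp add: fps_V_def)

lemma fps_V_prod: "l > 0 \<Longrightarrow> fps_V l (\<Prod>m\<le>(N::nat). f m :: rat fps) = (\<Prod>m\<le>N. fps_V l (f m))"
  by (induction N) (simp_all add: fps_V_mult)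

lemma two_colour_gf_split:
  assumes "l > 0"
  shows "two_colour_gf l c d = euler_pow c * fps_V l (euler_pow d)"
proof (rule fps_ext)
  fix j
  have "fps_nth (two_colour_gf l c d) j = fps_nth ((\<Prod>m\<le>j. (1 - fps_X ^ Suc m) powi (- c))
      * (\<Prod>m\<le>j. (1 - fps_X ^ (l * Suc m)) powi (- d))) j"
    unfolding two_colour_gf_nth[OF assms order_refl] prod.distrib[symmetric]
    using assms by (simp add: two_colour_factor_powi del: power_Suc mult_Suc_right)
  also have "(\<Prod>m\<le>j. (1 - fps_X ^ (l * Suc m)) powi (- d)) = fps_V l (\<Prod>m\<le>j. (1 - fps_X ^ Suc m :: rat fps) powi (- d))"
    using assms by (simp add: fps_V_prod fps_V_powi fps_V_diff fps_V_power power_mult[symmetric] fps_X_power_nth del: power_Suc mult_Suc_right)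
  also have "fps_nth ((\<Prod>m\<le>j. (1 - fps_X ^ Suc m) powi (- c)) * fps_V l (\<Prod>m\<le>j. (1 - fps_X ^ Suc m) powi (- d))) j
      = fps_nth (euler_pow c * fps_V l (euler_pow d)) j"
  proof (rule fps_mult_nth_cong)
    fix i assume "i \<le> j"
    moreover from this have "i div l \<le> j" by (meson div_le_dividend order_trans)
    ultimately show "fps_nth (\<Prod>m\<le>j. (1 - fps_X ^ Suc m) powi (- c)) i = fps_nth (euler_pow c) i"
      "fps_nth (fps_V l (\<Prod>m\<le>j. (1 - fps_X ^ Suc m) powi (- d))) i = fps_nth (fps_V l (euler_pow d)) i"
      by (simp_all add: fps_V_def euler_pow_nth)
  qed
  finally show "fps_nth (two_colour_gf l c d) j = fps_nth (euler_pow c * fps_V l (euler_pow d)) j" .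
qed

lemma euler_pow_add: "euler_pow (a + b) = euler_pow a * euler_pow b"
proof (rule fps_ext)
  fix j
  have 0: "fps_nth (1 - fps_X ^ Suc m :: rat fps) 0 \<noteq> 0" for m by (simp add: fps_X_power_nth del: power_Suc)
  have "fps_nth (euler_pow (a + b)) j
     = fps_nth ((\<Prod>m\<le>j. (1 - fps_X ^ Suc m) powi (- a)) * (\<Prod>m\<le>j. (1 - fps_X ^ Suc m) powi (- b))) j"
    unfolding euler_pow_nth[OF order_refl] prod.distrib[symmetric] fps_powi_add[OF 0, symmetric] by simp
  also have "\<dots> = fps_nth (euler_pow a * euler_pow b) j"
    by (rule fps_mult_nth_cong) (simp_all add: euler_pow_nth)
  finally show "fps_nth (euler_pow (a + b)) j = fps_nth (euler_pow a * euler_pow b) j" .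
qed

lemma euler_pow_0 [simp]: "euler_pow 0 = 1"
  by (rule fps_ext) (simp add: euler_pow_nth[OF order_refl])

lemma euler_pow_nth_0 [simp]: "fps_nth (euler_pow c) 0 = 1"
proof -
  have "fps_one_upto 1 (1 - fps_X)"
    unfolding fps_one_upto_def by (rule exI[of _ "-1"]) simp
  hence "fps_nth ((1 - fps_X :: rat fps) powi (- c)) 0 = 1"
    by (rule fps_one_upto_nth_0[OF fps_one_upto_powi]) auto
  thus ?thesis using euler_pow_nth[of 0 0 c] by simp
qed

lemma euler_pow_nz [simp]: "euler_pow c \<noteq> 0"
  by (metis euler_pow_nth_0 fps_zero_nth zero_neq_one)

lemma euler_pow_power: "euler_pow c ^ n = euler_pow (int n * c)"
  by (induction n) (simp_all add: euler_pow_add[symmetric] algebra_simps)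

lemma euler_pow_minus: "euler_pow c * euler_pow (- c) = 1"
  by (simp add: euler_pow_add[symmetric])

lemma fps_Ints_euler_pow: "fps_Ints (euler_pow c)"
  unfolding fps_Ints_def
proof
  fix n
  show "fps_nth (euler_pow c) n \<in> \<int>"
    using of_int_two_colour_p[of 1 c 0 n] unfolding euler_pow_def by (metis Ints_of_int zero_less_one)
qed

lemma sigma_fps_euler:
  "qD (euler_pow (- 1)) = - sigma_fps 1 * euler_pow (- 1)"
proof (rule fps_ext)
  fix j
  define g where "g = (\<lambda>m. Abs_fps (\<lambda>n. if n > 0 \<and> Suc m dvd n then - of_nat (Suc m) else 0) :: rat fps)"
  have g: "qD (1 - fps_X ^ Suc m) = (1 - fps_X ^ Suc m) * g m" for m
  proof (rule fps_ext)
    fix n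
    have "fps_nth ((1 - fps_X ^ Suc m) * g m) n = fps_nth (g m) n - (if n < Suc m then 0 else fps_nth (g m) (n - Suc m))"
      by (simp add: left_diff_distrib fps_X_power_mult_nth del: power_Suc)
    also have "\<dots> = (if n = Suc m then - of_nat (Suc m) else 0)"
      by (auto simp: g_def dvd_minus_self dest: dvd_imp_le)
    also have "\<dots> = fps_nth (qD (1 - fps_X ^ Suc m)) n"
      by (simp add: fps_X_power_nth del: power_Suc)
    finally show "fps_nth (qD (1 - fps_X ^ Suc m)) n = fps_nth ((1 - fps_X ^ Suc m) * g m) n" ..
  qed
  have D: "qD (\<Prod>m\<le>N. 1 - fps_X ^ Suc m :: rat fps) = (\<Prod>m\<le>N. 1 - fps_X ^ Suc m) * (\<Sum>m\<le>N. g m)" for N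
  proof (induction N)
    case 0
    show ?case using g[of 0] by simp
  next
    case (Suc N)
    have "qD (\<Prod>m\<le>Suc N. 1 - fps_X ^ Suc m :: rat fps)
        = qD (\<Prod>m\<le>N. 1 - fps_X ^ Suc m) * (1 - fps_X ^ Suc (Suc N)) + (\<Prod>m\<le>N. 1 - fps_X ^ Suc m) * qD (1 - fps_X ^ Suc (Suc N))"
      by (simp only: prod.atMost_Suc qD_mult)
    thus ?case unfolding Suc.IH g by (simp only: prod.atMost_Suc sum.atMost_Suc) (simp only: distrib_left distrib_right mult_ac)
  qed
  have P: "fps_nth (euler_pow (- 1)) i = fps_nth (\<Prod>m\<le>j. 1 - fps_X ^ Suc m) i" if "i \<le> j" for i
    using euler_pow_nth[OF that, of "- 1"] by (simp del: power_Suc)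
  have S: "fps_nth (\<Sum>m\<le>j. g m) i = - fps_nth (sigma_fps 1) i" if "i \<le> j" for i
  proof (cases "i = 0")
    case False
    have "fps_nth (\<Sum>m\<le>j. g m) i = - (\<Sum>m\<le>j. if Suc m dvd i then of_nat (Suc m) else 0)"
      using False by (auto simp: g_def fps_sum_nth sum_negf[symmetric] intro!: sum.cong)
    also have "(\<Sum>m\<le>j. if Suc m dvd i then rat_of_nat (Suc m) else 0) = (\<Sum>m | m \<le> j \<and> Suc m dvd i. of_nat (Suc m))"
      by (simp add: sum.If_cases Int_def)
    also have "\<dots> = (\<Sum>d | d dvd i. of_nat d ^ 1)"
      by (rule sum.reindex_bij_witness[where i = "\<lambda>d. d - 1" and j = Suc])
         (use that False in \<open>auto dest: dvd_imp_le intro: Suc_pred dvd_pos_nat\<close>)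
    finally show ?thesis by (simp add: sigma_fps_def divisor_power_sum_def)
  qed (simp add: g_def fps_sum_nth sigma_fps_def)
  have "fps_nth (qD (euler_pow (- 1))) j = fps_nth (qD (\<Prod>m\<le>j. 1 - fps_X ^ Suc m)) j"
    by (simp add: P del: power_Suc)
  also have "\<dots> = fps_nth (euler_pow (- 1) * (- sigma_fps 1)) j"
    unfolding D by (rule fps_mult_nth_cong) (simp_all add: P S del: power_Suc)
  finally show "fps_nth (qD (euler_pow (- 1))) j = fps_nth (- sigma_fps 1 * euler_pow (- 1)) j"
    by (simp add: mult.commute)
qed

lemma qD_euler_pow: "qD (euler_pow c) = of_int c * sigma_fps 1 * euler_pow c"
proof -
  have pow: "qD (euler_pow (int n * c)) = of_nat n * s * euler_pow (int n * c)"
    if "qD (euler_pow c) = s * euler_pow c" for n s c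
  proof (induction n)
    case (Suc n)
    have "euler_pow (int (Suc n) * c) = euler_pow c * euler_pow (int n * c)"
      by (simp add: euler_pow_add[symmetric] algebra_simps)
    thus ?case by (simp only: qD_mult Suc that) (simp add: algebra_simps)
  qed simp
  have 1: "qD (euler_pow 1) = sigma_fps 1 * euler_pow 1"
  proof -
    have "qD (euler_pow (- 1) * euler_pow 1) = 0" using euler_pow_minus[of "-1"] by simp
    hence "euler_pow (- 1) * qD (euler_pow 1) = euler_pow (- 1) * (sigma_fps 1 * euler_pow 1)"
      by (simp add: qD_mult sigma_fps_euler algebra_simps)
    thus ?thesis using mult_left_cancel[OF euler_pow_nz] by blast
  qed
  show ?thesis
  proof (cases "c \<ge> 0")
    case True
    then obtain n where "c = int n" by (rule nonneg_int_cases)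
    thus ?thesis using pow[OF 1, of n] by simp
  next
    case False
    then obtain n where "c = - int n" by (metis int_cases2 less_eq_int_code(1) nle_le of_nat_0_le_iff)
    thus ?thesis using pow[OF sigma_fps_euler, of n] by simp
  qed
qed

section \<open>The Hauptmodul is an eta quotient\<close>

definition hauptmodul :: "nat \<Rightarrow> nat \<Rightarrow> rat fps" where
  "hauptmodul l r = fps_X * euler_pow (int r) * fps_V l (euler_pow (- int r))"

lemma fps_log_derivative_unique:
  fixes f g e :: "rat fps"
  assumes "qD f = f * e" "qD g = g * e" "fps_nth e 0 = 1" "fps_nth f 1 = fps_nth g 1"
  shows "f = g"
proof (rule fps_ext)
  fix n
  have h: "qD (f - g) = (f - g) * e" using assms by (simp add: qD_diff algebra_simps)
  show "fps_nth f n = fps_nth g n"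
  proof (induction n rule: less_induct)
    case (less n)
    have "of_nat n * fps_nth (f - g) n = fps_nth ((f - g) * e) n"
      using arg_cong[OF h, of "\<lambda>F. fps_nth F n"] by simp
    also have "\<dots> = fps_nth (f - g) n"
      using fps_nth_mult_vanishing_below[of n "f - g" e] less assms by simp
    finally have "(of_nat n - 1) * fps_nth (f - g) n = 0" by (simp add: left_diff_distrib del: fps_sub_nth)
    hence "of_nat n = (1 :: rat) \<or> fps_nth f n = fps_nth g n" by simp
    hence "n = 1 \<or> fps_nth f n = fps_nth g n" by (simp only: of_nat_eq_1_iff)
    thus ?case using assms by auto
  qed
qed

text \<open>
  Both series have the logarithmic derivative \<open>e\<close>, because that of Euler's product is the weight 2 Eisenstein
  series up to normalisation.
\<close>

lemma hauptmodul_eqI: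
  assumes "l > 1" "r * (l - 1) = 24" and y: "fps_nth y 1 = 1" "qD y = y * e"
    and e: "of_nat l * fps_V l E2 = E2 + (of_nat l - 1) * e"
  shows "y = hauptmodul l r"
proof (rule fps_log_derivative_unique[OF y(2)])
  have l: "l > 0" using assms by simp
  define S where "S = sigma_fps 1"
  have rl: "of_nat r * (of_nat l - 1) = (24 :: rat fps)"
  proof -
    have "(of_nat (r * (l - 1)) :: rat fps) = 24" unfolding assms by simp
    thus ?thesis using l by (simp add: of_nat_diff)
  qed
  have "(of_nat l - 1) * e = of_nat l * fps_V l E2 - E2" using e by simp
  also have "\<dots> = (of_nat l - 1) * (1 + of_nat r * S - of_nat r * of_nat l * fps_V l S)"
  proof -
    have "(of_nat l - 1) * (1 + of_nat r * S - of_nat r * of_nat l * fps_V l S)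
       = (of_nat l - 1) + (of_nat r * (of_nat l - 1)) * S - (of_nat r * (of_nat l - 1)) * of_nat l * fps_V l S"
      by (simp add: algebra_simps)
    also have "\<dots> = of_nat l * fps_V l E2 - E2"
      unfolding rl by (simp add: E2_def fps_V_diff[OF l] fps_V_mult[OF l] fps_V_1[OF l] fps_V_numeral[OF l] S_def algebra_simps)
    finally show ?thesis ..
  qed
  finally have "(of_nat l - 1) * e = (of_nat l - 1) * (1 + of_nat r * S - of_nat r * of_nat l * fps_V l S)" .
  moreover have "(of_nat l - 1 :: rat fps) \<noteq> 0" using rl by auto
  ultimately have e': "e = 1 + of_nat r * S - of_nat r * of_nat l * fps_V l S" using mult_left_cancel by blast
  show "fps_nth e 0 = 1" unfolding e' by (simp add: S_def sigma_fps_def fps_V_nth_0[OF l])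
  have "qD (fps_V l (euler_pow (- int r))) = - (of_nat r * of_nat l * fps_V l S) * fps_V l (euler_pow (- int r))"
  proof -
    have "fps_V l (of_nat r :: rat fps) = of_nat r" 
      using fps_V_const[OF l, of "of_nat r :: rat"] by (simp add: fps_of_nat)
    thus ?thesis
      by (simp add: qD_fps_V[OF l] qD_euler_pow fps_V_mult[OF l] fps_V_minus S_def)
  qed
  moreover have "qD fps_X = (fps_X :: rat fps)" by (simp add: qD_def)
  ultimately show "qD (hauptmodul l r) = hauptmodul l r * e"
    unfolding hauptmodul_def e' by (simp only: qD_mult qD_euler_pow) (simp add: S_def algebra_simps)
  show "fps_nth y 1 = fps_nth (hauptmodul l r) 1"
    using y by (simp add: hauptmodul_def mult.assoc fps_V_nth_0[OF l])
qed

section \<open>Lowest coefficients\<close>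

text \<open>
  Substitute series of exact orders \<open>l\<close> and \<open>s\<close> with leading coefficient 1 for the two variables. The
  predicates say that every monomial gets order at least \<open>w\<close>, the functions collect the coefficients of those of
  order \<open>w\<close>; \<open>t\<close> is the order of the part already split off.
\<close>

fun lowest_ok :: "nat \<Rightarrow> nat \<Rightarrow> nat \<Rightarrow> int list \<Rightarrow> bool" where
  "lowest_ok l t w [] = True"
| "lowest_ok l t w (c # cs) = ((c = 0 \<or> w \<le> t) \<and> lowest_ok l (t + l) w cs)"

fun lowest_coeff :: "nat \<Rightarrow> nat \<Rightarrow> nat \<Rightarrow> int list \<Rightarrow> int" where
  "lowest_coeff l t w [] = 0"
| "lowest_coeff l t w (c # cs) = (if t = w then c else 0) + lowest_coeff l (t + l) w cs"

fun llowest_ok :: "nat \<Rightarrow> nat \<Rightarrow> nat \<Rightarrow> nat \<Rightarrow> int list list \<Rightarrow> bool" where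
  "llowest_ok s l t w [] = True"
| "llowest_ok s l t w (c # cs) = (lowest_ok l t w c \<and> llowest_ok s l (t + s) w cs)"

fun llowest_coeff :: "nat \<Rightarrow> nat \<Rightarrow> nat \<Rightarrow> nat \<Rightarrow> int list list \<Rightarrow> int" where
  "llowest_coeff s l t w [] = 0"
| "llowest_coeff s l t w (c # cs) = lowest_coeff l t w c + llowest_coeff s l (t + s) w cs"

lemma fps_nth_leval_lowest:
  fixes u x :: "rat fps"
  assumes "fps_nth u 0 = 1" "fps_nth x 0 = 1" "lowest_ok l t w cs"
  shows "fps_nth (fps_X ^ t * u * leval (fps_X ^ l * x) cs) w = of_int (lowest_coeff l t w cs)"
  using assms
proof (induction l t w cs arbitrary: u rule: lowest_ok.induct)
  case (2 l t w c cs)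
  have "fps_X ^ t * u * leval (fps_X ^ l * x) (c # cs)
      = fps_X ^ t * (fps_const (of_int c) * u) + fps_X ^ (t + l) * (u * x) * leval (fps_X ^ l * x) cs"
    by (simp add: algebra_simps power_add fps_of_int)
  moreover have "fps_nth (fps_X ^ (t + l) * (u * x) * leval (fps_X ^ l * x) cs) w = of_int (lowest_coeff l (t + l) w cs)"
    using 2 by (intro "2.IH") auto
  moreover have "fps_nth (fps_X ^ t * (fps_const (of_int c) * u)) w = of_int (if t = w then c else 0)"
    using "2.prems" by (auto simp: fps_X_power_mult_nth)
  ultimately show ?case by simp
qed simp

lemma fps_nth_lleval_lowest:
  fixes u x p :: "rat fps"
  assumes "fps_nth u 0 = 1" "fps_nth x 0 = 1" "fps_nth p 0 = 1" "llowest_ok s l t w cs"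
  shows "fps_nth (fps_X ^ t * u * lleval (fps_X ^ s * p) (fps_X ^ l * x) cs) w = of_int (llowest_coeff s l t w cs)"
  using assms
proof (induction s l t w cs arbitrary: u rule: llowest_ok.induct)
  case (2 s l t w c cs)
  have "fps_X ^ t * u * lleval (fps_X ^ s * p) (fps_X ^ l * x) (c # cs)
      = fps_X ^ t * u * leval (fps_X ^ l * x) c + fps_X ^ (t + s) * (u * p) * lleval (fps_X ^ s * p) (fps_X ^ l * x) cs"
    by (simp add: algebra_simps power_add)
  moreover have "fps_nth (fps_X ^ (t + s) * (u * p) * lleval (fps_X ^ s * p) (fps_X ^ l * x) cs) w = of_int (llowest_coeff s l (t + s) w cs)"
    using 2 by (intro "2.IH") auto
  moreover have "fps_nth (fps_X ^ t * u * leval (fps_X ^ l * x) c) w = of_int (lowest_coeff l t w c)"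
    using 2 by (intro fps_nth_leval_lowest) auto
  ultimately show ?case by simp
qed simp

section \<open>The modular equations\<close>

definition phi :: "nat \<Rightarrow> rat fps" where
  "phi l = fps_X ^ ((l ^ 2 - 1) div 24) * euler_pow 1 * fps_V l (fps_V l (euler_pow (- 1)))"

lemma phi_power:
  assumes "l > 0"
  shows "phi l ^ n = fps_X ^ (n * ((l ^ 2 - 1) div 24)) * euler_pow (int n) * fps_V l (fps_V l (euler_pow (- int n)))"
  by (simp add: phi_def power_mult_distrib fps_V_power[OF assms, symmetric] euler_pow_power power_mult[symmetric] mult.commute)

lemma hauptmodul_mult_V:
  assumes "l > 0" "(l ^ 2 - 1) div 24 * r = l + 1"
  shows "hauptmodul l r * fps_V l (hauptmodul l r) = phi l ^ r"
proof -
  have "fps_V l (euler_pow (- int r)) * fps_V l (euler_pow (int r)) = 1"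
    by (simp add: fps_V_mult[OF assms(1), symmetric] euler_pow_add[symmetric] fps_V_1[OF assms(1)])
  moreover have "hauptmodul l r * fps_V l (hauptmodul l r)
      = fps_X ^ (l + 1) * euler_pow (int r) * fps_V l (fps_V l (euler_pow (- int r)))
        * (fps_V l (euler_pow (- int r)) * fps_V l (euler_pow (int r)))"
    by (simp add: hauptmodul_def fps_V_mult[OF assms(1)] fps_V_X[OF assms(1)] algebra_simps)
  ultimately show ?thesis
    using assms by (simp add: phi_power mult.commute[of r])
qed

text \<open>
  The modular equation of \<open>\<phi>\<close>: row \<open>k\<close> is the coefficient of the \<open>k\<close>-th power of \<open>\<phi>\<close>, by ascending
  powers of \<open>g(q^l)\<close>. For \<open>l = 5\<close> and \<open>l = 7\<close> these are the equations that Watson used for the partition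
  function.
\<close>

definition modular_poly :: "nat \<Rightarrow> int list list" where
  "modular_poly l =
    (if l = 5 then [[0, -1], [0, -5], [0, -15], [0, -25], [0, -25], [1]]
     else if l = 7 then [[0, 0, -1], [0, 0, -7], [0, 0, -21], [0, 0, -49], [0, -7, -147], [0, -35, -343], [0, -49, -343], [1]]
     else [[0, 0, 0, 0, 0, 0, 0, -1], [0, 0, 0, 0, 0, 0, 0, 13], [0, 0, 0, 0, 0, 0, -13, -91], [0, 0, 0, 0, 0, 0, 169, 507], [0, 0, 0, 0, 0, -78, -1183, -2535], [0, 0, 0, 0, 0, 962, 6253, 10985], [0, 0, 0, 0, -260, -6422, -28561, -41743], [0, 0, 0, 0, 2886, 31096, 112047, 142805], [0, 0, 0, -494, -17238, -123032, -371293, -428415], [0, 0, 0, 4498, 71318, 404248, 1056757, 1113879], [0, 0, -468, -21294, -224094, -1085318, -2599051, -2599051], [0, 0, 2652, 58474, 487734, 2113514, 4826809, 4826809], [0, -143, -6084, -83486, -571220, -2227758, -4826809, -4826809], [1]])"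

text \<open>
  Power series have no zero divisors. The factor \<open>M \<phi>^r - 1\<close> has constant term \<open>-1\<close>, and the lowest
  coefficient of the cofactor \<open>G\<close> is not zero, so the remaining factor vanishes.
\<close>

lemma modular_equation_aux:
  fixes cofactor A B B' :: "int list list"
  assumes l: "l > 0" "(l ^ 2 - 1) div 24 * r = l + 1" "r > 0" "l ^ 2 > 24"
    and eq: "lleval (phi l) (fps_V l (hauptmodul l r)) F = (of_nat M * phi l ^ r - 1)
       * (lleval (phi l) (fps_V l (hauptmodul l r)) (modular_poly l) * lleval (phi l) (fps_V l (hauptmodul l r)) G)"
    and zero: "lleval (phi l) (fps_V l (hauptmodul l r)) F = 0"
    and G: "llowest_ok ((l ^ 2 - 1) div 24) l 0 w G" "llowest_coeff ((l ^ 2 - 1) div 24) l 0 w G \<noteq> 0"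
  shows "lleval (phi l) (fps_V l (hauptmodul l r)) (modular_poly l) = 0"
proof -
  have s: "(l ^ 2 - 1) div 24 > 0" using l(4) by (simp add: div_greater_zero_iff)
  have "fps_nth (phi l) 0 = 0" using s by (simp add: phi_def mult.assoc)
  hence "fps_nth (of_nat M * phi l ^ r - 1) 0 = -1" using l by (simp add: fps_power_zeroth)
  hence 1: "of_nat M * phi l ^ r - 1 \<noteq> 0" by (metis fps_zero_nth neg_equal_0_iff_equal zero_neq_one)
  have x: "fps_V l (hauptmodul l r) = fps_X ^ l * (fps_V l (euler_pow (int r) * fps_V l (euler_pow (- int r))))"
    by (simp add: hauptmodul_def fps_V_mult[OF l(1)] fps_V_X[OF l(1)] mult.assoc)
  have p: "phi l = fps_X ^ ((l ^ 2 - 1) div 24) * (euler_pow 1 * fps_V l (fps_V l (euler_pow (- 1))))"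
    by (simp add: phi_def mult.assoc)
  have "fps_nth (lleval (phi l) (fps_V l (hauptmodul l r)) G) w \<noteq> 0"
    using fps_nth_lleval_lowest[OF _ _ _ G(1), of 1
      "fps_V l (euler_pow (int r) * fps_V l (euler_pow (- int r)))" "euler_pow 1 * fps_V l (fps_V l (euler_pow (- 1)))"] G(2)
    unfolding x p by (simp add: fps_V_nth_0[OF l(1)])
  hence "lleval (phi l) (fps_V l (hauptmodul l r)) G \<noteq> 0" by (metis fps_zero_nth)
  thus ?thesis using eq 1 unfolding zero by simp
qed

text \<open>
  Turns a polynomial in \<open>y\<close>, multiplied by a power of \<open>x\<close>, into one in \<open>p\<close> and \<open>x\<close>, by means of
  \<open>y x = p^r\<close>.
\<close>

fun homogenise :: "nat \<Rightarrow> int list \<Rightarrow> int list list" where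
  "homogenise r [] = []"
| "homogenise r (c # cs) = (replicate (length cs) 0 @ [c]) # replicate (r - 1) [] @ homogenise r cs"

lemma lleval_append_replicate: "lleval p x (replicate n [] @ css) = p ^ n * lleval p x css"
  by (induction n) (simp_all add: algebra_simps)

lemma lleval_homogenise:
  assumes "y * x = p ^ r" "r > 0" "cs \<noteq> []"
  shows "lleval p x (homogenise r cs) = x ^ (length cs - 1) * leval y cs"
  using assms(3)
proof (induction cs)
  case (Cons c cs)
  have p: "p * p ^ (r - 1) = y * x" using assms by (simp add: power_eq_if)
  show ?case
  proof (cases cs)
    case (Cons c' cs')
    hence "lleval p x (homogenise r cs) = x ^ (length cs - 1) * leval y cs" using Cons.IH by simp
    moreover have "x ^ length cs = x * x ^ (length cs - 1)" using Cons by simp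
    ultimately have "lleval p x (homogenise r (c # cs)) = of_int c * x ^ length cs + (p * p ^ (r - 1)) * (x ^ (length cs - 1) * leval y cs)"
      by (simp add: leval_single lleval_append_replicate algebra_simps)
    thus ?thesis using \<open>x ^ length cs = x * x ^ (length cs - 1)\<close> unfolding p by (simp add: algebra_simps)
  qed (simp add: lleval_append_replicate[of p x _ "[]", simplified])
qed simp

text \<open>
  The polynomial on the left is the difference of the two expressions for \<open>j(q^l)\<close>, cleared of denominators. The
  Fricke involution provides a solution \<open>x y = 1 / M\<close>, whence the first factor on the right. The polynomial
  depends on \<open>\<phi>\<close> only through its \<open>r\<close>-th power, so besides the modular equation it has the factors in which
  \<open>\<phi>\<close> is multiplied by the other \<open>r\<close>-th roots of unity; \<open>G\<close> is, up to sign, their product, and \<open>w\<close> its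
  order.
\<close>

definition factor_data :: "nat \<Rightarrow> nat \<Rightarrow> nat \<Rightarrow> nat \<Rightarrow> int list \<Rightarrow> int list \<Rightarrow> int list \<Rightarrow> int list list \<Rightarrow> bool" where
  "factor_data l r M w a b b' G \<longleftrightarrow>
    length a + 3 * length b' = l + 5 \<and> a \<noteq> [] \<and> b' \<noteq> [] \<and>
    same_values
      (lladd (llmul (homogenise r a) (llmul (homogenise r b') (llmul (homogenise r b') (homogenise r b'))))
        (llmul (replicate (r * l) [] @ [[- 1]]) (llmul [a] (llmul [b] (llmul [b] [b])))))
      (llmul ([- 1] # replicate (r - 1) [] @ [[int M]]) (llmul (modular_poly l) G)) \<and>
    llowest_ok ((l ^ 2 - 1) div 24) l 0 w G \<and> llowest_coeff ((l ^ 2 - 1) div 24) l 0 w G \<noteq> 0"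

lemma modular_equation_from_data:
  assumes l: "l > 1" "(l ^ 2 - 1) div 24 * r = l + 1" "r * (l - 1) = 24" "l ^ 2 > 24"
    and iso: "isogeny_data l a b c d h b' d'" and fac: "factor_data l r M w a b b' G"
  shows "lleval (phi l) (fps_V l (hauptmodul l r)) (modular_poly l) = 0"
proof -
  have l0: "l > 0" using l by simp
  have r: "r > 0" using l(3) by (intro Nat.gr0I) auto
  define x where "x = fps_V l (hauptmodul l r)"
  define p where "p = phi l"
  obtain y e where y: "fps_nth y 0 = 0" "fps_nth y 1 = 1" "qD y = y * e"
      "of_nat l * fps_V l E2 = E2 + (of_nat l - 1) * e"
      "y ^ l * fps_V l (leval y a * leval y b ^ 3) = fps_V l y * (leval y a * leval y b' ^ 3)"
    using hauptmodul_exists[OF l0 iso] by blast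
  have y_eq: "y = hauptmodul l r" by (rule hauptmodul_eqI[OF l(1,3) y(2-4)])
  have x: "x = fps_V l y" by (simp add: x_def y_eq)
  have yx: "y * x = p ^ r" unfolding x y_eq p_def by (rule hauptmodul_mult_V[OF l0 l(2)])
  have Vl: "fps_V l (leval y cs) = leval x cs" for cs
  proof (induction cs)
    case (Cons v cs)
    have "fps_V l (of_int v :: rat fps) = of_int v" by (metis fps_V_const[OF l0] fps_of_int)
    thus ?case using Cons by (simp add: fps_V_add[OF l0] fps_V_mult[OF l0] x)
  qed (simp add: fps_V_0[OF l0])
  have "fps_nth x l = 1" using y(2) l0 by (simp add: x fps_V_def)
  hence x_nz: "x \<noteq> 0" by auto
  have rel: "y ^ l * (leval x a * leval x b ^ 3) = x * (leval y a * leval y b' ^ 3)"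
    using y(5) by (simp add: x[symmetric] fps_V_mult[OF l0] fps_V_power[OF l0] Vl)
  have deg: "length a - 1 + 3 * (length b' - 1) = l + 1" "a \<noteq> []" "b' \<noteq> []"
    using fac by (cases a; cases b'; auto simp: factor_data_def)+
  define A where "A = lleval p x (homogenise r a)"
  define B where "B = lleval p x (homogenise r b')"
  have A: "A = x ^ (length a - 1) * leval y a" and B: "B = x ^ (length b' - 1) * leval y b'"
    unfolding A_def B_def using lleval_homogenise[OF yx r] deg by auto
  have "x * ((p ^ r) ^ l * (leval x a * leval x b ^ 3)) = x ^ (l + 1) * (y ^ l * (leval x a * leval x b ^ 3))"
    unfolding yx[symmetric] power_mult_distrib by (simp add: mult_ac)
  also have "\<dots> = x * (A * B ^ 3)"
  proof -
    have "x ^ (l + 1) = x ^ (length a - 1) * (x ^ (length b' - 1)) ^ 3"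
      unfolding deg(1)[symmetric] by (simp add: power_add power_mult[symmetric] mult.commute)
    thus ?thesis unfolding rel A B by (simp add: power_mult_distrib mult_ac)
  qed
  finally have rel': "(p ^ r) ^ l * (leval x a * leval x b ^ 3) = A * B ^ 3" using x_nz by simp
  define F where "F = lladd (llmul (homogenise r a) (llmul (homogenise r b') (llmul (homogenise r b') (homogenise r b'))))
        (llmul (replicate (r * l) [] @ [[- 1]]) (llmul [a] (llmul [b] (llmul [b] [b]))))"
  have "lleval p x F = A * B ^ 3 - (p ^ r) ^ l * (leval x a * leval x b ^ 3)"
    unfolding F_def
    by (simp add: A_def B_def lleval_append_replicate power3_eq_cube power_mult[symmetric] algebra_simps)
  hence zero: "lleval p x F = 0" using rel' by simp
  have "lleval p x F = lleval p x (llmul ([- 1] # replicate (r - 1) [] @ [[int M]]) (llmul (modular_poly l) G))"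
    unfolding F_def using fac by (intro same_valuesD) (simp add: factor_data_def)
  moreover have "lleval p x ([- 1] # replicate (r - 1) [] @ [[int M]]) = of_nat M * p ^ r - 1"
    using r by (simp add: lleval_append_replicate power_eq_if algebra_simps)
  ultimately have eq: "lleval p x F = (of_nat M * p ^ r - 1) * (lleval p x (modular_poly l) * lleval p x G)"
    by simp
  have G: "llowest_ok ((l ^ 2 - 1) div 24) l 0 w G" "llowest_coeff ((l ^ 2 - 1) div 24) l 0 w G \<noteq> 0"
    using fac by (simp_all add: factor_data_def)
  show ?thesis
    by (rule modular_equation_aux[OF l0 l(2) r l(4) eq[unfolded x_def p_def] zero[unfolded x_def p_def] G])
qed

lemma factor_data_5:
  "factor_data 5 6 125 25 [1] [1, 250, 3125] [1, 10, 5]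
    [[0, 0, 0, 0, 0, 1], [0, 0, 0, 0, 0, -5], [0, 0, 0, 0, 0, 10], [], [0, 0, 0, 0, 0, -50], [0, 0, 0, 0, 1, 125], [0, 0, 0, 0, 20], [0, 0, 0, 0, -105, -625], [0, 0, 0, 0, 200, 1250], [], [0, 0, 0, 1, -750, -3125], [0, 0, 0, 15, 1375], [0, 0, 0, 120, 2500, 31250], [0, 0, 0, -650, -13125, -78125], [0, 0, 0, 1050, 12500], [0, 0, 1, 375, 34375, 390625], [0, 0, 10, -3000, -93750, -781250], [0, 0, 55, 1875], [0, 0, 200, 26250, 625000, 3906250], [0, 0, -1050, -81250, -1640625, -9765625], [0, 1, 1000, 75000, 1562500, 9765625], [0, 5, 1375, 46875, 390625], [0, 15, 1250, 15625], [0, 25, 625], [0, 25], [1]]"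
  by code_simp

lemma modular_equation_5: "lleval (phi 5) (fps_V 5 (hauptmodul 5 6)) (modular_poly 5) = 0"
  by (rule modular_equation_from_data[OF _ _ _ _ isogeny_data_5 factor_data_5]) simp_all

lemma factor_data_7:
  "factor_data 7 4 49 42 [1, 13, 49] [1, 245, 2401] [1, 5, 1]
    [[0, 0, 0, 0, 0, 0, 1], [0, 0, 0, 0, 0, 0, -7], [0, 0, 0, 0, 0, 0, 28], [0, 0, 0, 0, 0, 0, -98], [0, 0, 0, 0, 0, 21, 343], [0, 0, 0, 0, 0, -133, -1029], [0, 0, 0, 0, 0, 490, 2744], [0, 0, 0, 0, 1, -1617, -7203], [0, 0, 0, 0, 161, 5488, 19208], [0, 0, 0, 0, -924, -16121, -50421], [0, 0, 0, 0, 3136, 43218, 134456], [0, 0, 0, 14, -9555, -112847, -352947], [0, 0, 0, 511, 31213, 302526, 941192], [0, 0, 0, -2597, -88494, -789929, -2470629], [0, 0, 1, 7644, 218491, 1882384, 5764801], [0, 0, 56, -18179, -468195, -3882417, -11529602], [0, 0, 511, 53508, 1075648, 8235430, 23059204], [0, 0, -2058, -127253, -2218524, -15647317, -40353607], [0, 7, 3577, 175273, 2705927, 17294403, 40353607], [0, 35, 2744, 33614, 117649], [0, 49, 343], [1]]"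
  by code_simp

lemma modular_equation_7: "lleval (phi 7) (fps_V 7 (hauptmodul 7 4)) (modular_poly 7) = 0"
  by (rule modular_equation_from_data[OF _ _ _ _ isogeny_data_7 factor_data_7]) simp_all

lemma factor_data_13:
  "factor_data 13 2 13 91 [1, 5, 13] [1, 247, 3380, 15379, 28561] [1, 7, 20, 19, 1]
    [[0, 0, 0, 0, 0, 0, 0, 1], [0, 0, 0, 0, 0, 0, 0, 13], [0, 0, 0, 0, 0, 0, 13, 91], [0, 0, 0, 0, 0, 0, 169, 507], [0, 0, 0, 0, 0, 78, 1183, 2535], [0, 0, 0, 0, 0, 962, 6253, 10985], [0, 0, 0, 0, 260, 6422, 28561, 41743], [0, 0, 0, 0, 2886, 31096, 112047, 142805], [0, 0, 0, 494, 17238, 123032, 371293, 428415], [0, 0, 0, 4498, 71318, 404248, 1056757, 1113879], [0, 0, 468, 21294, 224094, 1085318, 2599051, 2599051], [0, 0, 2652, 58474, 487734, 2113514, 4826809, 4826809], [0, 143, 6084, 83486, 571220, 2227758, 4826809, 4826809], [1]]"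
  by code_simp

lemma modular_equation_13: "lleval (phi 13) (fps_V 13 (hauptmodul 13 2)) (modular_poly 13) = 0"
  by (rule modular_equation_from_data[OF _ _ _ _ isogeny_data_13 factor_data_13]) simp_all

section \<open>Newton's identities\<close>

lemma monic_poly_eq_prod_roots:
  fixes A :: "'a::idom poly"
  assumes A: "degree A = l" "Polynomial.coeff A l = 1"
    and roots: "\<And>i. i < l \<Longrightarrow> poly A (z i) = 0" and inj: "inj_on z {..<l}"
  shows "A = (\<Prod>i<l. [:- z i, 1:])"
proof (rule ccontr)
  define B where "B = (\<Prod>i<l. [:- z i, 1:])"
  define D where "D = A - B"
  assume "A \<noteq> (\<Prod>i<l. [:- z i, 1:])"
  hence D: "D \<noteq> 0" by (simp add: D_def B_def)
  have degB: "degree B = l" by (simp add: B_def degree_prod_eq_sum_degree)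
  have "Polynomial.coeff B l = lead_coeff B" by (simp add: degB)
  also have "\<dots> = 1" by (simp add: B_def lead_coeff_prod)
  finally have "Polynomial.coeff D l = 0" using A by (simp add: D_def)
  moreover have "degree D \<le> l" unfolding D_def using A degB by (intro degree_diff_le) auto
  ultimately have deg: "degree D < l"
    using D by (metis le_neq_implies_less leading_coeff_0_iff)
  have "z ` {..<l} \<subseteq> {x. poly D x = 0}"
    using roots by (auto simp: D_def B_def poly_prod)
  hence "card (z ` {..<l}) \<le> card {x. poly D x = 0}"
    using poly_roots_finite[OF D] by (rule card_mono[rotated])
  also have "\<dots> \<le> degree D" using card_poly_roots_bound[OF D] .
  finally show False using deg inj by (simp add: card_image)
qed

text \<open>
  The derivative of \<open>A\<close> is the sum of the quotients of \<open>A\<close> by its linear factors, and the coefficients of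
  these quotients are given by synthetic division.
\<close>

lemma newton_identities:
  fixes A :: "'a::idom poly" and z :: "nat \<Rightarrow> 'a"
  assumes A: "A = (\<Prod>i<l. [:- z i, 1:])" and k: "k < l"
  shows "of_nat (Suc k) * Polynomial.coeff A (Suc k) = (\<Sum>m\<in>{Suc k..l}. Polynomial.coeff A m * (\<Sum>i<l. z i ^ (m - Suc k)))"
proof -
  define B where "B = (\<lambda>i. \<Prod>j\<in>{..<l} - {i}. [:- z j, 1:])"
  have AB: "A = [:- z i, 1:] * B i" if "i < l" for i
    unfolding A B_def using that by (subst prod.remove[of _ i]) auto
  have degB: "Polynomial.coeff (B i) n = 0" if "i < l" "n \<ge> l" for i n
  proof -
    have "degree (B i) = card ({..<l} - {i})" by (simp add: B_def degree_prod_eq_sum_degree)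
    also have "\<dots> < l" using that by simp
    finally show ?thesis using that by (intro coeff_eq_0) auto
  qed
  have B: "Polynomial.coeff (B i) n = (\<Sum>m\<in>{Suc n..l}. Polynomial.coeff A m * z i ^ (m - Suc n))" if i: "i < l" and "n \<le> l" for i n
    using \<open>n \<le> l\<close>
  proof (induction n rule: inc_induct)
    case base
    show ?case using degB[OF i] by simp
  next
    case (step n)
    have "Polynomial.coeff (B i) n = Polynomial.coeff A (Suc n) + z i * Polynomial.coeff (B i) (Suc n)"
      by (subst AB[OF i]) simp
    also have "\<dots> = Polynomial.coeff A (Suc n) * z i ^ 0 + (\<Sum>m\<in>{Suc (Suc n)..l}. Polynomial.coeff A m * z i ^ (m - Suc n))"
      unfolding step.IH sum_distrib_left
      by (intro arg_cong2[of _ _ _ _ "(+)"] sum.cong) (auto simp: Suc_diff_Suc power_Suc[symmetric] simp del: power_Suc)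
    also have "\<dots> = (\<Sum>m\<in>{Suc n..l}. Polynomial.coeff A m * z i ^ (m - Suc n))"
      using step by (simp add: sum.atLeast_Suc_atMost)
    finally show ?case .
  qed
  have "pderiv A = (\<Sum>i<l. B i)"
    unfolding A B_def by (subst pderiv_prod) (simp add: pderiv_pCons)
  hence "of_nat (Suc k) * Polynomial.coeff A (Suc k) = (\<Sum>i<l. Polynomial.coeff (B i) k)"
    by (metis coeff_pderiv coeff_sum)
  also have "\<dots> = (\<Sum>i<l. \<Sum>m\<in>{Suc k..l}. Polynomial.coeff A m * z i ^ (m - Suc k))"
    using B k by (intro sum.cong) auto
  also have "\<dots> = (\<Sum>m\<in>{Suc k..l}. Polynomial.coeff A m * (\<Sum>i<l. z i ^ (m - Suc k)))"
    by (subst sum.swap) (simp add: sum_distrib_left)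
  finally show ?thesis .
qed

section \<open>The operator $U_l$ and traces\<close>

definition fps_U :: "nat \<Rightarrow> 'a::zero fps \<Rightarrow> 'a fps" where
  "fps_U l f = Abs_fps (\<lambda>n. fps_nth f (l * n))"

lemma fps_U_nth [simp]: "fps_nth (fps_U l f) n = fps_nth f (l * n)"
  by (simp add: fps_U_def)

lemma fps_U_V_mult:
  fixes f g :: "'a::comm_ring_1 fps"
  assumes l: "l > 0"
  shows "fps_U l (fps_V l f * g) = f * fps_U l g"
proof (rule fps_ext)
  fix n
  have "fps_nth (fps_V l f * g) (l * n) = (\<Sum>i=0..l * n. fps_nth (fps_V l f) i * fps_nth g (l * n - i))"
    by (simp add: fps_mult_nth)
  also have "\<dots> = (\<Sum>i\<in>(*) l ` {0..n}. fps_nth (fps_V l f) i * fps_nth g (l * n - i))"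
    by (rule sum.mono_neutral_right) (use l in \<open>auto simp: fps_V_def image_iff elim!: dvdE\<close>)
  also have "\<dots> = (\<Sum>i=0..n. fps_nth f i * fps_nth g (l * (n - i)))"
    using l by (subst sum.reindex) (auto simp: inj_on_def fps_V_def right_diff_distrib')
  finally show "fps_nth (fps_U l (fps_V l f * g)) n = fps_nth (f * fps_U l g) n"
    by (simp add: fps_mult_nth)
qed

lemma fps_U_add: "fps_U l (f + g) = fps_U l f + fps_U l (g :: 'a::comm_ring_1 fps)"
  by (rule fps_ext) simp

lemma fps_U_0 [simp]: "fps_U l 0 = 0"
  by (rule fps_ext) simp

lemma fps_U_sum: "fps_U l (\<Sum>i\<in>I. f i) = (\<Sum>i\<in>I. fps_U l (f i :: 'a::comm_ring_1 fps))"
  by (induction I rule: infinite_finite_induct) (simp_all add: fps_U_add)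

text \<open>
  The trace from series in \<open>q\<close> to series in \<open>q^l\<close>: multiplying \<open>q\<close> by all \<open>l\<close>-th roots of unity and
  adding keeps only the exponents divisible by \<open>l\<close>, \<open>l\<close> times each.
\<close>

definition trace_fps :: "nat \<Rightarrow> rat fps \<Rightarrow> rat fps" where
  "trace_fps l f = of_nat l * fps_V l (fps_U l f)"

definition root_of_unity :: "nat \<Rightarrow> complex" where
  "root_of_unity l = exp (2 * of_real pi * \<i> * of_nat 1 / of_nat l)"

lemma root_of_unity_power_eq_1_iff:
  assumes "l > 0"
  shows "root_of_unity l ^ n = 1 \<longleftrightarrow> l dvd n"
proof -
  have "root_of_unity l ^ n = exp (2 * of_real pi * \<i> * of_nat n / of_nat l)"
    by (simp add: root_of_unity_def exp_of_nat_mult[symmetric] algebra_simps)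
  thus ?thesis using complex_root_unity_eq_1[of l n] assms by simp
qed

text \<open>
  The conjugates of a series over the series in \<open>q^l\<close>, obtained by multiplying \<open>q\<close> by a root of unity.
\<close>

definition twist :: "nat \<Rightarrow> nat \<Rightarrow> rat fps \<Rightarrow> complex fps" where
  "twist l i f = Abs_fps (\<lambda>n. root_of_unity l ^ (i * n) * of_rat (fps_nth f n))"

lemma twist_nth [simp]: "fps_nth (twist l i f) n = root_of_unity l ^ (i * n) * of_rat (fps_nth f n)"
  by (simp add: twist_def)

lemma twist_add [simp]: "twist l i (f + g) = twist l i f + twist l i g"
  by (rule fps_ext) (simp add: of_rat_add algebra_simps)

lemma twist_mult [simp]: "twist l i (f * g) = twist l i f * twist l i g"
proof (rule fps_ext)
  fix n
  have "fps_nth (twist l i (f * g)) n = (\<Sum>k=0..n. root_of_unity l ^ (i * n) * (of_rat (fps_nth f k) * of_rat (fps_nth g (n - k))))"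
    by (simp add: fps_mult_nth of_rat_sum of_rat_mult sum_distrib_left)
  also have "\<dots> = fps_nth (twist l i f * twist l i g) n"
    unfolding fps_mult_nth
  proof (rule sum.cong)
    fix k assume "k \<in> {0..n}"
    hence "i * n = i * k + i * (n - k)" by (simp add: algebra_simps)
    hence "root_of_unity l ^ (i * n) = root_of_unity l ^ (i * k) * root_of_unity l ^ (i * (n - k))"
      by (simp only: power_add)
    thus "root_of_unity l ^ (i * n) * (of_rat (fps_nth f k) * of_rat (fps_nth g (n - k)))
        = fps_nth (twist l i f) k * fps_nth (twist l i g) (n - k)" by simp
  qed simp
  finally show "fps_nth (twist l i (f * g)) n = fps_nth (twist l i f * twist l i g) n" .
qed

lemma twist_const [simp]: "twist l i (fps_const c) = fps_const (of_rat c)"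
  by (rule fps_ext) simp

lemma twist_0 [simp]: "twist l i 0 = 0" and twist_1 [simp]: "twist l i 1 = 1"
  by (rule fps_ext, simp)+

lemma twist_of_int [simp]: "twist l i (of_int c) = of_int c"
  unfolding fps_of_int[symmetric] by simp

lemma twist_of_nat [simp]: "twist l i (of_nat c) = of_nat c"
  unfolding fps_of_nat[symmetric] by simp

lemma twist_minus [simp]: "twist l i (- f) = - twist l i f"
  by (rule fps_ext) (simp add: of_rat_minus)

lemma twist_sum [simp]: "twist l i (\<Sum>j\<in>J. f j) = (\<Sum>j\<in>J. twist l i (f j))"
  by (induction J rule: infinite_finite_induct) simp_all

lemma twist_power [simp]: "twist l i (f ^ n) = twist l i f ^ n"
  by (induction n) simp_all

lemma twist_leval [simp]: "twist l i (leval x cs) = leval (twist l i x) cs"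
  by (induction cs) simp_all

lemma twist_lleval [simp]: "twist l i (lleval p x cs) = lleval (twist l i p) (twist l i x) cs"
  by (induction cs) simp_all

lemma twist_V: "l > 0 \<Longrightarrow> twist l i (fps_V l f) = twist l 0 (fps_V l f)"
  using root_of_unity_power_eq_1_iff[of l] by (intro fps_ext) (auto simp: fps_V_def)

lemma twist_0_inject: "twist l 0 f = twist l 0 g \<Longrightarrow> f = g"
  by (auto simp: fps_eq_iff)

lemma sum_twist:
  assumes l: "l > 0"
  shows "(\<Sum>i<l. twist l i f) = twist l 0 (trace_fps l f)"
proof (rule fps_ext)
  fix n
  define w where "w = root_of_unity l"
  have "(\<Sum>i<l. (w ^ n) ^ i) = (if l dvd n then of_nat l else 0)"
  proof (cases "l dvd n")
    case True
    hence "w ^ n = 1" using l by (simp add: w_def root_of_unity_power_eq_1_iff)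
    thus ?thesis using True by simp
  next
    case False
    hence "w ^ n \<noteq> 1" using l by (simp add: w_def root_of_unity_power_eq_1_iff)
    moreover have "(w ^ n) ^ l = 1"
      using root_of_unity_power_eq_1_iff[OF l, of "n * l"] by (simp add: w_def power_mult[symmetric])
    ultimately show ?thesis using False by (simp add: geometric_sum)
  qed
  hence "(\<Sum>i<l. w ^ (i * n)) = (if l dvd n then of_nat l else 0)"
    by (simp add: power_mult[symmetric] mult.commute)
  hence "fps_nth (\<Sum>i<l. twist l i f) n = (if l dvd n then of_nat l else 0) * of_rat (fps_nth f n)"
    by (simp add: fps_sum_nth w_def sum_distrib_right[symmetric])
  also have "\<dots> = fps_nth (twist l 0 (trace_fps l f)) n"
  proof -
    have "fps_nth (of_nat l * fps_V l (fps_U l f)) n = of_nat l * fps_nth (fps_V l (fps_U l f)) n"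
      by (simp only: fps_of_nat[symmetric] fps_mult_left_const_nth)
    thus ?thesis by (auto simp: trace_fps_def fps_V_def of_rat_mult simp del: fps_mult_nth_0)
  qed
  finally show "fps_nth (\<Sum>i<l. twist l i f) n = fps_nth (twist l 0 (trace_fps l f)) n" .
qed

lemma lleval_eq_sum: "lleval p x css = (\<Sum>i<length css. leval x (css ! i) * p ^ i)"
proof (induction css)
  case (Cons c css)
  thus ?case by (simp add: sum.lessThan_Suc_shift sum_distrib_left algebra_simps del: sum.lessThan_Suc)
qed simp

lemma poly_Poly_leval: "poly (Poly (map (leval x) css)) p = lleval p x css"
  by (induction css) simp_all

lemma trace_fps_V_mult:
  assumes "l > 0"
  shows "trace_fps l (fps_V l f * g) = fps_V l f * trace_fps l g"
  by (simp add: trace_fps_def fps_U_V_mult[OF assms] fps_V_mult[OF assms])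

lemma trace_fps_sum: "l > 0 \<Longrightarrow> trace_fps l (\<Sum>i\<in>I. f i) = (\<Sum>i\<in>I. trace_fps l (f i))"
  unfolding trace_fps_def fps_U_sum
  by (induction I rule: infinite_finite_induct) (simp_all add: fps_V_add distrib_left)

lemma leval_V: "l > 0 \<Longrightarrow> leval (fps_V l y) cs = fps_V l (leval (y :: rat fps) cs)"
  by (induction cs) (simp_all add: fps_V_add fps_V_mult fps_of_int[symmetric])

text \<open>
  The conjugates of \<open>p\<close> are roots of the equation too, since its coefficients are series in \<open>q^l\<close>. They are
  distinct because their leading coefficients are: the order \<open>s\<close> is prime to \<open>l\<close>. So they are all the roots, and
  the traces of the powers of \<open>p\<close> are the power sums of the roots.
\<close>

lemma trace_power_recursion:
  fixes p y :: "rat fps"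
  assumes l: "l > 0" and len: "length css = Suc l" and monic: "css ! l = [1]"
    and eq: "lleval p (fps_V l y) css = 0"
    and p: "\<And>i. i < s \<Longrightarrow> fps_nth p i = 0" "fps_nth p s \<noteq> 0" "coprime l s"
  shows "n < l \<Longrightarrow> trace_fps l (p ^ n) = of_nat (l - n) * leval (fps_V l y) (css ! (l - n))
           - (\<Sum>i<n. leval (fps_V l y) (css ! (l - n + i)) * trace_fps l (p ^ i))"
    and "n \<ge> l \<Longrightarrow> trace_fps l (p ^ n) = - (\<Sum>i<l. leval (fps_V l y) (css ! i) * trace_fps l (p ^ (n - l + i)))"
proof -
  define x where "x = fps_V l y"
  define A where "A = Poly (map (leval (twist l 0 x)) css)"
  define z where "z = (\<lambda>i. twist l i p)"
  have coeffA: "Polynomial.coeff A k = leval (twist l 0 x) (css ! k)" if "k \<le> l" for k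
    using that len by (simp add: A_def coeff_Poly_eq nth_default_def)
  have lead: "Polynomial.coeff A l = 1" by (simp add: coeffA monic)
  have "degree A \<le> l"
    by (rule degree_le) (use len in \<open>auto simp: A_def coeff_Poly_eq nth_default_def\<close>)
  hence deg: "degree A = l" using lead by (metis le_antisym le_degree zero_neq_one)
  have root: "poly A (z i) = 0" for i
  proof -
    have "twist l i (lleval p x css) = 0" using eq by (simp add: x_def)
    thus ?thesis using twist_V[OF l, of i y] by (simp add: A_def z_def poly_Poly_leval x_def)
  qed
  have inj: "inj_on z {..<l}"
  proof (rule linorder_inj_onI)
    fix i j assume ij: "i < j" "i \<in> {..<l}" "j \<in> {..<l}"
    show "z i \<noteq> z j"
    proof
      assume "z i = z j"
      hence "fps_nth (z i) s = fps_nth (z j) s" by simp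
      hence "root_of_unity l ^ (i * s) = root_of_unity l ^ (j * s)" using p(2) by (simp add: z_def)
      moreover have "j * s = i * s + (j - i) * s" using ij by (simp add: add_mult_distrib[symmetric])
      hence "root_of_unity l ^ (j * s) = root_of_unity l ^ (i * s) * root_of_unity l ^ ((j - i) * s)"
        by (simp only: power_add)
      moreover have "root_of_unity l ^ (i * s) \<noteq> 0" by (simp add: root_of_unity_def)
      ultimately have "root_of_unity l ^ ((j - i) * s) = 1" by auto
      hence "l dvd (j - i) * s" using l by (simp add: root_of_unity_power_eq_1_iff)
      hence "l dvd j - i" using p(3) by (simp add: coprime_dvd_mult_left_iff)
      thus False using ij by (auto dest: dvd_imp_le)
    qed
  qed auto
  have prod: "A = (\<Prod>i<l. [:- z i, 1:])"
    by (rule monic_poly_eq_prod_roots[OF deg lead root inj])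
  have power_sum: "(\<Sum>i<l. z i ^ m) = twist l 0 (trace_fps l (p ^ m))" for m
    by (simp add: z_def sum_twist[OF l, symmetric])
  show "trace_fps l (p ^ n) = of_nat (l - n) * leval (fps_V l y) (css ! (l - n))
           - (\<Sum>i<n. leval (fps_V l y) (css ! (l - n + i)) * trace_fps l (p ^ i))" if n: "n < l"
  proof (rule twist_0_inject)
    obtain k where k: "l = Suc (n + k)" using n less_iff_Suc_add by auto
    have ln: "l - n = Suc k" using k by simp
    have "of_nat (Suc k) * Polynomial.coeff A (Suc k) = (\<Sum>m\<in>{Suc k..l}. Polynomial.coeff A m * (\<Sum>i<l. z i ^ (m - Suc k)))"
      by (rule newton_identities[OF prod]) (simp add: k)
    also have "\<dots> = (\<Sum>m\<in>{..n}. Polynomial.coeff A (Suc k + m) * (\<Sum>i<l. z i ^ m))"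
      by (rule sum.reindex_bij_witness[where i = "\<lambda>m. Suc k + m" and j = "\<lambda>m. m - Suc k"]) (auto simp: k)
    also have "\<dots> = (\<Sum>m<n. Polynomial.coeff A (Suc k + m) * (\<Sum>i<l. z i ^ m)) + Polynomial.coeff A l * (\<Sum>i<l. z i ^ n)"
      by (simp add: lessThan_Suc_atMost[symmetric] k add.commute)
    finally have "(\<Sum>i<l. z i ^ n) = of_nat (Suc k) * Polynomial.coeff A (Suc k) - (\<Sum>m<n. Polynomial.coeff A (Suc k + m) * (\<Sum>i<l. z i ^ m))"
      by (simp add: lead)
    moreover have "Polynomial.coeff A (Suc k + m) = leval (twist l 0 x) (css ! (Suc k + m))" if "m < n" for m
      using that by (intro coeffA) (simp add: k)
    moreover have "Polynomial.coeff A (Suc k) = leval (twist l 0 x) (css ! Suc k)"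
      by (intro coeffA) (simp add: k)
    ultimately have "twist l 0 (trace_fps l (p ^ n)) = of_nat (Suc k) * leval (twist l 0 x) (css ! Suc k)
        - (\<Sum>m<n. leval (twist l 0 x) (css ! (Suc k + m)) * twist l 0 (trace_fps l (p ^ m)))"
      unfolding power_sum by simp
    thus "twist l 0 (trace_fps l (p ^ n)) = twist l 0 (of_nat (l - n) * leval (fps_V l y) (css ! (l - n))
           - (\<Sum>i<n. leval (fps_V l y) (css ! (l - n + i)) * trace_fps l (p ^ i)))"
      unfolding ln diff_conv_add_uminus twist_add twist_minus x_def by simp
  qed
  show "trace_fps l (p ^ n) = - (\<Sum>i<l. leval (fps_V l y) (css ! i) * trace_fps l (p ^ (n - l + i)))" if n: "n \<ge> l"
  proof -
    have "lleval p x css = (\<Sum>i<Suc l. leval x (css ! i) * p ^ i)"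
      by (simp only: lleval_eq_sum len)
    hence "p ^ (n - l) * (\<Sum>i<Suc l. leval x (css ! i) * p ^ i) = 0" using eq by (simp add: x_def)
    hence "(\<Sum>i<Suc l. leval x (css ! i) * p ^ (n - l + i)) = 0"
      by (simp add: sum_distrib_left power_add algebra_simps del: sum.lessThan_Suc)
    hence "trace_fps l (\<Sum>i<Suc l. fps_V l (leval y (css ! i)) * p ^ (n - l + i)) = trace_fps l 0"
      by (simp add: x_def leval_V[OF l] del: sum.lessThan_Suc)
    hence "(\<Sum>i<Suc l. fps_V l (leval y (css ! i)) * trace_fps l (p ^ (n - l + i))) = 0"
      by (simp add: trace_fps_sum[OF l] trace_fps_V_mult[OF l] del: sum.lessThan_Suc)
         (simp add: trace_fps_def fps_V_0[OF l])
    thus ?thesis using n monic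
      by (simp add: leval_V[OF l, symmetric] add_eq_0_iff2 add.commute)
  qed
qed

section \<open>Divisibility of the coefficients\<close>

text \<open>
  The exponent is \<open>t / (2 s)\<close> rounded up. Rounding up is subadditive, which makes weights add under
  multiplication.
\<close>

definition weighted :: "nat \<Rightarrow> nat \<Rightarrow> int \<Rightarrow> rat \<Rightarrow> bool" where
  "weighted l s t c \<longleftrightarrow> c = 0 \<or> (t \<ge> 0 \<and> (\<exists>z::int. c = of_int (z * int l ^ ((nat t + 2 * s - 1) div (2 * s)))))"

lemma weighted_0 [simp]: "weighted l s t 0"
  by (simp add: weighted_def)

lemma weighted_add:
  assumes "weighted l s t a" "weighted l s t b"
  shows "weighted l s t (a + b)"
proof (cases "a = 0 \<or> b = 0")
  case False
  then obtain y z where "t \<ge> 0" "a = of_int (y * int l ^ ((nat t + 2 * s - 1) div (2 * s)))"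
    "b = of_int (z * int l ^ ((nat t + 2 * s - 1) div (2 * s)))"
    using assms by (auto simp: weighted_def)
  hence "a + b = of_int ((y + z) * int l ^ ((nat t + 2 * s - 1) div (2 * s)))"
    by (simp add: algebra_simps)
  thus ?thesis using \<open>t \<ge> 0\<close> unfolding weighted_def by blast
qed (use assms in auto)

lemma weighted_sum: "(\<And>i. i \<in> I \<Longrightarrow> weighted l s t (f i)) \<Longrightarrow> weighted l s t (\<Sum>i\<in>I. f i)"
  by (induction I rule: infinite_finite_induct) (auto intro: weighted_add)

lemma weighted_of_int_mult:
  assumes "weighted l s t a"
  shows "weighted l s t (of_int z * a)"
proof (cases "a = 0")
  case False
  then obtain y where "t \<ge> 0" "a = of_int (y * int l ^ ((nat t + 2 * s - 1) div (2 * s)))"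
    using assms by (auto simp: weighted_def)
  hence "of_int z * a = of_int ((z * y) * int l ^ ((nat t + 2 * s - 1) div (2 * s)))" by simp
  thus ?thesis using \<open>t \<ge> 0\<close> unfolding weighted_def by blast
qed auto

lemma weighted_mult:
  assumes "weighted l s t a" "weighted l s t' b" "s > 0"
  shows "weighted l s (t + t') (a * b)"
proof (cases "a = 0 \<or> b = 0")
  case False
  define u where "u = (nat t + 2 * s - 1) div (2 * s)"
  define v where "v = (nat t' + 2 * s - 1) div (2 * s)"
  define w where "w = (nat (t + t') + 2 * s - 1) div (2 * s)"
  from False obtain y z where yz: "t \<ge> 0" "t' \<ge> 0" "a = of_int (y * int l ^ u)" "b = of_int (z * int l ^ v)"
    using assms by (auto simp: weighted_def u_def v_def)
  have ceil: "n \<le> ((n + 2 * s - 1) div (2 * s)) * (2 * s)" for n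
  proof -
    have "(n + 2 * s - 1) mod (2 * s) < 2 * s" using assms(3) by simp
    moreover have "((n + 2 * s - 1) div (2 * s)) * (2 * s) + (n + 2 * s - 1) mod (2 * s) = n + 2 * s - 1"
      by (rule div_mult_mod_eq)
    ultimately show ?thesis using assms(3) by linarith
  qed
  have "nat (t + t') \<le> (u + v) * (2 * s)"
    using ceil[of "nat t"] ceil[of "nat t'"] yz(1,2) by (simp add: u_def v_def add_mult_distrib nat_add_distrib)
  hence "nat (t + t') + 2 * s - 1 < Suc (u + v) * (2 * s)" using assms(3) by simp
  hence "w < Suc (u + v)" unfolding w_def using assms(3) by (simp add: div_less_iff_less_mult)
  then obtain k where k: "u + v = w + k" by (metis less_Suc_eq_le le_iff_add)
  have "a * b = of_int (y * z * int l ^ (u + v))" by (simp add: yz power_add)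
  also have "\<dots> = of_int ((y * z * int l ^ k) * int l ^ w)" unfolding k by (simp add: power_add)
  finally show ?thesis using yz(1,2) unfolding weighted_def w_def by (metis add_nonneg_nonneg)
qed auto

text \<open>
  With \<open>g(q^l)\<close> in place of the variable, a polynomial that stands for an expression of degree \<open>c\<close> in \<open>\<phi>\<close>.
  The weight of a coefficient is the amount by which the order \<open>l j\<close> of its monomial exceeds the order \<open>s c\<close>.
\<close>

definition graded :: "nat \<Rightarrow> nat \<Rightarrow> nat \<Rightarrow> rat poly \<Rightarrow> bool" where
  "graded l s c P \<longleftrightarrow> (\<forall>j. weighted l s (int (l * j) - int (s * c)) (Polynomial.coeff P j))"

lemma graded_0 [simp]: "graded l s c 0" by (simp add: graded_def)

lemma graded_add: "graded l s c P \<Longrightarrow> graded l s c Q \<Longrightarrow> graded l s c (P + Q)"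
  by (auto simp: graded_def intro: weighted_add)

lemma graded_sum: "(\<And>i. i \<in> I \<Longrightarrow> graded l s c (f i)) \<Longrightarrow> graded l s c (\<Sum>i\<in>I. f i)"
  by (induction I rule: infinite_finite_induct) (auto intro: graded_add)

lemma graded_smult: "graded l s c P \<Longrightarrow> graded l s c (Polynomial.smult (of_int z) P)"
  by (auto simp: graded_def intro: weighted_of_int_mult)

lemma graded_mult:
  assumes "graded l s c P" "graded l s c' Q" "s > 0"
  shows "graded l s (c + c') (P * Q)"
  unfolding graded_def
proof
  fix j
  show "weighted l s (int (l * j) - int (s * (c + c'))) (Polynomial.coeff (P * Q) j)"
    unfolding coeff_mult
  proof (rule weighted_sum)
    fix i assume "i \<in> {..j}"
    hence "int (l * j) - int (s * (c + c')) = (int (l * i) - int (s * c)) + (int (l * (j - i)) - int (s * c'))"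
      by (simp add: of_nat_diff algebra_simps)
    thus "weighted l s (int (l * j) - int (s * (c + c'))) (Polynomial.coeff P i * Polynomial.coeff Q (j - i))"
      using assms by (auto simp: graded_def intro: weighted_mult)
  qed
qed

definition poly_at :: "rat poly \<Rightarrow> rat fps \<Rightarrow> rat fps" where
  "poly_at P y = fps_compose (fps_of_poly P) y"

lemma poly_at_add: "poly_at (P + Q) y = poly_at P y + poly_at Q y"
  by (simp add: poly_at_def fps_of_poly_add fps_compose_add_distrib)

lemma poly_at_0 [simp]: "poly_at 0 y = 0"
  by (simp add: poly_at_def)

lemma poly_at_sum: "poly_at (\<Sum>i\<in>I. f i) y = (\<Sum>i\<in>I. poly_at (f i) y)"
  by (induction I rule: infinite_finite_induct) (simp_all add: poly_at_add)

lemma poly_at_smult: "poly_at (Polynomial.smult c P) y = fps_const c * poly_at P y"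
  by (simp add: poly_at_def fps_of_poly_smult fps_const_mult_apply_left)

lemma poly_at_mult: "fps_nth y 0 = 0 \<Longrightarrow> poly_at (P * Q) y = poly_at P y * poly_at Q y"
  by (simp add: poly_at_def fps_of_poly_mult fps_compose_mult_distrib)

lemma leval_eq_poly_at:
  assumes "fps_nth y 0 = 0"
  shows "leval y cs = poly_at (Poly (map of_int cs)) y"
proof (induction cs)
  case (Cons c cs)
  have "Poly (map of_int (c # cs)) = [:of_int c:] + [:0, 1:] * Poly (map of_int cs :: rat list)" by simp
  hence "poly_at (Poly (map of_int (c # cs))) y = poly_at [:of_int c:] y + poly_at [:0, 1:] y * poly_at (Poly (map of_int cs)) y"
    by (simp only: poly_at_add poly_at_mult[OF assms])
  thus ?case using Cons assms by (simp add: poly_at_def fps_of_poly_const fps_of_int[symmetric])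
qed (simp add: poly_at_def)

definition graded_rows :: "nat \<Rightarrow> nat \<Rightarrow> int list list \<Rightarrow> bool" where
  "graded_rows l s css \<longleftrightarrow> (\<forall>k\<in>set [0..<Suc l]. \<forall>j\<in>set [0..<length (css ! k)].
     css ! k ! j = 0 \<or> (s * (l - k) \<le> l * j \<and>
       int l ^ ((l * j - s * (l - k) + 2 * s - 1) div (2 * s)) dvd css ! k ! j))"

lemma graded_rowsD:
  assumes "graded_rows l s css" "k \<le> l"
  shows "graded l s (l - k) (Poly (map of_int (css ! k)))"
  unfolding graded_def
proof
  fix j
  show "weighted l s (int (l * j) - int (s * (l - k))) (Polynomial.coeff (Poly (map of_int (css ! k))) j)"
  proof (cases "j < length (css ! k) \<and> css ! k ! j \<noteq> 0")
    case True
    have kj: "k \<in> set [0..<Suc l]" "j \<in> set [0..<length (css ! k)]" using assms(2) True by auto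
    hence *: "s * (l - k) \<le> l * j" "int l ^ ((l * j - s * (l - k) + 2 * s - 1) div (2 * s)) dvd css ! k ! j"
      using assms(1) True unfolding graded_rows_def by blast+
    have "nat (int (l * j) - int (s * (l - k))) = l * j - s * (l - k)" using *(1) by linarith
    moreover obtain z where "css ! k ! j = z * int l ^ ((l * j - s * (l - k) + 2 * s - 1) div (2 * s))"
      using *(2) by (metis dvd_div_mult_self)
    moreover have "Polynomial.coeff (Poly (map of_int (css ! k))) j = (of_int (css ! k ! j) :: rat)"
      using True by (simp add: coeff_Poly_eq nth_default_def)
    moreover have "int (l * j) - int (s * (l - k)) \<ge> 0" using *(1) by linarith
    ultimately show ?thesis unfolding weighted_def by metis
  qed (auto simp: coeff_Poly_eq nth_default_def)
qed

text \<open>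
  The recursion for the traces is homogeneous for the grading, in which \<open>leval x (css ! k)\<close> has degree
  \<open>l - k\<close>.
\<close>

lemma graded_traces:
  fixes p y :: "rat fps"
  assumes l: "l > 0" and len: "length css = Suc l" and monic: "css ! l = [1]"
    and eq: "lleval p (fps_V l y) css = 0" and y: "fps_nth y 0 = 0"
    and p: "\<And>i. i < s \<Longrightarrow> fps_nth p i = 0" "fps_nth p s \<noteq> 0" "coprime l s" and s: "s > 0"
    and rows: "graded_rows l s css"
  shows "\<exists>P. graded l s n P \<and> trace_fps l (p ^ n) = poly_at P (fps_V l y)"
proof (induction n rule: less_induct)
  case (less n)
  define x where "x = fps_V l y"
  have x0: "fps_nth x 0 = 0" using y by (simp add: x_def fps_V_nth_0[OF l])
  define a where "a = (\<lambda>k. Poly (map of_int (css ! k)) :: rat poly)"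
  have a: "leval x (css ! k) = poly_at (a k) x" for k unfolding a_def by (rule leval_eq_poly_at[OF x0])
  have ga: "graded l s (l - k) (a k)" if "k \<le> l" for k
    unfolding a_def by (rule graded_rowsD[OF rows that])
  obtain Q where Q: "graded l s m (Q m)" "trace_fps l (p ^ m) = poly_at (Q m) x" if "m < n" for m
    using less unfolding x_def by metis
  note rec = trace_power_recursion[OF l len monic eq p, folded x_def]
  show ?case
  proof (cases "n < l")
    case True
    define P where "P = Polynomial.smult (of_int (int (l - n))) (a (l - n)) + Polynomial.smult (of_int (- 1)) (\<Sum>i<n. a (l - n + i) * Q i)"
    have "trace_fps l (p ^ n) = of_nat (l - n) * poly_at (a (l - n)) x - (\<Sum>i<n. poly_at (a (l - n + i)) x * poly_at (Q i) x)"
      using rec(1)[OF _ True] Q(2) by (simp add: a)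
    also have "\<dots> = poly_at P x"
      unfolding P_def poly_at_add poly_at_smult poly_at_sum poly_at_mult[OF x0]
      by (simp add: fps_of_nat fps_const_neg[symmetric] del: fps_const_neg)
    finally have "trace_fps l (p ^ n) = poly_at P x" .
    moreover have "graded l s n P"
      unfolding P_def
    proof (intro graded_add graded_smult graded_sum)
      show "graded l s n (a (l - n))" using ga[of "l - n"] True by simp
      fix i assume "i \<in> {..<n}"
      hence i: "i < n" by simp
      have "graded l s ((l - (l - n + i)) + i) (a (l - n + i) * Q i)"
        using ga[of "l - n + i"] Q(1)[OF i] True i s by (intro graded_mult) auto
      thus "graded l s n (a (l - n + i) * Q i)" using True i by simp
    qed
    ultimately show ?thesis unfolding x_def by blast
  next
    case False
    define P where "P = Polynomial.smult (of_int (- 1)) (\<Sum>i<l. a i * Q (n - l + i))"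
    have "trace_fps l (p ^ n) = - (\<Sum>i<l. poly_at (a i) x * poly_at (Q (n - l + i)) x)"
      using rec(2)[of n] Q(2) False by (simp add: a)
    also have "\<dots> = poly_at P x"
      unfolding P_def poly_at_smult poly_at_sum poly_at_mult[OF x0]
      by (simp add: fps_const_neg[symmetric] del: fps_const_neg)
    finally have "trace_fps l (p ^ n) = poly_at P x" .
    moreover have "graded l s n P"
      unfolding P_def
    proof (intro graded_smult graded_sum)
      fix i assume "i \<in> {..<l}"
      hence i: "i < l" by simp
      have "graded l s ((l - i) + (n - l + i)) (a i * Q (n - l + i))"
        using ga[of i] Q(1)[of "n - l + i"] False i s by (intro graded_mult) auto
      thus "graded l s n (a i * Q (n - l + i))" using False i by simp
    qed
    ultimately show ?thesis unfolding x_def by blast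
  qed
qed

text \<open>
  Substituting a series of order 1 with leading coefficient 1 is unitriangular on coefficients.
\<close>

lemma fps_compose_integral_multiple:
  fixes F y :: "rat fps" and b :: int
  assumes y: "fps_nth y 0 = 0" "fps_nth y 1 = 1" "fps_Ints y"
    and F: "\<And>n. \<exists>z::int. fps_nth (fps_compose F y) n = of_int (b * z)"
  shows "\<exists>z::int. fps_nth F n = of_int (b * z)"
proof (induction n rule: less_induct)
  case (less n)
  have lead: "fps_nth (y ^ n) n = 1"
    using y(1,2) by (simp add: startsby_zero_power_nth_same)
  have "fps_nth (fps_compose F y) n = (\<Sum>i=0..n. fps_nth F i * fps_nth (y ^ i) n)"
    by (simp add: fps_compose_nth)
  also have "\<dots> = (\<Sum>i<n. fps_nth F i * fps_nth (y ^ i) n) + fps_nth F n"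
    by (simp add: lead atLeast0AtMost lessThan_Suc_atMost[symmetric])
  finally have eq: "fps_nth F n = fps_nth (fps_compose F y) n - (\<Sum>i<n. fps_nth F i * fps_nth (y ^ i) n)" by simp
  obtain z where z: "fps_nth (fps_compose F y) n = of_int (b * z)" using F by blast
  obtain w where w: "fps_nth F i = of_int (b * w i)" if "i < n" for i using less by metis
  have "\<exists>v. fps_nth (y ^ i) n = of_int v" for i
    using fps_Ints_power[OF y(3), of i] by (auto simp: fps_Ints_def elim!: Ints_cases)
  then obtain v where v: "fps_nth (y ^ i) n = of_int (v i)" for i by metis
  have "(\<Sum>i<n. fps_nth F i * fps_nth (y ^ i) n) = (\<Sum>i<n. of_int (b * (w i * v i)))"
    by (intro sum.cong) (auto simp: w v)
  also have "\<dots> = of_int (b * (\<Sum>i<n. w i * v i))" by (simp add: sum_distrib_left)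
  finally have "fps_nth F n = of_int (b * (z - (\<Sum>i<n. w i * v i)))"
    unfolding eq z by (simp add: right_diff_distrib)
  thus ?case by blast
qed

lemma poly_at_altdef:
  assumes "fps_nth y 0 = 0"
  shows "poly_at P y = (\<Sum>j\<le>Polynomial.degree P. fps_const (Polynomial.coeff P j) * y ^ j)"
proof -
  have "fps_of_poly P = (\<Sum>j\<le>Polynomial.degree P. fps_const (Polynomial.coeff P j) * fps_X ^ j)"
    by (rule fps_ext) (simp add: fps_sum_nth fps_X_power_nth if_distrib sum.delta coeff_eq_0 not_le cong: if_cong)
  thus ?thesis unfolding poly_at_def
    using assms by (simp add: fps_compose_sum_distrib fps_compose_mult_distrib fps_compose_power[symmetric])
qed

text \<open>
  The trace of \<open>p^n\<close> is \<open>l\<close> times \<open>U (p^n)\<close> at \<open>q^l\<close>, so one factor \<open>l\<close> is lost from the divisibility of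
  \<open>graded_traces\<close>. When the weight is zero there is none to lose, and the integrality of the quotients comes from
  that of \<open>U (p^n)\<close> itself.
\<close>

lemma U_power_expansion:
  fixes p y :: "rat fps"
  assumes l: "l > 0" and len: "length css = Suc l" and monic: "css ! l = [1]"
    and eq: "lleval p (fps_V l y) css = 0" and y: "fps_nth y 0 = 0" "fps_nth y 1 = 1" "fps_Ints y"
    and p: "\<And>i. i < s \<Longrightarrow> fps_nth p i = 0" "fps_nth p s \<noteq> 0" "coprime l s" "fps_Ints p" and s: "s > 0"
    and rows: "graded_rows l s css"
  shows "\<exists>(u::nat \<Rightarrow> int) N. fps_U l (p ^ n) = (\<Sum>j\<le>N. of_int (u j) * y ^ j) \<and>
     (\<forall>j. u j \<noteq> 0 \<longrightarrow> s * n \<le> l * j \<and> int l ^ ((l * j - s * n - 1) div (2 * s)) dvd u j)"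
proof -
  obtain P where P: "graded l s n P" "trace_fps l (p ^ n) = poly_at P (fps_V l y)"
    using graded_traces[OF l len monic eq y(1) p(1-3) s rows] by blast
  have V: "poly_at P (fps_V l y) = fps_V l (poly_at P y)"
    using y(1) l by (simp add: poly_at_def fps_V_compose fps_compose_assoc fps_X_power_nth)
  have ofnat: "(of_nat l :: rat fps) = fps_V l (of_nat l)"
    unfolding fps_of_nat[symmetric] by (simp only: fps_V_const[OF l])
  have "fps_V l (of_nat l * fps_U l (p ^ n)) = fps_V l (poly_at P y)"
    using P(2) V ofnat by (simp add: trace_fps_def fps_V_mult[OF l])
  hence U: "of_nat l * fps_U l (p ^ n) = poly_at P y" by (rule fps_V_injective[OF l])
  have "\<exists>z. Polynomial.coeff P j = of_int (int l * z)" for j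
  proof -
    have "\<exists>z. fps_nth (fps_of_poly P) j = of_int (int l * z)"
    proof (rule fps_compose_integral_multiple[OF y])
      fix k
      obtain z where "fps_nth (p ^ n) (l * k) = of_int z"
        using fps_Ints_power[OF p(4), of n] by (auto simp: fps_Ints_def elim!: Ints_cases)
      moreover have "fps_nth (of_nat l * fps_U l (p ^ n)) k = of_nat l * fps_nth (fps_U l (p ^ n)) k"
        by (simp only: fps_of_nat[symmetric] fps_mult_left_const_nth)
      ultimately show "\<exists>z. fps_nth (fps_compose (fps_of_poly P) y) k = of_int (int l * z)"
        unfolding poly_at_def[symmetric] U[symmetric] by (intro exI[of _ z]) simp
    qed
    thus ?thesis by simp
  qed
  then obtain u where u: "Polynomial.coeff P j = of_int (int l * u j)" for j by metis
  have "of_nat l * fps_U l (p ^ n) = of_nat l * (\<Sum>j\<le>Polynomial.degree P. of_int (u j) * y ^ j)"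
    unfolding U poly_at_altdef[OF y(1)] u sum_distrib_left
    by (simp add: fps_of_int fps_const_mult[symmetric] fps_of_nat mult.assoc del: fps_const_mult)
  moreover have "(of_nat l :: rat fps) \<noteq> 0" using l by simp
  ultimately have 1: "fps_U l (p ^ n) = (\<Sum>j\<le>Polynomial.degree P. of_int (u j) * y ^ j)"
    using mult_left_cancel by blast
  have 2: "s * n \<le> l * j \<and> int l ^ ((l * j - s * n - 1) div (2 * s)) dvd u j" if j: "u j \<noteq> 0" for j
  proof -
    have "Polynomial.coeff P j \<noteq> 0" using j l by (simp add: u)
    then obtain z where t: "int (l * j) - int (s * n) \<ge> 0" and
        z: "Polynomial.coeff P j = of_int (z * int l ^ ((nat (int (l * j) - int (s * n)) + 2 * s - 1) div (2 * s)))"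
      using P(1) unfolding graded_def weighted_def by metis
    have le: "s * n \<le> l * j" using t by linarith
    have m: "nat (int (l * j) - int (s * n)) = l * j - s * n" using le by linarith
    have "int l * u j = z * int l ^ ((l * j - s * n + 2 * s - 1) div (2 * s))"
      using z unfolding u m by (simp only: of_int_eq_iff)
    moreover have "Suc ((l * j - s * n - 1) div (2 * s)) = (l * j - s * n + 2 * s - 1) div (2 * s)" if "l * j > s * n"
    proof -
      have "l * j - s * n + 2 * s - 1 = (l * j - s * n - 1) + 2 * s" using that by linarith
      hence "(l * j - s * n + 2 * s - 1) div (2 * s) = ((l * j - s * n - 1) + 2 * s) div (2 * s)" by (simp only:)
      also have "\<dots> = Suc ((l * j - s * n - 1) div (2 * s))" using s by (subst div_add_self2) auto
      finally show ?thesis ..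
    qed
    ultimately have "l * j > s * n \<Longrightarrow> int l * u j = int l * (z * int l ^ ((l * j - s * n - 1) div (2 * s)))"
      by (metis mult.left_commute power_Suc)
    hence "l * j > s * n \<Longrightarrow> int l ^ ((l * j - s * n - 1) div (2 * s)) dvd u j" using l by simp
    moreover have "l * j = s * n \<Longrightarrow> int l ^ ((l * j - s * n - 1) div (2 * s)) dvd u j" by simp
    ultimately show ?thesis using le by linarith
  qed
  show ?thesis using 1 2 by blast
qed

lemma fps_Ints_V: "fps_Ints f \<Longrightarrow> fps_Ints (fps_V l f)"
  by (auto simp: fps_Ints_def fps_V_def)

lemma fps_Ints_X_power: "fps_Ints (fps_X ^ n)"
  by (auto simp: fps_Ints_def fps_X_power_nth)

lemma U_phi_expansion:
  assumes "l \<in> {5, 7, 13}" "r * (l - 1) = 24" "s = (l ^ 2 - 1) div 24"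
  shows "\<exists>(u::nat \<Rightarrow> int) N. fps_U l (phi l ^ n) = (\<Sum>j\<le>N. of_int (u j) * hauptmodul l r ^ j) \<and>
     (\<forall>j. u j \<noteq> 0 \<longrightarrow> s * n \<le> l * j \<and> int l ^ ((l * j - s * n - 1) div (2 * s)) dvd u j)"
proof -
  have l: "l > 0" using assms by auto
  have cases: "l = 5 \<and> r = 6 \<and> s = 1 \<or> l = 7 \<and> r = 4 \<and> s = 2 \<or> l = 13 \<and> r = 2 \<and> s = 7"
    using assms by auto
  have len: "length (modular_poly l) = Suc l" and monic: "modular_poly l ! l = [1]"
    using cases by (auto simp: modular_poly_def)
  have "graded_rows 5 1 (modular_poly 5)" "graded_rows 7 2 (modular_poly 7)" "graded_rows 13 7 (modular_poly 13)"
    by code_simp+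
  hence rows: "graded_rows l s (modular_poly l)" using cases by auto
  have eq: "lleval (phi l) (fps_V l (hauptmodul l r)) (modular_poly l) = 0"
    using cases modular_equation_5 modular_equation_7 modular_equation_13 by (elim disjE conjE) (simp_all only:)
  have X: "fps_Ints fps_X" using fps_Ints_X_power[of 1] by simp
  have y: "fps_nth (hauptmodul l r) 0 = 0" "fps_nth (hauptmodul l r) 1 = 1" "fps_Ints (hauptmodul l r)"
    unfolding hauptmodul_def
    by (simp_all add: mult.assoc fps_V_nth_0[OF l])
       (intro fps_Ints_mult fps_Ints_V fps_Ints_euler_pow X)
  have s: "s > 0" using cases by auto
  have "coprime (5::nat) 1" "coprime (7::nat) 2" "coprime (13::nat) 7" by code_simp+
  hence cop: "coprime l s" using cases by auto
  have phi: "phi l = fps_X ^ s * (euler_pow 1 * fps_V l (fps_V l (euler_pow (- 1))))"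
    using assms by (simp add: phi_def mult.assoc)
  have p1: "fps_nth (phi l) i = 0" if "i < s" for i
    using that by (simp add: phi fps_X_power_mult_nth)
  have p2: "fps_nth (phi l) s \<noteq> 0"
    by (simp add: phi fps_X_power_mult_nth fps_V_nth_0[OF l])
  have p3: "fps_Ints (phi l)"
    unfolding phi by (intro fps_Ints_mult fps_Ints_X_power fps_Ints_euler_pow fps_Ints_V)
  show ?thesis
    by (rule U_power_expansion[OF l len monic eq y p1 p2 cop p3 s rows])
qed

section \<open>Congruences between the exponents\<close>

definition fps_multiple :: "int \<Rightarrow> rat fps \<Rightarrow> bool" where
  "fps_multiple b f \<longleftrightarrow> (\<exists>h. fps_Ints h \<and> f = of_int b * h)"

lemma fps_Ints_add: "fps_Ints f \<Longrightarrow> fps_Ints g \<Longrightarrow> fps_Ints (f + g)"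
  by (auto simp: fps_Ints_def)

lemma fps_Ints_minus: "fps_Ints f \<Longrightarrow> fps_Ints (- f)"
  by (auto simp: fps_Ints_def)

lemma fps_Ints_0 [simp]: "fps_Ints 0" and fps_Ints_1 [simp]: "fps_Ints 1"
  by (auto simp: fps_Ints_def)

lemma fps_Ints_of_int [simp]: "fps_Ints (of_int c)"
  by (auto simp: fps_Ints_def)

lemma fps_Ints_of_nat [simp]: "fps_Ints (of_nat c)"
  by (auto simp: fps_Ints_def)

lemma fps_Ints_sum: "(\<And>i. i \<in> I \<Longrightarrow> fps_Ints (f i)) \<Longrightarrow> fps_Ints (\<Sum>i\<in>I. f i)"
  by (induction I rule: infinite_finite_induct) (auto intro: fps_Ints_add)

lemma fps_multiple_of_int_mult: "fps_Ints h \<Longrightarrow> fps_multiple b (of_int b * h)"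
  by (auto simp: fps_multiple_def)

lemma fps_multiple_add: "fps_multiple b f \<Longrightarrow> fps_multiple b g \<Longrightarrow> fps_multiple b (f + g)"
  unfolding fps_multiple_def by (metis distrib_left fps_Ints_add)

lemma fps_multiple_minus: "fps_multiple b f \<Longrightarrow> fps_multiple b (- f)"
  unfolding fps_multiple_def by (metis fps_Ints_minus mult_minus_right)

lemma fps_multiple_mult: "fps_multiple b f \<Longrightarrow> fps_Ints g \<Longrightarrow> fps_multiple b (f * g)"
  unfolding fps_multiple_def by (metis fps_Ints_mult mult.assoc)

lemma fps_multiple_0 [simp]: "fps_multiple b 0"
  unfolding fps_multiple_def by (metis fps_Ints_0 mult_zero_right)

lemma fps_multiple_nth:
  assumes "fps_multiple b f"
  shows "\<exists>z::int. fps_nth f n = of_int (b * z)"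
proof -
  obtain h where h: "fps_Ints h" "f = of_int b * h" using assms by (auto simp: fps_multiple_def)
  obtain z where "fps_nth h n = of_int z" using h by (auto simp: fps_Ints_def elim: Ints_cases)
  hence "fps_nth f n = of_int (b * z)"
    unfolding h(2) fps_of_int[symmetric] fps_mult_left_const_nth by simp
  thus ?thesis by blast
qed

lemma fps_multipleI:
  assumes "\<And>n. \<exists>z::int. fps_nth f n = of_int (b * z)"
  shows "fps_multiple b f"
proof -
  obtain z where z: "fps_nth f n = of_int (b * z n)" for n using assms by metis
  have "f = of_int b * Abs_fps (\<lambda>n. of_int (z n))"
    by (rule fps_ext) (simp add: z fps_of_int[symmetric])
  moreover have "fps_Ints (Abs_fps (\<lambda>n. of_int (z n)))" by (simp add: fps_Ints_def)
  ultimately show ?thesis unfolding fps_multiple_def by blast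
qed

lemma fermat_int:
  assumes "prime l"
  shows "[z ^ l = z] (mod int l)"
proof -
  have l: "l > 0" using assms prime_gt_0_nat by blast
  define a where "a = nat (z mod int l)"
  have a: "int a = z mod int l" using l by (simp add: a_def)
  have "[a ^ l = a] (mod l)"
  proof (cases "l dvd a")
    case True
    moreover from this l have "l dvd a ^ l" by (metis dvd_power dvd_trans)
    ultimately show ?thesis by (simp add: cong_def dvd_eq_mod_eq_0)
  next
    case False
    have "[a ^ (l - 1) * a = 1 * a] (mod l)"
      using fermat_theorem[OF assms False] by (rule cong_scalar_right)
    moreover have "a ^ (l - 1) * a = a ^ l" using l by (cases l) simp_all
    ultimately show ?thesis by simp
  qed
  hence "[int a ^ l = int a] (mod int l)" by (simp flip: cong_int_iff)
  moreover have "[z = int a] (mod int l)" by (simp add: a cong_def)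
  ultimately show ?thesis using cong_pow[of z "int a" "int l" l] by (simp add: cong_def)
qed

lemma fps_power_prime_add:
  assumes "prime l" "fps_Ints f" "fps_Ints g"
  shows "fps_multiple (int l) ((f + g) ^ l - f ^ l - g ^ l)"
proof -
  have l: "l > 0" using assms prime_gt_0_nat by blast
  have "(f + g) ^ l = (\<Sum>k\<le>l. of_nat (l choose k) * f ^ k * g ^ (l - k))"
    by (rule binomial_ring)
  also have "{..l} = insert 0 (insert l {0<..<l})" using l by auto
  also have "(\<Sum>k\<in>insert 0 (insert l {0<..<l}). of_nat (l choose k) * f ^ k * g ^ (l - k))
      = g ^ l + (f ^ l + (\<Sum>k\<in>{0<..<l}. of_nat (l choose k) * f ^ k * g ^ (l - k)))"
    using l by (subst sum.insert; simp)+
  finally have *: "(f + g) ^ l - f ^ l - g ^ l = (\<Sum>k\<in>{0<..<l}. of_nat (l choose k) * f ^ k * g ^ (l - k))"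
    by simp
  also have "\<dots> = (\<Sum>k\<in>{0<..<l}. of_int (int l) * (of_nat ((l choose k) div l) * f ^ k * g ^ (l - k)))"
  proof (rule sum.cong)
    fix k assume "k \<in> {0<..<l}"
    hence "l dvd (l choose k)" using assms(1) by (intro dvd_choose_prime) auto
    hence "l choose k = l * ((l choose k) div l)" by simp
    hence "(of_nat (l choose k) :: rat fps) = of_nat l * of_nat ((l choose k) div l)"
      by (metis of_nat_mult)
    thus "of_nat (l choose k) * f ^ k * g ^ (l - k) = of_int (int l) * (of_nat ((l choose k) div l) * f ^ k * g ^ (l - k))"
      by (simp add: algebra_simps)
  qed simp
  also have "\<dots> = of_int (int l) * (\<Sum>k\<in>{0<..<l}. of_nat ((l choose k) div l) * f ^ k * g ^ (l - k))"
    by (simp only: sum_distrib_left)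
  finally show ?thesis
    using assms by (simp only:) (intro fps_multiple_of_int_mult fps_Ints_sum fps_Ints_mult fps_Ints_power fps_Ints_of_nat)
qed

text \<open>
  For polynomials by adding one term at a time, and a single coefficient only sees a polynomial.
\<close>

lemma fps_frobenius:
  assumes l: "prime l" and f: "fps_Ints f"
  shows "fps_multiple (int l) (f ^ l - fps_V l f)"
proof (rule fps_multipleI)
  fix n
  have l0: "l > 0" using l prime_gt_0_nat by blast
  define t where "t = (\<lambda>m. \<Sum>i<m. fps_const (fps_nth f i) * fps_X ^ i)"
  have mono: "fps_Ints (fps_const (fps_nth f i) * fps_X ^ i)" for i
    using f by (intro fps_Ints_mult fps_Ints_X_power) (auto simp: fps_Ints_def)
  have tI: "fps_Ints (t m)" for m unfolding t_def by (intro fps_Ints_sum mono)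
  have "fps_multiple (int l) (t m ^ l - fps_V l (t m))" for m
  proof (induction m)
    case 0
    show ?case using l0 by (simp add: t_def fps_V_0[OF l0] power_0_left)
  next
    case (Suc m)
    define g where "g = fps_const (fps_nth f m) * fps_X ^ m"
    have "fps_multiple (int l) (g ^ l - fps_V l g)"
    proof -
      obtain z where z: "fps_nth f m = of_int z" using f by (auto simp: fps_Ints_def elim: Ints_cases)
      have "[z ^ l = z] (mod int l)"
        by (rule fermat_int[OF l])
      then obtain k where k: "z ^ l - z = int l * k" by (auto simp: cong_iff_dvd_diff dvd_def)
      have "g ^ l - fps_V l g = of_int (z ^ l - z) * fps_X ^ (m * l)"
      proof -
        have "fps_V l (of_int z :: rat fps) = of_int z" by (metis fps_V_const[OF l0] fps_of_int)
        thus ?thesis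
          by (simp add: g_def z fps_of_int fps_V_mult[OF l0] fps_V_power[OF l0] fps_V_X[OF l0]
             power_mult_distrib power_mult[symmetric] mult.commute algebra_simps)
      qed
      also have "\<dots> = of_int (int l) * (of_int k * fps_X ^ (m * l))" unfolding k by simp
      finally show ?thesis
        by (simp only:) (intro fps_multiple_of_int_mult fps_Ints_mult fps_Ints_of_int fps_Ints_X_power)
    qed
    moreover have "t (Suc m) = t m + g" by (simp add: t_def g_def)
    moreover have "fps_multiple (int l) ((t m + g) ^ l - t m ^ l - g ^ l)"
      by (rule fps_power_prime_add[OF l tI]) (simp add: g_def mono)
    ultimately have "fps_multiple (int l) (((t m + g) ^ l - t m ^ l - g ^ l) + (t m ^ l - fps_V l (t m)) + (g ^ l - fps_V l g))"
      using Suc by (intro fps_multiple_add)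
    thus ?case by (simp add: \<open>t (Suc m) = t m + g\<close> fps_V_add[OF l0] algebra_simps)
  qed
  from fps_multiple_nth[OF this, of "Suc n" n]
  obtain z where z: "fps_nth (t (Suc n) ^ l - fps_V l (t (Suc n))) n = of_int (int l * z)" by blast
  have t: "fps_nth (t (Suc n)) i = fps_nth f i" if "i \<le> n" for i
    using that by (simp add: t_def fps_sum_nth fps_X_power_nth if_distrib sum.delta cong: if_cong)
  have "fps_nth (t (Suc n) ^ k) i = fps_nth (f ^ k) i" if "i \<le> n" for i k
    using that
  proof (induction k arbitrary: i)
    case (Suc k)
    show ?case unfolding power_Suc by (rule fps_mult_nth_cong) (use Suc t in auto)
  qed simp
  moreover have "fps_nth (fps_V l (t (Suc n))) n = fps_nth (fps_V l f) n"
    using t[of "n div l"] by (simp add: fps_V_def)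
  ultimately have "fps_nth (f ^ l - fps_V l f) n = fps_nth (t (Suc n) ^ l - fps_V l (t (Suc n))) n" by simp
  from this z have "fps_nth (f ^ l - fps_V l f) n = of_int (int l * z)" by (rule trans)
  thus "\<exists>z. fps_nth (f ^ l - fps_V l f) n = of_int (int l * z)" ..
qed

text \<open>
  If \<open>f\<close> is 1 modulo \<open>l\<close>, then \<open>(f^l - 1) / (f - 1) = 1 + f + ... + f^(l-1)\<close> is \<open>l\<close>, that is 0,
  modulo \<open>l\<close>.
\<close>

lemma fps_multiple_power_lift:
  assumes "fps_multiple (int l ^ Suc N) (f - 1)" "fps_Ints f"
  shows "fps_multiple (int l ^ Suc (Suc N)) (f ^ l - 1)"
proof -
  obtain h where h: "fps_Ints h" "f - 1 = of_int (int l ^ Suc N) * h"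
    using assms by (auto simp: fps_multiple_def)
  have f: "f = 1 + of_int (int l ^ Suc N) * h" using h by (simp add: algebra_simps)
  have "fps_multiple (int l) ((\<Sum>i<l. f ^ i))"
  proof -
    have fi: "fps_multiple (int l) (f ^ i - 1)" for i
    proof (induction i)
      case (Suc i)
      have "fps_multiple (int l) (f - 1)"
      proof -
        have "f - 1 = of_int (int l) * (of_int (int l ^ N) * h)" unfolding h by simp
        thus ?thesis using h(1) by (simp only:) (intro fps_multiple_of_int_mult fps_Ints_mult fps_Ints_of_int)
      qed
      hence "fps_multiple (int l) ((f - 1) * f ^ i + (f ^ i - 1))"
        using Suc assms(2) by (intro fps_multiple_add fps_multiple_mult fps_Ints_power)
      thus ?case by (simp add: algebra_simps)
    qed simp
    have "fps_multiple (int l) ((\<Sum>i<m. f ^ i - 1))" for m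
      by (induction m) (auto intro: fps_multiple_add fi)
    moreover have "fps_multiple (int l) (of_nat l)"
      unfolding fps_multiple_def by (intro exI[of _ 1]) simp
    ultimately have "fps_multiple (int l) ((\<Sum>i<l. f ^ i - 1) + of_nat l)" by (intro fps_multiple_add)
    thus ?thesis by (simp add: sum_subtractf)
  qed
  then obtain g where g: "fps_Ints g" "(\<Sum>i<l. f ^ i) = of_int (int l) * g" by (auto simp: fps_multiple_def)
  have "f ^ l - 1 = (f - 1) * (\<Sum>i<l. f ^ i)" by (rule power_diff_1_eq)
  also have "\<dots> = of_int (int l ^ Suc (Suc N)) * (h * g)" unfolding g h(2) by (simp add: algebra_simps)
  finally show ?thesis using h(1) g(1) by (simp only:) (intro fps_multiple_of_int_mult fps_Ints_mult)
qed

lemma euler_pow_unit_congruence: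
  assumes l: "prime l"
  shows "fps_multiple (int l ^ Suc N) (euler_pow (int l ^ Suc N) * fps_V l (euler_pow (- (int l ^ N))) - 1)"
proof (induction N)
  case 0
  have l0: "l > 0" using l prime_gt_0_nat by blast
  have 1: "euler_pow (int l) * euler_pow (- 1) ^ l = 1"
    by (simp add: euler_pow_power euler_pow_minus)
  have "fps_multiple (int l) (- (euler_pow (- 1) ^ l - fps_V l (euler_pow (- 1))) * euler_pow (int l))"
    by (intro fps_multiple_mult fps_multiple_minus fps_frobenius[OF l] fps_Ints_euler_pow)
  also have "- (euler_pow (- 1) ^ l - fps_V l (euler_pow (- 1))) * euler_pow (int l)
      = euler_pow (int l) * fps_V l (euler_pow (- 1)) - 1"
    using 1 by (simp add: algebra_simps)
  finally show ?case by simp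
next
  case (Suc N)
  have l0: "l > 0" using l prime_gt_0_nat by blast
  have "fps_Ints (euler_pow (int l ^ Suc N) * fps_V l (euler_pow (- (int l ^ N))))"
    by (intro fps_Ints_mult fps_Ints_euler_pow fps_Ints_V)
  from fps_multiple_power_lift[OF Suc this]
  show ?case by (simp add: power_mult_distrib euler_pow_power fps_V_power[OF l0, symmetric])
qed

text \<open>
  The shift preserves \<open>c + l d\<close>, and it makes \<open>c\<close> and \<open>c + d\<close> as large as desired.
\<close>

lemma two_colour_gf_shift_congruence:
  assumes l: "prime l"
  shows "fps_multiple (int l ^ Suc N)
    (two_colour_gf l (c + int m * int l ^ Suc N) (d - int m * int l ^ N) - two_colour_gf l c d)"
proof -
  have l0: "l > 0" using l prime_gt_0_nat by blast
  define R where "R = euler_pow (int l ^ Suc N) * fps_V l (euler_pow (- (int l ^ N)))"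
  have RI: "fps_Ints R" unfolding R_def by (intro fps_Ints_mult fps_Ints_euler_pow fps_Ints_V)
  have "fps_multiple (int l ^ Suc N) (R ^ m - 1)"
  proof (induction m)
    case (Suc m)
    have "fps_multiple (int l ^ Suc N) ((R - 1) * R ^ m + (R ^ m - 1))"
      using Suc euler_pow_unit_congruence[OF l, of N] RI unfolding R_def
      by (intro fps_multiple_add fps_multiple_mult fps_Ints_power)
    thus ?case by (simp add: algebra_simps)
  qed simp
  moreover have "R ^ m = euler_pow (int m * int l ^ Suc N) * fps_V l (euler_pow (- (int m * int l ^ N)))"
    by (simp add: R_def power_mult_distrib euler_pow_power fps_V_power[OF l0, symmetric])
  moreover have "fps_Ints (two_colour_gf l c d)"
    unfolding two_colour_gf_split[OF l0] by (intro fps_Ints_mult fps_Ints_euler_pow fps_Ints_V)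
  ultimately have "fps_multiple (int l ^ Suc N) ((euler_pow (int m * int l ^ Suc N) * fps_V l (euler_pow (- (int m * int l ^ N))) - 1)
      * two_colour_gf l c d)"
    by (metis fps_multiple_mult)
  also have "(euler_pow (int m * int l ^ Suc N) * fps_V l (euler_pow (- (int m * int l ^ N))) - 1) * two_colour_gf l c d
     = two_colour_gf l (c + int m * int l ^ Suc N) (d - int m * int l ^ N) - two_colour_gf l c d"
  proof -
    have "d - int m * int l ^ N = d + - (int m * int l ^ N)" by simp
    thus ?thesis unfolding two_colour_gf_split[OF l0]
      by (simp only: euler_pow_add fps_V_mult[OF l0]) (simp add: algebra_simps)
  qed
  finally show ?thesis .
qed

lemma euler_pow_recursion:
  "of_nat n * fps_nth (euler_pow c) n = of_int c * (\<Sum>i<n. fps_nth (euler_pow c) i * divisor_power_sum 1 (n - i))"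
proof -
  have "of_nat n * fps_nth (euler_pow c) n = fps_nth (of_int c * (euler_pow c * sigma_fps 1)) n"
    using arg_cong[OF qD_euler_pow[of c], of "\<lambda>f. fps_nth f n"] by (simp add: algebra_simps)
  also have "\<dots> = of_int c * fps_nth (euler_pow c * sigma_fps 1) n"
    by (simp only: fps_of_int[symmetric] fps_mult_left_const_nth)
  also have "fps_nth (euler_pow c * sigma_fps 1) n = (\<Sum>i<n. fps_nth (euler_pow c) i * divisor_power_sum 1 (n - i))"
    by (simp add: fps_mult_nth sigma_fps_def atLeast0AtMost lessThan_Suc_atMost[symmetric])
  finally show ?thesis .
qed

lemma divisor_sum_code:
  assumes "n > 0"
  shows "divisor_power_sum 1 n = of_nat (sum_list (filter (\<lambda>d. d dvd n) [1..<Suc n]))"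
proof -
  have "{d. d dvd n} = set (filter (\<lambda>d. d dvd n) [1..<Suc n])"
    using assms by (auto dest: dvd_imp_le intro: Suc_leI dvd_pos_nat)
  hence "divisor_power_sum 1 n = of_nat (\<Sum>d\<in>set (filter (\<lambda>d. d dvd n) [1..<Suc n]). d)"
    unfolding divisor_power_sum_def by simp
  also have "(\<Sum>d\<in>set (filter (\<lambda>d. d dvd n) [1..<Suc n]). d) = sum_list (filter (\<lambda>d. d dvd n) [1..<Suc n])"
    by (subst sum.distinct_set_conv_list) (simp_all only: distinct_filter distinct_upt list.map_ident)
  finally show ?thesis .
qed

text \<open>
  By Jacobi's formula the exponents that occur in the cube of Euler's product are triangular numbers, and 8 is not
  one. The recursion for the coefficients is enough to see it.
\<close>

lemma euler_cube_nth_8: "fps_nth (euler_pow (- 3)) 8 = 0"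
proof -
  have "sum_list (filter (\<lambda>d. d dvd 1) [1..<Suc 1]) = (1::nat)" "sum_list (filter (\<lambda>d. d dvd 2) [1..<Suc 2]) = (3::nat)"
    "sum_list (filter (\<lambda>d. d dvd 3) [1..<Suc 3]) = (4::nat)" "sum_list (filter (\<lambda>d. d dvd 4) [1..<Suc 4]) = (7::nat)"
    "sum_list (filter (\<lambda>d. d dvd 5) [1..<Suc 5]) = (6::nat)" "sum_list (filter (\<lambda>d. d dvd 6) [1..<Suc 6]) = (12::nat)"
    "sum_list (filter (\<lambda>d. d dvd 7) [1..<Suc 7]) = (8::nat)" "sum_list (filter (\<lambda>d. d dvd 8) [1..<Suc 8]) = (15::nat)"
    by code_simp+
  hence \<sigma>: "divisor_power_sum 1 1 = 1" "divisor_power_sum 1 2 = 3" "divisor_power_sum 1 3 = 4"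
    "divisor_power_sum 1 4 = 7" "divisor_power_sum 1 5 = 6" "divisor_power_sum 1 6 = 12"
    "divisor_power_sum 1 7 = 8" "divisor_power_sum 1 8 = 15"
    by (simp_all only: divisor_sum_code of_nat_1 of_nat_numeral zero_less_one zero_less_numeral)
  define e where "e = fps_nth (euler_pow (- 3))"
  have rec: "of_nat n * e n = - 3 * (\<Sum>i<n. e i * divisor_power_sum 1 (n - i))" for n
    using euler_pow_recursion[of n "- 3"] by (simp add: e_def)
  have e0: "e 0 = 1" by (simp add: e_def)
  have e1: "e 1 = - 3" using rec[of 1] e0 \<sigma> by simp
  have e2: "e 2 = 0" using rec[of 2] e0 e1 \<sigma> by (simp add: sum.lessThan_Suc eval_nat_numeral)
  have e3: "e 3 = 5" using rec[of 3] e0 e1 e2 \<sigma> by (simp add: sum.lessThan_Suc eval_nat_numeral)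
  have e4: "e 4 = 0" using rec[of 4] e0 e1 e2 e3 \<sigma> by (simp add: sum.lessThan_Suc eval_nat_numeral)
  have e5: "e 5 = 0" using rec[of 5] e0 e1 e2 e3 e4 \<sigma> by (simp add: sum.lessThan_Suc eval_nat_numeral)
  have e6: "e 6 = - 7" using rec[of 6] e0 e1 e2 e3 e4 e5 \<sigma> by (simp add: sum.lessThan_Suc eval_nat_numeral)
  have e7: "e 7 = 0" using rec[of 7] e0 e1 e2 e3 e4 e5 e6 \<sigma> by (simp add: sum.lessThan_Suc eval_nat_numeral)
  show ?thesis using rec[of 8] e0 e1 e2 e3 e4 e5 e6 e7 \<sigma>
    by (simp add: sum.lessThan_Suc eval_nat_numeral e_def)
qed

text \<open>
  Modulo 13 the 13th powers are series in \<open>q^13\<close>, which leaves the cube of Euler's product.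
\<close>

lemma euler_pow_nth_8_mod_13:
  assumes "[c = 10] (mod 13)"
  shows "\<exists>z::int. fps_nth (euler_pow c) 8 = of_int (13 * z)"
proof -
  obtain q where q: "c = - 3 + 13 * q"
  proof -
    have "13 dvd c - 10" using assms by (simp add: cong_iff_dvd_diff)
    then obtain k where "c - 10 = 13 * k" by (auto simp: dvd_def)
    thus ?thesis using that[of "k + 1"] by simp
  qed
  have "fps_multiple (int 13) ((euler_pow q ^ 13 - fps_V 13 (euler_pow q)) * euler_pow (- 3))"
    by (intro fps_multiple_mult fps_frobenius fps_Ints_euler_pow) simp
  from fps_multiple_nth[OF this, of 8]
  obtain z where z: "fps_nth ((euler_pow q ^ 13 - fps_V 13 (euler_pow q)) * euler_pow (- 3)) 8 = of_int (13 * z)" by auto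
  have "fps_nth (fps_V 13 (euler_pow q) * euler_pow (- 3)) 8 = fps_nth (1 * euler_pow (- 3)) 8"
  proof (rule fps_mult_nth_cong)
    fix i :: nat assume "i \<le> 8"
    thus "fps_nth (fps_V 13 (euler_pow q)) i = fps_nth 1 i" by (auto simp: fps_V_def dest: dvd_imp_le)
  qed simp
  hence 0: "fps_nth (fps_V 13 (euler_pow q) * euler_pow (- 3)) 8 = 0" by (simp add: euler_cube_nth_8)
  have "euler_pow c = euler_pow q ^ 13 * euler_pow (- 3)"
    unfolding q euler_pow_add by (simp add: euler_pow_power mult.commute)
  also have "\<dots> = (euler_pow q ^ 13 - fps_V 13 (euler_pow q)) * euler_pow (- 3) + fps_V 13 (euler_pow q) * euler_pow (- 3)"
    by (simp add: left_diff_distrib)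
  finally have "fps_nth (euler_pow c) 8 = of_int (13 * z)" using z 0 by simp
  thus ?thesis by blast
qed

section \<open>The operator $U_l$ on eta quotients of fixed weight\<close>

text \<open>
  For \<open>c + d = w\<close> this is \<open>-(c + l d)\<close>, 24 times the order of the eta quotient.
\<close>

definition eta_order :: "nat \<Rightarrow> int \<Rightarrow> int \<Rightarrow> int" where
  "eta_order l w c = (int l - 1) * c - int l * w"

text \<open>
  The places are 24 times the exponents of the eta quotient with exponents \<open>c\<close> and \<open>d = w - c\<close>. With the
  fractional part of the order included, the operator \<open>U\<close> is \<open>x \<mapsto> l x\<close> on places.
\<close>

definition eta_coeff :: "nat \<Rightarrow> int \<Rightarrow> int \<Rightarrow> int \<Rightarrow> rat" where
  "eta_coeff l w c x = (if 24 dvd x - eta_order l w c \<and> x \<ge> eta_order l w c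
     then fps_nth (two_colour_gf l c (w - c)) (nat ((x - eta_order l w c) div 24)) else 0)"

lemma eta_coeff_eq:
  "eta_coeff l w c (eta_order l w c + 24 * i) = (if i \<ge> 0 then fps_nth (two_colour_gf l c (w - c)) (nat i) else 0)"
  by (simp add: eta_coeff_def)

lemma eta_order_step:
  assumes "r * (int l - 1) = 24" "24 * s = int l ^ 2 - 1"
  shows "int l * eta_order l w (w - c + r * j) = eta_order l w c + 24 * (int l * j - s * c)"
proof -
  have "int l * eta_order l w (w - c + r * j)
      = int l * ((int l - 1) * (w - c) - int l * w) + int l * j * (r * (int l - 1))"
    by (simp add: eta_order_def algebra_simps)
  also have "\<dots> = int l * ((int l - 1) * (w - c) - int l * w) + 24 * (int l * j)"
    unfolding assms(1) by simp
  also have "int l * ((int l - 1) * (w - c) - int l * w) = eta_order l w c - (int l ^ 2 - 1) * c"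
    by (simp add: eta_order_def algebra_simps power2_eq_square)
  finally show ?thesis unfolding assms(2)[symmetric] by (simp add: algebra_simps)
qed

lemma eta_order_shift:
  assumes "r * (int l - 1) = 24"
  shows "eta_order l w (w - c + r * j) = eta_order l w (w - c) + 24 * j"
proof -
  have "eta_order l w (w - c + r * j) = eta_order l w (w - c) + j * (r * (int l - 1))"
    by (simp add: eta_order_def algebra_simps)
  thus ?thesis unfolding assms by simp
qed

text \<open>
  Multiplied by \<open>q^(s n)\<close>, the eta quotient is the \<open>n\<close>-th power of \<open>\<phi>\<close> times a series in \<open>q^l\<close>, which
  comes out of \<open>U\<close>. Multiplying by \<open>g\<close> shifts the exponents by \<open>r\<close> in opposite directions.
\<close>

lemma U_two_colour_gf:
  assumes l: "l > 0"
    and u: "fps_U l (phi l ^ n) = (\<Sum>j\<le>N. of_int (u j) * hauptmodul l r ^ j)"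
    and s: "s = (l ^ 2 - 1) div 24"
  shows "fps_U l (fps_X ^ (s * n) * two_colour_gf l (int n) (w - int n))
    = (\<Sum>j\<le>N. of_int (u j) * (fps_X ^ j * two_colour_gf l (w - int n + int (r * j)) (int n - int (r * j))))"
proof -
  have "fps_X ^ (s * n) * two_colour_gf l (int n) (w - int n)
      = fps_V l (fps_V l (euler_pow (int n)) * euler_pow (w - int n)) * phi l ^ n"
  proof -
    have "fps_V l (fps_V l (euler_pow (int n))) * fps_V l (fps_V l (euler_pow (- int n))) = 1"
      by (simp add: fps_V_mult[OF l, symmetric] euler_pow_minus fps_V_1[OF l])
    hence "fps_V l (fps_V l (euler_pow (int n)) * euler_pow (w - int n)) * phi l ^ n
        = fps_X ^ (n * s) * euler_pow (int n) * fps_V l (euler_pow (w - int n)) * 1"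
      by (simp add: phi_power[OF l] fps_V_mult[OF l] s algebra_simps)
    thus ?thesis by (simp add: two_colour_gf_split[OF l] algebra_simps)
  qed
  hence "fps_U l (fps_X ^ (s * n) * two_colour_gf l (int n) (w - int n))
      = fps_V l (euler_pow (int n)) * euler_pow (w - int n) * (\<Sum>j\<le>N. of_int (u j) * hauptmodul l r ^ j)"
    by (simp only: fps_U_V_mult[OF l] u)
  also have "\<dots> = (\<Sum>j\<le>N. of_int (u j) * (fps_X ^ j * two_colour_gf l (w - int n + int (r * j)) (int n - int (r * j))))"
    unfolding sum_distrib_left
  proof (rule sum.cong)
    fix j
    have "hauptmodul l r ^ j = fps_X ^ j * euler_pow (int (r * j)) * fps_V l (euler_pow (- int (r * j)))"
      by (simp add: hauptmodul_def power_mult_distrib euler_pow_power fps_V_power[OF l, symmetric] mult.commute)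
    moreover have "euler_pow (w - int n + int (r * j)) = euler_pow (w - int n) * euler_pow (int (r * j))"
      by (rule euler_pow_add)
    moreover have "euler_pow (int n - int (r * j)) = euler_pow (int n) * euler_pow (- int (r * j))"
      using euler_pow_add[of "int n" "- int (r * j)"] by simp
    ultimately show "fps_V l (euler_pow (int n)) * euler_pow (w - int n) * (of_int (u j) * hauptmodul l r ^ j)
        = of_int (u j) * (fps_X ^ j * two_colour_gf l (w - int n + int (r * j)) (int n - int (r * j)))"
      by (simp only: two_colour_gf_split[OF l] fps_V_mult[OF l]) (simp only: mult_ac)
  qed simp
  finally show ?thesis .
qed

lemma eta_coeff_U:
  assumes l: "l \<in> {5, 7, 13}" "r * (l - 1) = 24" "s = (l ^ 2 - 1) div 24" and c: "c \<ge> 0"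
  shows "\<exists>(u::nat \<Rightarrow> int) N. (\<forall>x. eta_coeff l w c (int l * x)
        = (\<Sum>j\<le>N. of_int (u j) * eta_coeff l w (w - c + int (r * j)) x)) \<and>
     (\<forall>j. u j \<noteq> 0 \<longrightarrow> s * nat c \<le> l * j \<and> int l ^ ((l * j - s * nat c - 1) div (2 * s)) dvd u j)"
proof -
  have l0: "l > 0" using l by auto
  define n where "n = nat c"
  have n: "c = int n" using c by (simp add: n_def)
  obtain u N where u: "fps_U l (phi l ^ n) = (\<Sum>j\<le>N. of_int (u j) * hauptmodul l r ^ j)"
    "\<forall>j. u j \<noteq> 0 \<longrightarrow> s * n \<le> l * j \<and> int l ^ ((l * j - s * n - 1) div (2 * s)) dvd u j"
    using U_phi_expansion[OF l, of n] by blast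
  have cases: "l = 5 \<and> r = 6 \<and> s = 1 \<or> l = 7 \<and> r = 4 \<and> s = 2 \<or> l = 13 \<and> r = 2 \<and> s = 7"
    using l by auto
  hence rl: "int r * (int l - 1) = 24" and sl: "24 * int s = int l ^ 2 - 1" by auto
  note U = U_two_colour_gf[OF l0 u(1) l(3), of w]
  have "eta_coeff l w c (int l * x) = (\<Sum>j\<le>N. of_int (u j) * eta_coeff l w (w - c + int (r * j)) x)" for x
  proof (cases "24 dvd x - eta_order l w (w - c)")
    case True
    then obtain m where m: "x = eta_order l w (w - c) + 24 * m" by (auto simp: dvd_def algebra_simps)
    have lx: "int l * x = eta_order l w c + 24 * (int l * m - int s * c)"
      using eta_order_step[OF rl sl, of w c 0] unfolding m by (simp add: algebra_simps)
    have xj: "x = eta_order l w (w - c + int (r * j)) + 24 * (m - int j)" for j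
      using eta_order_shift[OF rl, of w c "int j"] unfolding m by (simp add: algebra_simps)
    have R: "eta_coeff l w (w - c + int (r * j)) x
        = (if m \<ge> int j then fps_nth (two_colour_gf l (w - c + int (r * j)) (c - int (r * j))) (nat (m - int j)) else 0)" for j
      by (subst xj[of j], subst eta_coeff_eq) simp
    show ?thesis
    proof (cases "m \<ge> 0")
      case False
      hence "int l * m < 0" using l0 by (simp add: mult_pos_neg)
      moreover have "int s * c \<ge> 0" using c by simp
      ultimately have "\<not> int l * m - int s * c \<ge> 0" by linarith
      hence "eta_coeff l w c (int l * x) = 0" unfolding lx eta_coeff_eq by (simp only: if_False)
      moreover have "eta_coeff l w (w - c + int (r * j)) x = 0" for j unfolding R using False by simp
      ultimately show ?thesis by (simp del: of_nat_mult)
    next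
      case True
      then obtain k where k: "m = int k" by (rule nonneg_int_cases)
      have "eta_coeff l w c (int l * x) = fps_nth (fps_U l (fps_X ^ (s * n) * two_colour_gf l (int n) (w - int n))) k"
      proof -
        have "(int l * m - int s * c \<ge> 0) = (\<not> l * k < s * n)"
          by (simp add: k n not_less of_nat_mult[symmetric] del: of_nat_mult)
        moreover have "nat (int l * m - int s * c) = l * k - s * n"
          by (simp add: k n of_nat_mult[symmetric] nat_minus_as_int[symmetric] nat_diff_distrib' del: of_nat_mult)
        ultimately show ?thesis unfolding lx eta_coeff_eq fps_U_nth fps_X_power_mult_nth
          by (cases "l * k < s * n") (simp_all only: n if_True if_False not_True_eq_False not_False_eq_True)
      qed
      also have "\<dots> = (\<Sum>j\<le>N. of_int (u j) * (if k < j then 0 else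
          fps_nth (two_colour_gf l (w - int n + int (r * j)) (int n - int (r * j))) (k - j)))"
        unfolding U fps_sum_nth fps_of_int[symmetric] fps_mult_left_const_nth fps_X_power_mult_nth ..
      also have "\<dots> = (\<Sum>j\<le>N. of_int (u j) * eta_coeff l w (w - c + int (r * j)) x)"
      proof (rule sum.cong)
        fix j
        have "nat (m - int j) = k - j" by (simp add: k)
        thus "of_int (u j) * (if k < j then 0 else
            fps_nth (two_colour_gf l (w - int n + int (r * j)) (int n - int (r * j))) (k - j))
          = of_int (u j) * eta_coeff l w (w - c + int (r * j)) x"
          unfolding R by (cases "k < j") (simp_all add: k n del: of_nat_mult)
      qed simp
      finally show ?thesis .
    qed
  next
    case False
    have "coprime (24::int) 5" "coprime (24::int) 7" "coprime (24::int) 13" by code_simp+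
    hence cop: "coprime (24::int) (int l)" using cases by auto
    have "\<not> 24 dvd int l * x - eta_order l w c"
    proof
      assume "24 dvd int l * x - eta_order l w c"
      moreover have "int l * x - eta_order l w c = int l * (x - eta_order l w (w - c)) - 24 * (int s * c)"
        using eta_order_step[OF rl sl, of w c 0] by (simp add: algebra_simps)
      ultimately have "24 dvd (int l * (x - eta_order l w (w - c)) - 24 * (int s * c)) + 24 * (int s * c)"
        by (metis dvd_add dvd_triv_left)
      hence "24 dvd int l * (x - eta_order l w (w - c))" by simp
      thus False using False cop by (simp add: coprime_dvd_mult_right_iff)
    qed
    moreover have "\<not> 24 dvd x - eta_order l w (w - c + int (r * j))" for j
    proof
      assume "24 dvd x - eta_order l w (w - c + int (r * j))"
      hence "24 dvd (x - eta_order l w (w - c + int (r * j))) + 24 * int j" by (intro dvd_add) auto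
      moreover have "(x - eta_order l w (w - c + int (r * j))) + 24 * int j = x - eta_order l w (w - c)"
        using eta_order_shift[OF rl, of w c "int j"] by simp
      ultimately show False using False by metis
    qed
    ultimately show ?thesis by (simp add: eta_coeff_def)
  qed
  thus ?thesis using u(2) unfolding n_def by blast
qed

text \<open>
  The bound for the exponent of \<open>l\<close> in the coefficient of an eta quotient of order \<open>n'/24\<close> in the image of one of
  order \<open>n/24\<close>, where \<open>l n' = n + 24 m\<close>. The exceptional case, where \<open>m = 8\<close> and the general bound is
  trivial, is the one that Jacobi's formula improves.
\<close>

definition val_bound :: "nat \<Rightarrow> nat \<Rightarrow> nat \<Rightarrow> int \<Rightarrow> int \<Rightarrow> nat" where
  "val_bound l s m n n' = (if l = 13 \<and> n = 16 \<and> n' = 16 then 1 else (m - 1) div (2 * s))"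

text \<open>
  The bound is that of \<open>U_phi_expansion\<close>. In the exceptional case \<open>n' = 16\<close> is the smallest order that occurs,
  so its coefficient can be read off as the first coefficient of the image, which is the coefficient of \<open>q^8\<close>
  of the original series.
\<close>

lemma eta_coeff_step:
  assumes l: "l \<in> {5, 7, 13}" "s = (l ^ 2 - 1) div 24" and c: "c \<ge> 0"
  shows "\<exists>(A::int set) u. finite A \<and> (\<forall>x. eta_coeff l w c (int l * x) = (\<Sum>c'\<in>A. of_int (u c') * eta_coeff l w c' x)) \<and>
     (\<forall>c'\<in>A. u c' \<noteq> 0 \<longrightarrow> (\<exists>m. int l * eta_order l w c' = eta_order l w c + 24 * int m \<and>
        int l ^ val_bound l s m (eta_order l w c) (eta_order l w c') dvd u c'))"
proof -
  have l0: "l > 0" using l by auto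
  define r where "r = 24 div (l - 1)"
  have rl': "r * (l - 1) = 24" using l by (auto simp: r_def)
  have cases: "l = 5 \<and> r = 6 \<and> s = 1 \<or> l = 7 \<and> r = 4 \<and> s = 2 \<or> l = 13 \<and> r = 2 \<and> s = 7"
    using l by (auto simp: r_def)
  hence rl: "int r * (int l - 1) = 24" and sl: "24 * int s = int l ^ 2 - 1" and r0: "r > 0" by auto
  obtain u N where u: "\<And>x. eta_coeff l w c (int l * x) = (\<Sum>j\<le>N. of_int (u j) * eta_coeff l w (w - c + int (r * j)) x)"
     "\<And>j. u j \<noteq> 0 \<Longrightarrow> s * nat c \<le> l * j \<and> int l ^ ((l * j - s * nat c - 1) div (2 * s)) dvd u j"
    using eta_coeff_U[OF l(1) rl' l(2) c, of w] by blast
  define f where "f = (\<lambda>j. w - c + int (r * j))"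
  define A where "A = f ` {..N}"
  define u' where "u' = (\<lambda>c'. u (the_inv_into {..N} f c'))"
  have inj: "inj_on f {..N}" using r0 by (auto simp: inj_on_def f_def)
  have u': "u' (f j) = u j" if "j \<le> N" for j
    using that by (simp add: u'_def the_inv_into_f_f[OF inj])
  have 1: "eta_coeff l w c (int l * x) = (\<Sum>c'\<in>A. of_int (u' c') * eta_coeff l w c' x)" for x
    unfolding A_def sum.reindex[OF inj] o_def u(1)
  proof (rule sum.cong)
    fix j assume "j \<in> {..N}"
    hence "u' (f j) = u j" by (simp add: u')
    thus "of_int (u j) * eta_coeff l w (w - c + int (r * j)) x = of_int (u' (f j)) * eta_coeff l w (f j) x"
      by (simp add: f_def)
  qed simp
  have 2: "\<exists>m. int l * eta_order l w c' = eta_order l w c + 24 * int m \<and>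
        int l ^ ((m - 1) div (2 * s)) dvd u' c'" if "c' \<in> A" "u' c' \<noteq> 0" for c'
  proof -
    obtain j where j: "j \<le> N" "c' = f j" using \<open>c' \<in> A\<close> by (auto simp: A_def)
    have uj: "u j \<noteq> 0" using that j by (simp add: u')
    have le: "s * nat c \<le> l * j" using u(2)[OF uj] by blast
    have "int (l * j - s * nat c) = int l * int j - int s * c"
      using le c by (simp add: of_nat_diff)
    moreover have "int l * eta_order l w c' = eta_order l w c + 24 * (int l * int j - int s * c)"
      using eta_order_step[OF rl sl, of w c "int j"] by (simp add: j f_def)
    ultimately show ?thesis using u(2)[OF uj] j by (intro exI[of _ "l * j - s * nat c"]) (simp add: u' c)
  qed
  have 3: "13 dvd u' c'" if l13: "l = 13" and n: "eta_order l w c = 16" and c': "c' \<in> A" "eta_order l w c' = 16" for c'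
  proof -
    have r2: "r = 2" using cases l13 by auto
    have zero: "of_int (u' b) * eta_coeff l w b 16 = 0" if b: "b \<in> A" "b \<noteq> c'" for b
    proof (cases "u' b = 0")
      case False
      then obtain m where m: "13 * eta_order l w b = 16 + 24 * int m" using 2[OF b(1)] l13 n by auto
      have "eta_order l w b - eta_order l w c' = 12 * (b - c')" by (simp add: eta_order_def l13 algebra_simps)
      hence "eta_order l w b \<noteq> 16" using b c' by auto
      moreover have "eta_order l w b \<ge> 16"
        using m by presburger
      ultimately show ?thesis by (simp add: eta_coeff_def)
    qed simp
    have "eta_coeff l w c (13 * 16) = (\<Sum>b\<in>A. of_int (u' b) * eta_coeff l w b 16)" using 1[of 16] l13 by simp
    also have "\<dots> = (\<Sum>b\<in>{c'}. of_int (u' b) * eta_coeff l w b 16)"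
      by (rule sum.mono_neutral_right) (use c' zero in \<open>auto simp: A_def\<close>)
    also have "\<dots> = of_int (u' c')"
      using c' l0 by (simp add: eta_coeff_def two_colour_gf_split fps_V_nth_0)
    finally have uc: "of_int (u' c') = fps_nth (two_colour_gf l c (w - c)) 8"
      using n by (simp add: eta_coeff_def)
    also have "\<dots> = fps_nth (euler_pow c) 8"
    proof -
      have "fps_nth (euler_pow c * fps_V 13 (euler_pow (w - c))) 8 = fps_nth (euler_pow c * 1) 8"
      proof (rule fps_mult_nth_cong)
        fix i :: nat assume "i \<le> 8"
        thus "fps_nth (fps_V 13 (euler_pow (w - c))) i = fps_nth 1 i" by (auto simp: fps_V_def dest: dvd_imp_le)
      qed simp
      thus ?thesis by (simp add: two_colour_gf_split l13)
    qed
    finally have "of_int (u' c') = fps_nth (euler_pow c) 8" .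
    moreover have "[c = 10] (mod 13)"
    proof -
      have "12 * c = 16 + 13 * w" using n by (simp add: eta_order_def l13)
      hence "c - 10 = 13 * (c - w - 2)" by (simp add: algebra_simps)
      thus ?thesis by (metis cong_iff_dvd_diff dvd_triv_left)
    qed
    ultimately obtain z where "(of_int (u' c') :: rat) = of_int (13 * z)"
      using euler_pow_nth_8_mod_13 by metis
    hence "u' c' = 13 * z" by (simp only: of_int_eq_iff)
    thus ?thesis by simp
  qed
  have "\<exists>m. int l * eta_order l w c' = eta_order l w c + 24 * int m \<and>
        int l ^ val_bound l s m (eta_order l w c) (eta_order l w c') dvd u' c'" if c': "c' \<in> A" "u' c' \<noteq> 0" for c'
    using 2[OF c'] 3[OF _ _ c'(1)] unfolding val_bound_def by auto
  moreover have "finite A" by (simp add: A_def)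
  ultimately show ?thesis using 1 by blast
qed

section \<open>Divisible combinations of eta quotients\<close>

text \<open>
  The exponent \<open>X\<close> counts half powers of \<open>l\<close>, since for \<open>l = 13\<close> one application of \<open>U\<close> gains half a
  power on average; hence the rounding in \<open>(X + 1) div 2\<close>.
\<close>

inductive eta_span :: "nat \<Rightarrow> int \<Rightarrow> (int \<Rightarrow> bool) \<Rightarrow> (int \<Rightarrow> nat) \<Rightarrow> (int \<Rightarrow> rat) \<Rightarrow> bool"
  for l w S X where
  zero: "eta_span l w S X (\<lambda>x. 0)"
| add: "eta_span l w S X h \<Longrightarrow> c \<ge> 0 \<Longrightarrow> S (eta_order l w c) \<Longrightarrow> int l ^ ((X (eta_order l w c) + 1) div 2) dvd b
    \<Longrightarrow> eta_span l w S X (\<lambda>x. h x + of_int b * eta_coeff l w c x)"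

lemma eta_span_add:
  assumes "eta_span l w S X g" "eta_span l w S X h"
  shows "eta_span l w S X (\<lambda>x. g x + h x)"
  using assms(2)
proof (induction rule: eta_span.induct)
  case (add h c b)
  from eta_span.add[OF add.IH add.hyps(2-4)] show ?case by (simp add: add.assoc)
qed (use assms(1) in simp)

lemma eta_span_single:
  "c \<ge> 0 \<Longrightarrow> S (eta_order l w c) \<Longrightarrow> int l ^ ((X (eta_order l w c) + 1) div 2) dvd b
    \<Longrightarrow> eta_span l w S X (\<lambda>x. of_int b * eta_coeff l w c x)"
  using eta_span.add[OF eta_span.zero] by simp

lemma eta_span_sum:
  assumes "finite A" "\<And>a. a \<in> A \<Longrightarrow> eta_span l w S X (f a)"
  shows "eta_span l w S X (\<lambda>x. \<Sum>a\<in>A. f a x)"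
  using assms
proof (induction A rule: finite_induct)
  case (insert a A)
  have "eta_span l w S X (\<lambda>x. f a x + (\<Sum>a\<in>A. f a x))"
    using insert by (intro eta_span_add) auto
  thus ?case using insert by simp
qed (simp add: eta_span.zero)

lemma eta_span_mono:
  assumes "eta_span l w S X h" "\<And>n. S n \<Longrightarrow> S' n \<and> X' n \<le> X n"
  shows "eta_span l w S' X' h"
  using assms(1)
proof (induction rule: eta_span.induct)
  case (add h c b)
  have "(X' (eta_order l w c) + 1) div 2 \<le> (X (eta_order l w c) + 1) div 2"
    using assms(2)[OF add.hyps(3)] by (intro div_le_mono) auto
  hence "int l ^ ((X' (eta_order l w c) + 1) div 2) dvd b"
    using add.hyps(4) by (meson dvd_trans le_imp_power_dvd)
  thus ?case using add assms(2) by (intro eta_span.add) auto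
qed (rule eta_span.zero)

text \<open>
  The lower bound on the new orders amounts to \<open>c \<ge> 0\<close> for the new eta quotients, as is required for the
  next application.
\<close>

lemma eta_span_step:
  assumes l: "l \<in> {5, 7, 13}" "s = (l ^ 2 - 1) div 24"
    and h: "eta_span l w S X h"
    and step: "\<And>n n' m. S n \<Longrightarrow> int l * n' = n + 24 * int m \<Longrightarrow>
        S' n' \<and> X' n' \<le> X n + 2 * val_bound l s m n n'"
    and low: "\<And>n. S' n \<Longrightarrow> n \<ge> - (int l * w)"
  shows "eta_span l w S' X' (\<lambda>x. h (int l * x))"
  using h
proof (induction rule: eta_span.induct)
  case (add h c b)
  have l1: "l > 1" using l by auto
  obtain A u where A: "finite A" "\<And>x. eta_coeff l w c (int l * x) = (\<Sum>c'\<in>A. of_int (u c') * eta_coeff l w c' x)"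
    and u: "\<And>c'. c' \<in> A \<Longrightarrow> u c' \<noteq> 0 \<Longrightarrow> \<exists>m. int l * eta_order l w c' = eta_order l w c + 24 * int m \<and>
        int l ^ val_bound l s m (eta_order l w c) (eta_order l w c') dvd u c'"
    using eta_coeff_step[OF l add.hyps(2), of w] by blast
  have "eta_span l w S' X' (\<lambda>x. \<Sum>c'\<in>A. of_int (b * u c') * eta_coeff l w c' x)"
  proof (rule eta_span_sum[OF A(1)])
    fix c' assume c': "c' \<in> A"
    show "eta_span l w S' X' (\<lambda>x. of_int (b * u c') * eta_coeff l w c' x)"
    proof (cases "u c' = 0")
      case False
      define n n' where "n = eta_order l w c" and "n' = eta_order l w c'"
      obtain m where m: "int l * n' = n + 24 * int m" "int l ^ val_bound l s m n n' dvd u c'"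
        using u[OF c' False] by (auto simp: n_def n'_def)
      have st: "S' n'" "X' n' \<le> X n + 2 * val_bound l s m n n'"
        using step[OF add.hyps(3)[folded n_def] m(1)] by auto
      have "n' \<ge> - (int l * w)" using low st by blast
      hence "(int l - 1) * c' \<ge> 0" by (simp add: n'_def eta_order_def)
      hence c'0: "c' \<ge> 0" using l1 by (simp add: zero_le_mult_iff)
      have "(X' n' + 1) div 2 \<le> (X n + 1) div 2 + val_bound l s m n n'"
        using st(2) by linarith
      hence "int l ^ ((X' n' + 1) div 2) dvd int l ^ ((X n + 1) div 2) * int l ^ val_bound l s m n n'"
        by (simp add: power_add[symmetric] le_imp_power_dvd)
      also have "\<dots> dvd b * u c'" using add.hyps(4) m(2) by (intro mult_dvd_mono) (auto simp: n_def)
      finally show ?thesis using c'0 st(1) by (intro eta_span_single) (auto simp: n'_def)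
    next
      case True
      thus ?thesis using eta_span.zero by simp
    qed
  qed
  moreover have "(\<lambda>x. \<Sum>c'\<in>A. of_int (b * u c') * eta_coeff l w c' x) = (\<lambda>x. of_int b * eta_coeff l w c (int l * x))"
    by (simp add: A(2) sum_distrib_left mult.assoc)
  ultimately show ?case using eta_span_add[OF add.IH] by simp
qed (rule eta_span.zero)

lemma eta_coeff_int: "l > 0 \<Longrightarrow> \<exists>z::int. eta_coeff l w c x = of_int z"
proof -
  assume l: "l > 0"
  have "fps_Ints (two_colour_gf l c (w - c))"
    unfolding two_colour_gf_split[OF l] by (intro fps_Ints_mult fps_Ints_euler_pow fps_Ints_V)
  thus ?thesis
    by (auto simp: eta_coeff_def fps_Ints_def intro: exI[of _ 0] elim!: Ints_cases dest: spec[of _ "nat ((x - eta_order l w c) div 24)"])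
qed

lemma eta_span_divisible:
  assumes "eta_span l w S X h" "l > 0" "\<And>n. S n \<Longrightarrow> Z \<le> X n"
  shows "\<exists>z::int. h x = of_int (int l ^ ((Z + 1) div 2) * z)"
  using assms(1)
proof (induction rule: eta_span.induct)
  case zero
  show ?case by (intro exI[of _ 0]) simp
next
  case (add h c b)
  obtain y where y: "h x = of_int (int l ^ ((Z + 1) div 2) * y)" using add.IH by blast
  obtain v where v: "eta_coeff l w c x = of_int v" using eta_coeff_int[OF assms(2)] by blast
  have "(Z + 1) div 2 \<le> (X (eta_order l w c) + 1) div 2"
    using assms(3)[OF add.hyps(3)] by (intro div_le_mono) auto
  hence "int l ^ ((Z + 1) div 2) dvd b"
    using add.hyps(4) by (meson dvd_trans le_imp_power_dvd)
  then obtain k where "b = int l ^ ((Z + 1) div 2) * k" by (auto simp: dvd_def)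
  hence "h x + of_int b * eta_coeff l w c x = of_int (int l ^ ((Z + 1) div 2) * (y + k * v))"
    by (simp add: y v algebra_simps)
  thus ?case by blast
qed

section \<open>The first steps\<close>

lemma val_bound_ge:
  assumes "l \<in> {5, 7, 13}" "s = (l ^ 2 - 1) div 24" "int l * n' = n + 24 * int m"
  shows "(m - 1) div (2 * s) \<le> val_bound l s m n n'"
  using assms by (auto simp: val_bound_def)

text \<open>
  Eta quotients of order up to the cutoff need not carry any power of \<open>l\<close>. As 5 is the smallest of the three
  primes, division by 5 bounds the effect of \<open>U\<close> on it for all of them.
\<close>

primrec cutoff :: "int \<Rightarrow> int \<Rightarrow> nat \<Rightarrow> int" where
  "cutoff D N0 0 = N0"
| "cutoff D N0 (Suc t) = cutoff D N0 t div 5 + D"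

lemma cutoff_nonneg: "N0 \<ge> 0 \<Longrightarrow> D \<ge> 0 \<Longrightarrow> cutoff D N0 t \<ge> 0"
  by (induction t) auto

lemma cutoff_le:
  assumes "N0 \<ge> 0" "D \<ge> 5"
  shows "cutoff D N0 t \<le> N0 div 5 ^ t + 2 * D"
proof (induction t)
  case 0
  show ?case using assms by simp
next
  case (Suc t)
  have "cutoff D N0 (Suc t) \<le> (N0 div 5 ^ t + 2 * D) div 5 + D"
    using Suc by (simp add: zdiv_mono1)
  also have "(N0 div 5 ^ t + 2 * D) div 5 \<le> N0 div 5 ^ t div 5 + D" using assms by linarith
  also have "N0 div 5 ^ t div 5 = N0 div 5 ^ Suc t" by (simp add: zdiv_zmult2_eq[symmetric] mult.commute)
  finally show ?case by simp
qed

text \<open>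
  Raising the new order by \<open>D = 48 s\<close> takes a value of \<open>m\<close> larger by \<open>2 s l\<close>, thus at least one more
  factor \<open>l\<close>. So beyond the cutoff the number of factors grows at least like the excess of the order over it,
  divided by \<open>D\<close>.
\<close>

lemma first_steps_bound:
  fixes n n' N :: int and m s l :: nat
  assumes l: "l \<ge> 5" and s: "s > 0" and N: "N \<ge> 0" and m: "int l * n' = n + 24 * int m"
    and D: "D = 48 * int s"
  shows "nat ((n' - (N div 5 + D)) div D) \<le> nat ((n - N) div D) + (m - 1) div (2 * s)"
proof -
  define N' where "N' = N div 5 + D"
  define a where "a = (n' - N') div D"
  define q where "q = (n - N) div D"
  define v where "v = (m - 1) div (2 * s)"
  have D0: "D > 0" using s D by simp
  have "a \<le> int (nat q + v)" if a0: "a \<ge> 0"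
  proof (rule ccontr)
    assume "\<not> a \<le> int (nat q + v)"
    hence "D * (int (nat q) + int v + 1) \<le> D * a" using D0 by (intro mult_left_mono) auto
    hence 1: "D * int (nat q) + D * int v + D \<le> D * a" by (simp add: algebra_simps)
    have "D * a + (n' - N') mod D = n' - N'" by (simp add: a_def)
    hence 2: "D * a \<le> n' - N'" using D0 by (smt (verit) pos_mod_sign)
    have "(m - 1) mod (2 * s) < 2 * s" using s by simp
    moreover have "2 * s * v + (m - 1) mod (2 * s) = m - 1" by (simp add: v_def)
    ultimately have "m - 1 < 2 * s * v + 2 * s" by linarith
    hence "int m \<le> int (2 * s * v + 2 * s)" by linarith
    hence 3: "24 * int m \<le> D * int v + D" by (simp add: D algebra_simps)
    have "n < N + D * int (nat q) + D"
    proof (cases "q \<ge> 0")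
      case True
      have "D * q + (n - N) mod D = n - N" by (simp add: q_def)
      moreover have "(n - N) mod D < D" using D0 by simp
      ultimately show ?thesis using True by simp
    next
      case False
      hence "n - N < 0" using D0 by (simp add: q_def pos_imp_zdiv_nonneg_iff not_le)
      thus ?thesis using False D0 by simp
    qed
    hence 4: "int l * n' < N + n' - N' + D" using 1 2 3 m by linarith
    have N'0: "N' \<ge> 0" using N D0 by (simp add: N'_def)
    have "n' \<ge> N'" using a0 D0 2 by (smt (verit) mult_nonneg_nonneg)
    hence "(int l - 5) * n' \<ge> 0" using l N'0 by simp
    hence "5 * n' < N + n' - N' + D" using 4 by (simp add: algebra_simps)
    hence "5 * N' < N + D" using \<open>n' \<ge> N'\<close> by linarith
    moreover have "5 * (N div 5) \<ge> N - 4" by presburger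
    hence "5 * N' \<ge> N - 4 + 5 * D" unfolding N'_def by (simp add: algebra_simps)
    ultimately show False using D s by linarith
  qed
  thus ?thesis unfolding a_def[symmetric] N'_def[symmetric] q_def[symmetric] v_def[symmetric] by linarith
qed

text \<open>
  Modulo 24 the prime \<open>l\<close> is its own inverse.
\<close>

lemma order_class_step:
  assumes l: "l \<in> {5, 7, 13 :: nat}" and n': "int l * n' = n + 24 * int m" and n: "24 dvd n - k"
  shows "24 dvd n' - int l * k"
proof -
  have "24 dvd int l ^ 2 - 1" using l by auto
  hence "24 dvd (int l ^ 2 - 1) * n'" by simp
  moreover have "24 dvd int l * (n - k)" using n by simp
  ultimately have "24 dvd int l * (n - k) + 24 * (int l * int m) - (int l ^ 2 - 1) * n'"
    by (intro dvd_diff dvd_add) auto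
  also have "int l * (n - k) + 24 * (int l * int m) - (int l ^ 2 - 1) * n' = int l * (n + 24 * int m - int l * n') + n' - int l * k"
    by (simp add: algebra_simps power2_eq_square)
  finally show ?thesis using n' by simp
qed

text \<open>
  Orders cannot fall below \<open>n0 / l^t\<close>, which is negligible once \<open>l^t\<close> exceeds \<open>|n0|\<close>, and by then the
  cutoff is bounded as well.
\<close>

lemma first_steps:
  assumes l: "l \<in> {5, 7, 13}" "s = (l ^ 2 - 1) div 24" and D: "D = 48 * int s"
    and c: "c \<ge> 0" "eta_order l w c = n0" and w: "w \<ge> \<bar>n0\<bar>"
  shows "eta_span l w (\<lambda>n. n * int l ^ t \<ge> n0 \<and> 24 dvd n - int l ^ t * n0)
     (\<lambda>n. 2 * nat ((n - cutoff D \<bar>n0\<bar> t) div D)) (\<lambda>x. eta_coeff l w c (int l ^ t * x))"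
proof (induction t)
  case 0
  have D0: "D > 0" using D l by auto
  have "(n0 - \<bar>n0\<bar>) div D \<le> 0" using D0 by (cases "n0 \<ge> 0") (auto simp: div_nonpos_pos_le0)
  thus ?case using eta_span_single[of c _ l w _ 1] c by simp
next
  case (Suc t)
  have D0: "D > 0" and s: "s > 0" and l5: "l \<ge> 5" using D l by auto
  have step: "(n' * int l ^ Suc t \<ge> n0 \<and> 24 dvd n' - int l ^ Suc t * n0) \<and>
      2 * nat ((n' - cutoff D \<bar>n0\<bar> (Suc t)) div D) \<le> 2 * nat ((n - cutoff D \<bar>n0\<bar> t) div D) + 2 * val_bound l s m n n'"
    if S: "n * int l ^ t \<ge> n0 \<and> 24 dvd n - int l ^ t * n0" and n': "int l * n' = n + 24 * int m" for n n' m
  proof -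
    have "n' * int l ^ Suc t = (n + 24 * int m) * int l ^ t" unfolding n'[symmetric] by simp
    also have "\<dots> \<ge> n * int l ^ t" by (intro mult_right_mono) auto
    finally have 1: "n' * int l ^ Suc t \<ge> n0" using S by linarith
    have 2: "24 dvd n' - int l ^ Suc t * n0"
      using order_class_step[OF l(1) n', of "int l ^ t * n0"] S by (simp add: mult.assoc)
    have "nat ((n' - cutoff D \<bar>n0\<bar> (Suc t)) div D) \<le> nat ((n - cutoff D \<bar>n0\<bar> t) div D) + (m - 1) div (2 * s)"
      using first_steps_bound[OF l5 s _ n' D] cutoff_nonneg[of "\<bar>n0\<bar>" D t] D0 by simp
    also have "\<dots> \<le> nat ((n - cutoff D \<bar>n0\<bar> t) div D) + val_bound l s m n n'"
      using val_bound_ge[OF l n'] by simp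
    finally show ?thesis using 1 2 by simp
  qed
  have low: "n \<ge> - (int l * w)" if "n * int l ^ Suc t \<ge> n0 \<and> 24 dvd n - int l ^ Suc t * n0" for n
  proof -
    have lw: "int l * w \<ge> w" using l5 w by (simp add: mult_le_cancel_right1)
    show ?thesis
    proof (cases "n \<ge> 0")
      case True
      thus ?thesis using lw w by linarith
    next
      case False
      have "int l ^ Suc t \<ge> 1" using l5 by (intro one_le_power) auto
      hence "n * int l ^ Suc t \<le> n * 1" using False by (intro mult_left_mono_neg) auto
      thus ?thesis using that lw w by linarith
    qed
  qed
  from eta_span_step[OF l Suc step low]
  show ?case by (simp add: mult_ac)
qed

section \<open>The steady state\<close>

text \<open>
  \<open>W\<close> is a potential function on orders, and \<open>g t\<close> is what the application number \<open>t\<close> of \<open>U\<close> gains on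
  top of the change of potential, in half powers of \<open>l\<close>.
\<close>

definition steady :: "nat \<Rightarrow> nat \<Rightarrow> int \<Rightarrow> (int \<Rightarrow> nat) \<Rightarrow> (nat \<Rightarrow> nat) \<Rightarrow> bool" where
  "steady l s k W g \<longleftrightarrow> (\<forall>t n n' m. n \<ge> 1 \<and> 24 dvd n - int l ^ t * k \<and> int l * n' = n + 24 * int m
      \<longrightarrow> W n' + g t \<le> W n + 2 * val_bound l s m n n')"

text \<open>
  The potential at the beginning may exceed what the coefficients carry by \<open>C\<close> half powers, and may fall short
  of it by \<open>B\<close>.
\<close>

lemma steady_steps:
  assumes l: "l \<in> {5, 7, 13}" "s = (l ^ 2 - 1) div 24" and st: "steady l s k W g" and w: "w \<ge> 0"
    and h: "eta_span l w (\<lambda>n. n \<ge> 1 \<and> 24 dvd n - k) X h" and X: "\<And>n. n \<ge> 1 \<Longrightarrow> 24 dvd n - k \<Longrightarrow> W n + B - C \<le> X n"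
  shows "eta_span l w (\<lambda>n. n \<ge> 1 \<and> 24 dvd n - int l ^ t * k)
     (\<lambda>n. W n + (\<Sum>i<t. g i) + B - C) (\<lambda>x. h (int l ^ t * x))"
proof (induction t)
  case 0
  show ?case using eta_span_mono[OF h, of "\<lambda>n. n \<ge> 1 \<and> 24 dvd n - k" "\<lambda>n. W n + B - C"] X by simp
next
  case (Suc t)
  have step: "(n' \<ge> 1 \<and> 24 dvd n' - int l ^ Suc t * k) \<and>
      W n' + (\<Sum>i<Suc t. g i) + B - C \<le> W n + (\<Sum>i<t. g i) + B - C + 2 * val_bound l s m n n'"
    if S: "n \<ge> 1 \<and> 24 dvd n - int l ^ t * k" and n': "int l * n' = n + 24 * int m" for n n' m
  proof -
    have "int l * n' > 0" using S n' by linarith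
    hence "n' \<ge> 1" by (simp add: zero_less_mult_iff)
    moreover have "24 dvd n' - int l ^ Suc t * k"
      using order_class_step[OF l(1) n', of "int l ^ t * k"] S by (simp add: mult.assoc)
    moreover have "W n' + g t \<le> W n + 2 * val_bound l s m n n'"
      using st S n' unfolding steady_def by blast
    ultimately show ?thesis by simp
  qed
  have low: "n \<ge> - (int l * w)" if "n \<ge> 1 \<and> 24 dvd n - int l ^ Suc t * k" for n
  proof -
    have "int l * w \<ge> 0" using w by simp
    thus ?thesis using that by linarith
  qed
  from eta_span_step[OF l Suc step low]
  show ?case by (simp add: mult_ac)
qed

definition rep24 :: "int \<Rightarrow> int" where "rep24 n = (n - 1) mod 24 + 1"

text \<open>
  The bound \<open>(m - 1) div (2 s)\<close> when both orders are the smallest positive ones of their classes modulo 24.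
\<close>

definition gain :: "nat \<Rightarrow> nat \<Rightarrow> int \<Rightarrow> nat" where
  "gain l s n = nat ((int l * rep24 (int l * n) - rep24 n) div 24 - 1) div (2 * s)"

text \<open>
  If the order is the number \<open>i\<close> in the list of positive orders of its class, starting at 0, this is
  \<open>i / (2 s)\<close> rounded up, counted in half powers.
\<close>

definition weight :: "nat \<Rightarrow> int \<Rightarrow> nat" where
  "weight s n = 2 * ((nat ((n - 1) div 24) + 2 * s - 1) div (2 * s))"

lemma rep24_cong: "24 dvd n - m \<Longrightarrow> rep24 n = rep24 m"
  unfolding rep24_def by (metis (no_types, opaque_lifting) diff_diff_eq2 add_diff_cancel_right' cancel_comm_monoid_add_class.diff_cancel diff_add_cancel dvd_minus_iff minus_diff_eq mod_eq_dvd_iff)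

lemma rep24_bounds: "1 \<le> rep24 n" "rep24 n \<le> 24"
  unfolding rep24_def by presburger+

lemma gain_cong:
  assumes "24 dvd n - m"
  shows "gain l s n = gain l s m"
proof -
  have "24 dvd int l * n - int l * m" using assms by (simp add: right_diff_distrib[symmetric])
  thus ?thesis using assms by (simp add: gain_def rep24_cong[of n m] rep24_cong[of "int l * n" "int l * m"])
qed

text \<open>
  Here \<open>e = 2 s\<close>, the orders have the numbers \<open>i\<close> and \<open>i'\<close> in their classes, and \<open>u\<close> is the value of \<open>m\<close>
  for \<open>i = i' = 0\<close>. Raising \<open>i'\<close> by one raises \<open>m\<close> by \<open>l\<close>, more than \<open>e\<close>, which outweighs the losses by
  rounding.
\<close>

lemma ceiling_inequality:
  fixes e l u m i i' :: nat
  assumes e: "e > 0" "e + 3 \<le> l" "u \<le> e + e" and m: "m + i = u + l * i'"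
  shows "(i' + (e - 1)) div e + (u - 1) div e \<le> (i + (e - 1)) div e + (m - 1) div e"
proof (cases "i' = 0")
  case True
  show ?thesis
  proof (cases "u \<le> e")
    case False
    hence "(u - 1) div e = 1" using e by (intro div_nat_eqI) auto
    moreover have "1 \<le> (i + (e - 1)) div e + (m - 1) div e"
    proof (cases "i = 0")
      case True
      hence "m - 1 \<ge> e" using m False \<open>i' = 0\<close> by simp
      hence "(m - 1) div e \<ge> 1" using e by (simp add: Suc_le_eq div_greater_zero_iff)
      thus ?thesis by simp
    next
      case False
      hence "i + (e - 1) \<ge> e" using e by simp
      hence "(i + (e - 1)) div e \<ge> 1" using e by (simp add: Suc_le_eq div_greater_zero_iff)
      thus ?thesis by simp
    qed
    ultimately show ?thesis using True e by simp
  qed (use True e in simp)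
next
  case False
  define A B V g where "A = (i' + (e - 1)) div e" and "B = (i + (e - 1)) div e"
    and "V = (m - 1) div e" and "g = (u - 1) div e"
  have A: "e * A \<le> i' + (e - 1)" by (simp add: A_def)
  have B: "i < e * B + 1"
  proof -
    have "i + (e - 1) < e * B + e" unfolding B_def using dividend_less_times_div[OF e(1), of "i + (e - 1)"] by linarith
    thus ?thesis using e by linarith
  qed
  have V: "m < e * V + e + 1"
  proof -
    have "m - 1 < e * V + e" unfolding V_def using dividend_less_times_div[OF e(1), of "m - 1"] by linarith
    thus ?thesis by linarith
  qed
  have g: "e * g \<le> u" unfolding g_def by (meson diff_le_self le_trans times_div_less_eq_dividend)
  have "A + g \<le> B + V"
  proof (rule ccontr)
    assume "\<not> A + g \<le> B + V"
    hence "e * (B + V + 1) \<le> e * (A + g)" by (intro mult_left_mono) auto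
    hence "e * B + e * V + e \<le> e * A + e * g" by (simp add: algebra_simps)
    hence "m + i \<le> i' + (e - 1) + u" using A B V g e by linarith
    hence 1: "l * i' \<le> i' + (e - 1)" using m by simp
    have "(e + 3) * i' \<le> l * i'" using e by (intro mult_right_mono) auto
    hence "e * i' + 2 * i' \<le> e - 1" using 1 by (simp add: algebra_simps)
    moreover have "e * 1 \<le> e * i'" using False by (intro mult_left_mono) auto
    ultimately show False using e by linarith
  qed
  thus ?thesis by (simp add: A_def B_def V_def g_def)
qed

lemma steady_5_7_aux:
  fixes n n' :: int and m :: nat
  assumes ls: "l = 5 \<and> s = 1 \<or> l = 7 \<and> s = (2::nat)" and n: "n \<ge> 1" and n': "int l * n' = n + 24 * int m"
  shows "weight s n' + 2 * gain l s n \<le> weight s n + 2 * ((m - 1) div (2 * s))"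
proof -
  have l: "l \<in> {5, 7, 13}" using ls by auto
  define i where "i = nat ((n - 1) div 24)"
  define i' where "i' = nat ((n' - 1) div 24)"
  have "int l * n' > 0" using n n' by linarith
  hence n'1: "n' \<ge> 1" by (simp add: zero_less_mult_iff)
  have ni: "n = rep24 n + 24 * int i" using n unfolding rep24_def i_def by (simp add: pos_imp_zdiv_nonneg_iff)
  have ni': "n' = rep24 n' + 24 * int i'" using n'1 unfolding rep24_def i'_def by (simp add: pos_imp_zdiv_nonneg_iff)
  have r: "rep24 (int l * n) = rep24 n'"
    using order_class_step[OF l n', of n] by (intro rep24_cong[symmetric]) simp
  define \<mu> where "\<mu> = int m - int l * int i' + int i"
  have mu: "int l * rep24 n' = rep24 n + 24 * \<mu>"
  proof -
    have "int l * (rep24 n' + 24 * int i') = (rep24 n + 24 * int i) + 24 * int m"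
      using n' by (simp only: ni[symmetric] ni'[symmetric])
    thus ?thesis by (simp add: \<mu>_def algebra_simps)
  qed
  have g: "gain l s n = nat (\<mu> - 1) div (2 * s)"
    unfolding gain_def r mu by simp
  have b: "1 \<le> rep24 n" "rep24 n \<le> 24" "1 \<le> rep24 n'" "rep24 n' \<le> 24" by (rule rep24_bounds)+
  have m: "int m = \<mu> + int l * int i' - int i" by (simp add: \<mu>_def)
  have W: "weight s n = 2 * ((i + 2 * s - 1) div (2 * s))" "weight s n' = 2 * ((i' + 2 * s - 1) div (2 * s))"
    by (simp_all add: weight_def i_def i'_def)
  show ?thesis
  proof (cases "l = 5")
    case True
    hence s: "s = 1" using ls by auto
    have "\<mu> \<ge> 0" "\<mu> \<le> 4" using mu b True by auto
    then obtain u where u: "\<mu> = int u" "u \<le> 4" by (metis nonneg_int_cases of_nat_le_iff of_nat_numeral)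
    have m': "m + i = u + 5 * i'" using m u True by simp
    have ineq: "(i' + 1) div 2 + (u - 1) div 2 \<le> (i + 1) div 2 + (m - 1) div 2"
      using ceiling_inequality[of 2 5 u m i i'] m' u(2) by simp
    have "nat (\<mu> - 1) = u - 1" by (simp add: u)
    thus ?thesis using ineq unfolding W g unfolding s by simp
  next
    case False
    hence s: "s = 2" "l = 7" using ls by auto
    have "\<mu> \<ge> 0" "\<mu> \<le> 6" using mu b s by auto
    then obtain u where u: "\<mu> = int u" "u \<le> 6" by (metis nonneg_int_cases of_nat_le_iff of_nat_numeral)
    have m': "m + i = u + 7 * i'" using m u s by simp
    have ineq: "(i' + 3) div 4 + (u - 1) div 4 \<le> (i + 3) div 4 + (m - 1) div 4"
      using ceiling_inequality[of 4 7 u m i i'] m' u(2) by simp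
    have "nat (\<mu> - 1) = u - 1" by (simp add: u)
    thus ?thesis using ineq unfolding W g unfolding s by (simp add: add.commute)
  qed
qed

lemma steady_5_7:
  assumes ls: "l = 5 \<and> s = 1 \<or> l = 7 \<and> s = (2::nat)"
  shows "steady l s k (weight s) (\<lambda>t. 2 * gain l s (int l ^ t * k))"
  unfolding steady_def
proof (intro allI impI, elim conjE)
  fix t n n' m
  assume n: "n \<ge> 1" "24 dvd n - int l ^ t * k" "int l * n' = n + 24 * int m"
  have "val_bound l s m n n' = (m - 1) div (2 * s)" using ls by (auto simp: val_bound_def)
  moreover have "gain l s (int l ^ t * k) = gain l s n" using gain_cong[OF n(2)] by simp
  ultimately show "weight s n' + 2 * gain l s (int l ^ t * k) \<le> weight s n + 2 * val_bound l s m n n'"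
    using steady_5_7_aux[OF ls n(1,3)] by simp
qed

text \<open>
  The order 16 has potential 0. Every larger order of its class has potential at least 1, so that a step down to
  order 16 pays for itself.
\<close>

definition weight_13 :: "int \<Rightarrow> nat" where
  "weight_13 n = (if n \<le> 24 then 0 else nat ((n - 1) div 24) div 7 + 1)"

text \<open>
  The class of 16 modulo 24 is fixed by multiplication with 13. From order 16 to itself the additional factor
  13 gives two half powers. A step down to order 16 lowers the potential. A step to a larger order either starts
  high enough for the potential to drop or has a large \<open>m\<close>: from order 16 it takes \<open>m \<ge> 21\<close>.
\<close>

lemma steady_13:
  assumes "24 dvd k - 16"
  shows "steady 13 7 k weight_13 (\<lambda>t. 1)"
  unfolding steady_def
proof (intro allI impI, elim conjE)
  fix t n n' m
  assume n: "n \<ge> 1" "24 dvd n - int 13 ^ t * k" "int 13 * n' = n + 24 * int m"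
  have cls: "24 dvd int 13 ^ t * k - 16"
  proof (induction t)
    case (Suc t)
    have "24 dvd 13 * (int 13 ^ t * k - 16) + 24 * 8" using dvd_add[OF dvd_mult[OF Suc] dvd_triv_left] .
    moreover have "13 * (int 13 ^ t * k - 16) + 24 * 8 = int 13 ^ Suc t * k - 16" by simp
    ultimately show ?case by (simp only:)
  qed (use assms in simp)
  have "24 dvd (n - int 13 ^ t * k) + (int 13 ^ t * k - 16)" using n(2) cls by (rule dvd_add)
  hence n16: "24 dvd n - 16" by simp
  then obtain i where i: "n = 16 + 24 * int i"
  proof -
    obtain q where q: "n - 16 = 24 * q" using n16 by (auto simp: dvd_def)
    hence "q \<ge> 0" using n(1) by linarith
    thus ?thesis using that[of "nat q"] q by simp
  qed
  have "24 dvd n' - int 13 * 16" using order_class_step[of 13, OF _ n(3) n16] by simp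
  hence "24 dvd (n' - int 13 * 16) + 24 * 8" by (intro dvd_add) auto
  hence "24 dvd n' - 16" by simp
  then obtain i' where i': "n' = 16 + 24 * int i'"
  proof -
    obtain q where q: "n' - 16 = 24 * q" using \<open>24 dvd n' - 16\<close> by (auto simp: dvd_def)
    hence "q \<ge> 0" using n(1,3) by simp
    thus ?thesis using that[of "nat q"] q by simp
  qed
  have m: "m + i = 8 + 13 * i'" using n(3) i i' by simp
  have W: "weight_13 (16 + 24 * int j) = (if j = 0 then 0 else j div 7 + 1)" for j
  proof -
    have "(16 + 24 * int j - 1) div 24 = int j" by linarith
    thus ?thesis by (auto simp: weight_13_def)
  qed
  have v: "val_bound 13 7 m n n' = (if i = 0 \<and> i' = 0 then 1 else (m - 1) div 14)"
    by (simp add: val_bound_def i i')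
  show "weight_13 n' + 1 \<le> weight_13 n + 2 * val_bound 13 7 m n n'"
  proof (cases "i' = 0")
    case True
    thus ?thesis unfolding v unfolding i i' W by simp
  next
    case False
    have "i' div 7 + 1 + 1 \<le> (if i = 0 then 0 else i div 7 + 1) + 2 * ((m - 1) div 14)"
    proof (cases "i = 0")
      case True
      hence "m = 8 + 13 * i'" using m by simp
      define v where "v = (m - 1) div 14"
      define u where "u = i' div 7"
      have v: "14 * v + 14 > m - 1" unfolding v_def by linarith
      have u: "7 * u \<le> i'" unfolding u_def by simp
      have "u + 2 \<le> 2 * v"
      proof (rule ccontr)
        assume *: "\<not> u + 2 \<le> 2 * v"
        hence "i' \<le> 1" using u v \<open>m = 8 + 13 * i'\<close> by linarith
        hence "i' = 1" using \<open>i' \<noteq> 0\<close> by simp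
        moreover have "u = 0" using u \<open>i' \<le> 1\<close> by linarith
        ultimately show False using * v \<open>m = 8 + 13 * i'\<close> by simp
      qed
      thus ?thesis using True by (simp add: u_def v_def)
    next
      case False
      define q where "q = i div 7"
      define t where "t = i mod 7"
      have it: "i = 7 * q + t" "t \<le> 6" by (auto simp: q_def t_def)
      have "i' div 7 + 1 \<le> q + 2 * ((m - 1) div 14)"
      proof -
        define v where "v = (m - 1) div 14"
        define u where "u = i' div 7"
        have v: "14 * v + 14 > m - 1" unfolding v_def by linarith
        have u: "7 * u \<le> i'" unfolding u_def by simp
        have "u + 1 \<le> q + 2 * v"
        proof (rule ccontr)
          assume *: "\<not> u + 1 \<le> q + 2 * v"
          hence "i' \<le> 1" using u v m it by linarith
          hence "i' = 1" using \<open>i' \<noteq> 0\<close> by simp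
          hence "u = 0" using u by linarith
          hence "q = 0" "v = 0" using * by auto
          thus False using v m it \<open>i' = 1\<close> by simp
        qed
        thus ?thesis by (simp add: u_def v_def)
      qed
      thus ?thesis using False by (simp add: q_def)
    qed
    thus ?thesis using False unfolding v unfolding i i' W by simp
  qed
qed

section \<open>The average gain\<close>

lemma gain_le_1:
  assumes ls: "l = 5 \<and> s = 1 \<or> l = 7 \<and> s = (2::nat)"
  shows "gain l s n \<le> 1"
proof -
  have b: "1 \<le> rep24 n" "rep24 (int l * n) \<le> 24" by (rule rep24_bounds)+
  have "(int l * rep24 (int l * n) - rep24 n) div 24 \<le> (int l * 24 - 1) div 24"
  proof (rule zdiv_mono1)
    have "int l * rep24 (int l * n) \<le> int l * 24" using b by (intro mult_left_mono) auto
    thus "int l * rep24 (int l * n) - rep24 n \<le> int l * 24 - 1" using b by linarith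
  qed simp
  also have "(int l * 24 - 1) div 24 = int l - 1" using ls by (elim disjE conjE) simp_all
  finally have "nat ((int l * rep24 (int l * n) - rep24 n) div 24 - 1) \<le> l - 2" by linarith
  hence "gain l s n \<le> (l - 2) div (2 * s)" unfolding gain_def by (rule div_le_mono)
  also have "\<dots> = 1" using ls by (elim disjE conjE) simp_all
  finally show ?thesis .
qed

text \<open>
  For the residue 0 the larger of the two values that belong to the two signs of \<open>c + l d\<close>.
\<close>

definition alpha_bound :: "nat \<Rightarrow> int \<Rightarrow> nat" where
  "alpha_bound l t = (if t = 0 then 1 else alpha_pos l t)"

lemma alpha_le_alpha_bound: "alpha l k \<le> alpha_bound l (k mod 24)"
proof (cases "k mod 24 = 0")
  case True
  hence "residue24 k = 24" by (simp add: residue24_def dvd_eq_mod_eq_0)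
  thus ?thesis using True by (simp add: alpha_def alpha_bound_def alpha_pos_def)
next
  case False
  hence r: "residue24 k = k mod 24" by (simp add: residue24_def dvd_eq_mod_eq_0)
  have "k mod 24 < 24" by simp
  hence "k mod 24 \<noteq> 24" by linarith
  hence "alpha l k = alpha_pos l (k mod 24)" unfolding alpha_def r by (simp only: simp_thms if_False)
  thus ?thesis using False by (simp add: alpha_bound_def)
qed

text \<open>
  This is where the table of values of \<open>\<alpha>\<close> enters. The order is \<open>-k/24\<close>, hence the signs.
\<close>

lemma gain_table:
  "\<forall>t\<in>set [0..23]. alpha_bound 5 t \<le> gain 5 1 (- t) + gain 5 1 (5 * - t)"
  "\<forall>t\<in>set [0..23]. alpha_bound 7 t \<le> gain 7 2 (- t) + gain 7 2 (7 * - t)"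
  by code_simp+

text \<open>
  The classes of the orders modulo 24 alternate between \<open>-k\<close> and \<open>-l k\<close>.
\<close>

lemma gain_pair:
  assumes ls: "l = 5 \<and> s = 1 \<or> l = 7 \<and> s = (2::nat)" and a: "alpha l k > 0"
  shows "alpha l k \<le> gain l s (int l ^ t * - k) + gain l s (int l ^ Suc t * - k)"
proof -
  define u where "u = k mod 24"
  have u: "u \<in> set [0..23]" by (simp add: u_def)
  have ku: "24 dvd - k - (- u)" by (simp add: u_def mod_eq_dvd_iff[symmetric] minus_mod_eq_mult_div)
  have "alpha l k \<le> alpha_bound l u"
    unfolding u_def by (rule alpha_le_alpha_bound)
  also have "\<dots> \<le> gain l s (- u) + gain l s (int l * - u)"
    using gain_table u ls by auto
  also have "gain l s (- u) = gain l s (- k)" using gain_cong[OF ku] by simp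
  also have "gain l s (int l * - u) = gain l s (int l * - k)"
  proof (rule gain_cong)
    have "24 dvd - (int l * (- k - (- u)))" using ku by (metis dvd_minus_iff dvd_mult)
    thus "24 dvd int l * - u - int l * - k" by (simp add: algebra_simps)
  qed
  finally have 0: "alpha l k \<le> gain l s (- k) + gain l s (int l * - k)" .
  have per: "gain l s (int l ^ Suc (Suc i) * - k) = gain l s (int l ^ i * - k)" for i
  proof (rule gain_cong)
    have "24 dvd int l ^ 2 - 1" using ls by auto
    hence "24 dvd (int l ^ 2 - 1) * (int l ^ i * - k)" by simp
    thus "24 dvd int l ^ Suc (Suc i) * - k - int l ^ i * - k" by (simp add: algebra_simps power2_eq_square)
  qed
  show ?thesis
  proof (induction t)
    case (Suc t)
    thus ?case using per[of t] by linarith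
  qed (use 0 in simp)
qed

text \<open>
  An odd number of applications ends in the middle of a pair, where one half power may be missing; it is not if
  \<open>\<alpha> = 2\<close>, as then each application gains a full factor.
\<close>

lemma gain_sum:
  assumes ls: "l = 5 \<and> s = 1 \<or> l = 7 \<and> s = (2::nat)" and a: "alpha l k > 0"
  shows "alpha l k * R \<le> (\<Sum>i<R. 2 * gain l s (int l ^ i * (int l ^ T * - k))) + (if alpha l k = 2 then 0 else 1)"
proof -
  define g where "g = (\<lambda>i. gain l s (int l ^ i * (int l ^ T * - k)))"
  have gT: "g i = gain l s (int l ^ (i + T) * - k)" for i by (simp add: g_def power_add mult.assoc)
  have pair: "alpha l k \<le> g i + g (Suc i)" for i
    unfolding gT using gain_pair[OF ls a, of "i + T"] by simp
  have le1: "g i \<le> 1" for i unfolding g_def by (rule gain_le_1[OF ls])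
  have a2: "alpha l k \<le> 2" using pair[of 0] le1[of 0] le1[of 1] by simp
  have "alpha l k * R \<le> (\<Sum>i<R. 2 * g i) + (if alpha l k = 2 then 0 else 1)"
  proof (induction R rule: induct_nat_012)
    case 1
    show ?case using a2 a pair[of 0] le1[of 1] by auto
  next
    case (ge2 R)
    have "alpha l k * Suc (Suc R) = alpha l k * R + 2 * alpha l k" by simp
    also have "\<dots> \<le> (\<Sum>i<R. 2 * g i) + (if alpha l k = 2 then 0 else 1) + 2 * (g R + g (Suc R))"
      by (rule add_mono[OF ge2(1) mult_le_mono2[OF pair[of R]]])
    finally show ?case by simp
  qed simp
  thus ?thesis by (simp add: g_def)
qed

text \<open>
  At the end of the first steps the potential is covered, up to a constant, by the factors of \<open>l\<close> that the large
  orders have paid for.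
\<close>

lemma weight_le:
  assumes "s > 0" "n \<ge> 1" "N \<le> 2 * (48 * int s)"
  shows "weight s n \<le> 2 * nat ((n - N) div (48 * int s)) + 8"
proof -
  define D where "D = 48 * int s"
  have D0: "D > 0" using assms by (simp add: D_def)
  define i where "i = nat ((n - 1) div 24)"
  define q where "q = (i + 2 * s - 1) div (2 * s)"
  have i: "24 * int i \<le> n - 1" using assms(2) by (simp add: i_def pos_imp_zdiv_nonneg_iff)
  have "q * (2 * s) \<le> i + 2 * s - 1" by (simp add: q_def)
  hence "int (q * (2 * s)) \<le> int (i + 2 * s - 1)" by (simp only: of_nat_le_iff)
  also have "int (i + 2 * s - 1) = int i + 2 * int s - 1" using assms(1) by (simp add: of_nat_diff)
  finally have "int q * (2 * int s) \<le> int i + 2 * int s - 1" by simp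
  hence "D * int q \<le> 24 * int i + D" unfolding D_def by (simp add: algebra_simps)
  hence "D * int q \<le> n - N + 3 * D" using i assms(3) unfolding D_def by linarith
  hence "D * (int q - 3) \<le> n - N" by (simp add: algebra_simps)
  hence "int q - 3 \<le> (n - N) div D" using D0 by (metis mult.commute zdiv_mono1 nonzero_mult_div_cancel_right less_irrefl)
  thus ?thesis unfolding weight_def i_def[symmetric] q_def[symmetric] D_def[symmetric] by linarith
qed

lemma weight_13_le:
  assumes "n \<ge> 1" "N \<le> 2 * (48 * 7)"
  shows "weight_13 n \<le> 2 * nat ((n - N) div (48 * 7)) + 8"
proof -
  have "(n - 1) div 24 div 7 = (n - 1) div 168" using zdiv_zmult2_eq[of 7 "n - 1" 24] by simp
  hence "int (nat ((n - 1) div 24) div 7) = (n - 1) div 168"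
    using assms(1) by (simp add: zdiv_int pos_imp_zdiv_nonneg_iff)
  moreover have "(n - 1) div 168 + 1 \<le> 2 * ((n - 672) div 336) + 8"
  proof -
    have "168 * ((n - 1) div 168) \<le> n - 1" by simp
    moreover have "n - 672 < 336 * ((n - 672) div 336) + 336"
      using pos_mod_bound[of 336 "n - 672"] mult_div_mod_eq[of 336 "n - 672"] by linarith
    ultimately show ?thesis by linarith
  qed
  moreover have "(n - 672) div 336 \<le> (n - N) div 336" using assms(2) by (intro zdiv_mono1) auto
  ultimately have "int (nat ((n - 1) div 24) div 7) + 1 \<le> 2 * ((n - N) div 336) + 8" by linarith
  hence "nat ((n - 1) div 24) div 7 + 1 \<le> 2 * nat ((n - N) div 336) + 8" by linarith
  thus ?thesis by (simp add: weight_13_def)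
qed

text \<open>
  The first \<open>T\<close> applications of \<open>U\<close> are spent on reaching positive, bounded orders; the remaining ones gain
  \<open>\<alpha>\<close> half powers each on average. The constant 9 is 8 for the potential at the start of the steady phase and 1
  for an incomplete pair.
\<close>

lemma eta_divisible:
  assumes l: "l \<in> {5, 7, 13}" and a: "alpha l k > 0" and c: "c \<ge> 0" "eta_order l w c = - k" and w: "w \<ge> \<bar>k\<bar>"
    and T: "5 ^ T > \<bar>k\<bar>" and k: "k \<noteq> 0" and r: "r \<ge> T"
  shows "\<exists>(Z::nat) (z::int). alpha l k * (r - T) \<le> Z + 9 \<and> eta_coeff l w c (int l ^ r * x) = of_int (int l ^ ((Z + 1) div 2) * z)"
proof -
  define s where "s = (l ^ 2 - 1) div 24"
  define D where "D = 48 * int s"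
  define k' where "k' = int l ^ T * - k"
  have cases: "l = 5 \<and> s = 1 \<or> l = 7 \<and> s = 2 \<or> l = 13 \<and> s = 7" using l by (auto simp: s_def)
  have s0: "s > 0" using cases by auto
  have w0: "w \<ge> 0" using w by linarith
  define h where "h = (\<lambda>x. eta_coeff l w c (int l ^ T * x))"
  define X where "X = (\<lambda>n. 2 * nat ((n - cutoff D \<bar>k\<bar> T) div D))"
  have N: "cutoff D \<bar>k\<bar> T \<le> 2 * D"
    using cutoff_le[of "\<bar>k\<bar>" D T] T s0 by (simp add: D_def)
  have "eta_span l w (\<lambda>n. n * int l ^ T \<ge> - k \<and> 24 dvd n - int l ^ T * - k) X h"
    using first_steps[OF l s_def D_def c] w unfolding X_def h_def by simp
  hence h: "eta_span l w (\<lambda>n. n \<ge> 1 \<and> 24 dvd n - k') X h"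
  proof (rule eta_span_mono)
    fix n assume n: "n * int l ^ T \<ge> - k \<and> 24 dvd n - int l ^ T * - k"
    have "(5::int) ^ T \<le> int l ^ T" using l by (intro power_mono) auto
    hence lT: "int l ^ T > \<bar>k\<bar>" using T by linarith
    have "n \<ge> 0"
    proof (rule ccontr)
      assume "\<not> n \<ge> 0"
      hence "n * int l ^ T \<le> - 1 * int l ^ T" using lT by (intro mult_right_mono) auto
      thus False using n lT by linarith
    qed
    \<comment> \<open>Order 0 maps to itself without gain. It is excluded because \<open>\<alpha> = 0\<close> if \<open>k > 0\<close> is a multiple of 24; for \<open>k < 0\<close> all orders are positive.\<close>
    moreover have "n \<noteq> 0"
    proof
      assume n0: "n = 0"
      hence "k > 0" using n k by auto
      have "24 dvd int l ^ T * k" using n n0 by simp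
      moreover have "coprime (24::int) 5" "coprime (24::int) 7" "coprime (24::int) 13" by code_simp+
      hence "coprime (24::int) (int l ^ T)" using l by auto
      ultimately have "24 dvd k" by (simp add: coprime_dvd_mult_right_iff)
      thus False using a \<open>k > 0\<close> l by (auto simp: alpha_def residue24_def alpha_pos_def)
    qed
    ultimately show "(n \<ge> 1 \<and> 24 dvd n - k') \<and> X n \<le> X n" using n by (simp add: k'_def)
  qed
  have "\<exists>W g. steady l s k' W g \<and> (\<forall>n. n \<ge> 1 \<longrightarrow> W n \<le> 2 * nat ((n - cutoff D \<bar>k\<bar> T) div D) + 8)
      \<and> (\<forall>R. alpha l k * R \<le> (\<Sum>i<R. g i) + 1)"
  proof (cases "l = 13")
    case True
    have a8: "alpha l k = 1" "residue24 k = 8" using a True by (auto simp: alpha_def alpha_pos_def split: if_splits)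
    hence "k mod 24 = 8" by (auto simp: residue24_def split: if_splits)
    hence k8: "24 dvd k - 8" by presburger
    have p8: "24 dvd int 13 ^ t * - 8 - 16" for t
    proof (induction t)
      case (Suc t)
      have "24 dvd 13 * (int 13 ^ t * - 8 - 16) + 24 * 8" using dvd_add[OF dvd_mult[OF Suc] dvd_triv_left] .
      moreover have "13 * (int 13 ^ t * - 8 - 16) + 24 * 8 = int 13 ^ Suc t * - 8 - 16" by simp
      ultimately show ?case by (simp only:)
    qed simp
    have "24 dvd (int 13 ^ T * - 8 - 16) - int 13 ^ T * (k - 8)"
      by (rule dvd_diff[OF p8 dvd_mult[OF k8]])
    moreover have "(int 13 ^ T * - 8 - 16) - int 13 ^ T * (k - 8) = k' - 16" by (simp add: k'_def True algebra_simps)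
    ultimately have "24 dvd k' - 16" by (simp only:)
    from steady_13[OF this] have "steady l s k' weight_13 (\<lambda>t. 1)" using True cases by auto
    moreover have "D = 48 * 7" using True cases by (auto simp: D_def)
    ultimately show ?thesis using weight_13_le[of _ "cutoff D \<bar>k\<bar> T"] N a8(1) by (intro exI[of _ weight_13] exI[of _ "\<lambda>t. 1"]) auto
  next
    case False
    hence ls: "l = 5 \<and> s = 1 \<or> l = 7 \<and> s = 2" using cases by auto
    have "alpha l k * R \<le> (\<Sum>i<R. 2 * gain l s (int l ^ i * k')) + 1" for R
      using gain_sum[OF ls a, of R T] unfolding k'_def by (auto split: if_splits)
    thus ?thesis using steady_5_7[OF ls, of k'] weight_le[OF s0, of _ "cutoff D \<bar>k\<bar> T"] N
      unfolding D_def by blast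
  qed
  then obtain W g where st: "steady l s k' W g"
      and W: "\<And>n. n \<ge> 1 \<Longrightarrow> W n \<le> 2 * nat ((n - cutoff D \<bar>k\<bar> T) div D) + 8"
      and g: "\<And>R. alpha l k * R \<le> (\<Sum>i<R. g i) + 1" by blast
  define R where "R = r - T"
  have "eta_span l w (\<lambda>n. n \<ge> 1 \<and> 24 dvd n - int l ^ R * k') (\<lambda>n. W n + (\<Sum>i<R. g i) + 0 - 8) (\<lambda>x. h (int l ^ R * x))"
    by (rule steady_steps[OF l s_def st w0 h]) (use W in \<open>auto simp: X_def le_diff_conv\<close>)
  hence "\<exists>z::int. h (int l ^ R * x) = of_int (int l ^ (((\<Sum>i<R. g i) - 8 + 1) div 2) * z)"
    by (rule eta_span_divisible) (use l in auto)
  moreover have "h (int l ^ R * x) = eta_coeff l w c (int l ^ r * x)"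
    using r by (simp add: h_def R_def mult.assoc[symmetric] power_add[symmetric])
  moreover have "alpha l k * (r - T) \<le> ((\<Sum>i<R. g i) - 8) + 9" using g[of R] by (simp add: R_def)
  ultimately show ?thesis by metis
qed

text \<open>
  For \<open>k = 1\<close> no loss at all is allowed, as \<open>log |k| = 0\<close>. Already the first application of \<open>U\<close> leads from
  order \<open>-1/24\<close> to positive orders, and it gains a full factor \<open>l\<close> beyond the potential.
\<close>

lemma eta_divisible_1:
  assumes l: "l \<in> {5, 7, 13}" and a: "alpha l 1 > 0" and c: "c \<ge> 0" "eta_order l w c = - 1" and w: "w \<ge> 0"
    and r: "r \<ge> 1"
  shows "\<exists>(Z::nat) (z::int). alpha l 1 * r \<le> Z \<and> eta_coeff l w c (int l ^ r * x) = of_int (int l ^ ((Z + 1) div 2) * z)"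
proof -
  define s where "s = (l ^ 2 - 1) div 24"
  have ls: "l = 5 \<and> s = 1 \<or> l = 7 \<and> s = 2"
    using l a by (auto simp: s_def alpha_def alpha_pos_def residue24_def split: if_splits)
  have single: "eta_span l w (\<lambda>n. n = - 1) (\<lambda>n. 0) (\<lambda>x. eta_coeff l w c x)"
    using eta_span_single[of c "\<lambda>n. n = - 1" l w "\<lambda>n. 0" 1] c by simp
  define k' where "k' = int l ^ 1 * - 1"
  have step: "(n' \<ge> 1 \<and> 24 dvd n' - k') \<and> weight s n' + 2 \<le> 0 + 2 * val_bound l s m n n'"
    if n: "n = - 1" and n': "int l * n' = n + 24 * int m" for n n' m
  proof -
    have dv: "24 dvd n' - k'"
      using order_class_step[OF l n', of "- 1"] n by (simp add: k'_def)
    then obtain q where q: "n' = 24 * q - int l" by (auto simp: dvd_def k'_def algebra_simps)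
    have "q \<ge> 1"
    proof (rule ccontr)
      assume "\<not> q \<ge> 1"
      hence "n' \<le> - int l" using q by linarith
      hence "int l * n' \<le> int l * - int l" by (intro mult_left_mono) auto
      thus False using n' n ls by auto
    qed
    then obtain i where i: "q = 1 + int i" using zle_iff_zadd by auto
    have n'1: "n' \<ge> 1" using q i ls by auto
    have "m - 1 = l * (i + 1) - (l ^ 2 - 1) div 24 - 1"
      using n' n q i ls by (auto simp: algebra_simps)
    hence m: "l = 5 \<and> s = 1 \<and> m - 1 = 5 * i + 3 \<or> l = 7 \<and> s = 2 \<and> m - 1 = 7 * i + 4"
      using ls by auto
    have idx: "nat ((n' - 1) div 24) = i"
    proof -
      have "(n' - 1) div 24 = int i" using q i ls by auto
      thus ?thesis by simp
    qed
    have "weight s n' + 2 \<le> 2 * ((m - 1) div (2 * s))"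
      using m unfolding weight_def idx by (elim disjE conjE) (simp; presburger)+
    also have "\<dots> \<le> 2 * val_bound l s m n n'" using val_bound_ge[OF l s_def n'] by simp
    finally show ?thesis using n'1 dv by simp
  qed
  have low: "n \<ge> - (int l * w)" if "n \<ge> 1 \<and> 24 dvd n - k'" for n
  proof -
    have "int l * w \<ge> 0" using w by simp
    thus ?thesis using that by linarith
  qed
  have h: "eta_span l w (\<lambda>n. n \<ge> 1 \<and> 24 dvd n - k') (\<lambda>n. weight s n + 2) (\<lambda>x. eta_coeff l w c (int l * x))"
    by (rule eta_span_step[OF l s_def single step low])
  define R where "R = r - 1"
  define g where "g = (\<lambda>t. 2 * gain l s (int l ^ t * k'))"
  have "eta_span l w (\<lambda>n. n \<ge> 1 \<and> 24 dvd n - int l ^ R * k') (\<lambda>n. weight s n + (\<Sum>i<R. g i) + 2 - 0)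
      (\<lambda>x. eta_coeff l w c (int l * (int l ^ R * x)))"
    using steady_steps[OF l s_def steady_5_7[OF ls] w h, where B = 2 and C = 0] by (simp add: g_def)
  hence "\<exists>z::int. eta_coeff l w c (int l * (int l ^ R * x)) = of_int (int l ^ (((\<Sum>i<R. g i) + 2 + 1) div 2) * z)"
    by (rule eta_span_divisible) (use l in auto)
  moreover have "int l * (int l ^ R * x) = int l ^ r * x"
    using r by (simp add: R_def mult.assoc[symmetric] power_Suc[symmetric] del: power_Suc)
  moreover have "alpha l 1 * r \<le> (\<Sum>i<R. g i) + 2"
  proof -
    have "alpha l 1 * R \<le> (\<Sum>i<R. g i) + (if alpha l 1 = 2 then 0 else 1)"
      using gain_sum[OF ls a, of R 1] by (simp add: g_def k'_def)
    moreover have "alpha l 1 * r = alpha l 1 * R + alpha l 1" using r by (simp add: R_def algebra_simps)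
    moreover have "alpha l 1 = 2 \<or> alpha l 1 = 1" using a l by (auto simp: alpha_def alpha_pos_def residue24_def)
    ultimately show ?thesis by auto
  qed
  ultimately show ?thesis by metis
qed

section \<open>The theorem\<close>

text \<open>
  Shifting the exponents makes \<open>c\<close> nonnegative and \<open>c + d\<close> at least \<open>|k|\<close>, without affecting \<open>k\<close> or the
  coefficients modulo \<open>l^t\<close>. The congruence for \<open>n\<close> says that its place is a multiple of \<open>l^r\<close>.
\<close>

lemma two_colour_p_divisible:
  fixes r t :: nat
  assumes l: "l \<in> {5, 7, 13}" and n: "n \<ge> 0" and cong: "[24 * n = c + int l * d] (mod (int l ^ r))"
    and div: "\<And>w c' x. c' \<ge> 0 \<Longrightarrow> w \<ge> \<bar>c + int l * d\<bar> \<Longrightarrow> eta_order l w c' = - (c + int l * d)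
       \<Longrightarrow> \<exists>(Z::nat) (z::int). t \<le> (Z + 1) div 2 \<and> eta_coeff l w c' (int l ^ r * x) = of_int (int l ^ ((Z + 1) div 2) * z)"
  shows "int l ^ t dvd two_colour_p l c d n"
proof -
  have pr: "prime l"
  proof -
    have "prime (5::nat)" "prime (7::nat)" "prime (13::nat)" by simp_all
    thus ?thesis using l by auto
  qed
  have l0: "l > 0" and l5: "l \<ge> 5" using l by auto
  define k where "k = c + int l * d"
  define m where "m = nat (\<bar>k\<bar> + \<bar>c + d\<bar>)"
  define c' where "c' = c + int m * int l ^ Suc t"
  define d' where "d' = d - int m * int l ^ t"
  define w where "w = c' + d'"
  have "w = c + d + int m * ((int l - 1) * int l ^ t)" by (simp add: w_def c'_def d'_def algebra_simps)
  moreover have "(int l - 1) * int l ^ t \<ge> 1 * 1" using l5 by (intro mult_mono one_le_power) auto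
  hence "int m * ((int l - 1) * int l ^ t) \<ge> int m * 1" by (intro mult_left_mono) auto
  ultimately have w: "w \<ge> \<bar>k\<bar>" by (simp add: m_def)
  have order: "eta_order l w c' = - k"
    by (simp add: eta_order_def w_def k_def c'_def d'_def algebra_simps)
  have c'0: "c' \<ge> 0"
  proof -
    have "(int l - 1) * c' = int l * w - k" using order by (simp add: eta_order_def)
    moreover have "int l * w \<ge> 1 * w" using l5 w by (intro mult_right_mono) auto
    ultimately have "(int l - 1) * c' \<ge> 0" using w by linarith
    thus ?thesis using l5 by (simp add: zero_le_mult_iff)
  qed
  obtain x where x: "24 * n - k = int l ^ r * x" using cong by (auto simp: cong_iff_dvd_diff k_def dvd_def)
  obtain Z z where Z: "t \<le> (Z + 1) div 2" "eta_coeff l w c' (int l ^ r * x) = of_int (int l ^ ((Z + 1) div 2) * z)"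
    using div[OF c'0 w[unfolded k_def] order[unfolded k_def], of x] by blast
  have "eta_coeff l w c' (int l ^ r * x) = fps_nth (two_colour_gf l c' d') (nat n)"
  proof -
    have "int l ^ r * x = eta_order l w c' + 24 * n" using x order by simp
    moreover have "w - c' = d'" by (simp add: w_def)
    ultimately show ?thesis using n eta_coeff_eq[of l w c' n] by simp
  qed
  hence 1: "fps_nth (two_colour_gf l c' d') (nat n) = of_int (int l ^ ((Z + 1) div 2) * z)" using Z by simp
  obtain y where y: "fps_nth (two_colour_gf l c' d' - two_colour_gf l c d) (nat n) = of_int (int l ^ Suc t * y)"
    using fps_multiple_nth[OF two_colour_gf_shift_congruence[OF pr, of t c m d]] unfolding c'_def d'_def by blast
  have "of_int (two_colour_p l c d n) = fps_nth (two_colour_gf l c d) (nat n)"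
    using of_int_two_colour_p[OF l0, of c d "nat n"] n by simp
  also have "\<dots> = of_int (int l ^ ((Z + 1) div 2) * z - int l ^ Suc t * y)" using 1 y by simp
  finally have "two_colour_p l c d n = int l ^ ((Z + 1) div 2) * z - int l ^ Suc t * y" by (simp only: of_int_eq_iff)
  moreover have "int l ^ t dvd int l ^ ((Z + 1) div 2) * z" using Z(1) by (intro dvd_mult2 le_imp_power_dvd)
  moreover have "int l ^ t dvd int l ^ Suc t * y" by (intro dvd_mult2 le_imp_power_dvd) simp
  ultimately show ?thesis by (metis dvd_diff)
qed

lemma zero_mod_real_powerI:
  assumes "int l ^ t dvd N" "x \<le> real t" "l > 1"
  shows "zero_mod_real_power N l x"
proof (cases "N = 0")
  case False
  hence "t \<le> multiplicity (int l) N" using assms by (intro multiplicity_geI) auto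
  thus ?thesis using assms(2) by (simp add: zero_mod_real_power_def)
qed (simp add: zero_mod_real_power_def)

lemma alpha_le_2: "alpha l k \<le> 2"
  by (simp add: alpha_def alpha_pos_def)

theorem corollary1p2:
  shows "\<exists>C::real. C > 0 \<and>
    (\<forall>l\<in>{5, 7, 13 :: nat}. \<forall>c d :: int. c + int l * d \<noteq> 0 \<longrightarrow>
      (\<exists>\<epsilon>::real. \<bar>\<epsilon>\<bar> \<le> C * ln \<bar>real_of_int (c + int l * d)\<bar> \<and>
        (\<forall>(r::nat) (n::int). r > 0 \<and> [24 * n = c + int l * d] (mod (int l ^ r)) \<longrightarrow>
          zero_mod_real_power (two_colour_p l c d n) l
            (1 / 2 * real (alpha l (c + int l * d)) * real r + \<epsilon>))))"
proof (rule exI[of _ 13], intro conjI ballI allI impI)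
  fix l :: nat and c d :: int
  assume l: "l \<in> {5, 7, 13}" and k0: "c + int l * d \<noteq> 0"
  define k where "k = c + int l * d"
  have l1: "l > 1" using l by auto
  have "\<bar>k\<bar> \<ge> 1" using k0 unfolding k_def by linarith
  hence "real_of_int \<bar>k\<bar> \<ge> 1" by linarith
  hence k: "\<bar>real_of_int k\<bar> \<ge> 1" by simp
  hence ln0: "ln \<bar>real_of_int k\<bar> \<ge> 0" by simp
  have neg: "zero_mod_real_power (two_colour_p l c d n) l x" if "n < 0" for n x
    using that by (simp add: two_colour_p_def zero_mod_real_power_def)
  have "\<exists>\<epsilon>::real. \<bar>\<epsilon>\<bar> \<le> 13 * ln \<bar>real_of_int k\<bar> \<and>
        (\<forall>(r::nat) (n::int). r > 0 \<and> [24 * n = k] (mod (int l ^ r)) \<longrightarrow>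
          zero_mod_real_power (two_colour_p l c d n) l (1 / 2 * real (alpha l k) * real r + \<epsilon>))"
  proof (cases "alpha l k = 0")
    case True
    show ?thesis
      by (intro exI[of _ 0]) (use True ln0 l1 in \<open>auto intro: zero_mod_real_powerI[of _ 0]\<close>)
  next
    case False
    hence a: "alpha l k > 0" by simp
    show ?thesis
    proof (cases "\<bar>k\<bar> = 1")
      case True
      \<comment> \<open>Since \<open>ln 1 = 0\<close>, nothing may be lost; for \<open>k = - 1\<close>, of residue 23, \<open>\<alpha> = 0\<close>.\<close>
      have k1: "k = 1"
      proof (rule ccontr)
        assume "k \<noteq> 1"
        hence "k = - 1" using True by linarith
        thus False using a by (auto simp: alpha_def alpha_pos_def residue24_def split: if_splits)
      qed
      have "zero_mod_real_power (two_colour_p l c d n) l (1 / 2 * real (alpha l k) * real r + 0)"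
        if r: "r > 0" "[24 * n = k] (mod (int l ^ r))" for r n
      proof (cases "n < 0")
        case False
        have "int l ^ ((alpha l k * r + 1) div 2) dvd two_colour_p l c d n"
        proof (rule two_colour_p_divisible[OF l _ r(2)[unfolded k_def]])
          fix w c' x :: int
          assume *: "c' \<ge> 0" "w \<ge> \<bar>c + int l * d\<bar>" "eta_order l w c' = - (c + int l * d)"
          obtain Z z where "alpha l 1 * r \<le> Z" "eta_coeff l w c' (int l ^ r * x) = of_int (int l ^ ((Z + 1) div 2) * z)"
            using eta_divisible_1[OF l, of c' w r x] a * r k1 unfolding k_def by auto
          moreover from this have "(alpha l k * r + 1) div 2 \<le> (Z + 1) div 2"
            unfolding k1 by (intro div_le_mono) simp
          ultimately show "\<exists>(Z::nat) (z::int). (alpha l k * r + 1) div 2 \<le> (Z + 1) div 2 \<and>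
             eta_coeff l w c' (int l ^ r * x) = of_int (int l ^ ((Z + 1) div 2) * z)" by blast
        qed (use False in simp)
        moreover have "alpha l k * r \<le> 2 * ((alpha l k * r + 1) div 2)" by linarith
        hence "real (alpha l k * r) \<le> real (2 * ((alpha l k * r + 1) div 2))" by (simp only: of_nat_le_iff)
        hence "1 / 2 * real (alpha l k) * real r + 0 \<le> real ((alpha l k * r + 1) div 2)" by simp
        ultimately show ?thesis using l1 by (rule zero_mod_real_powerI)
      qed (rule neg)
      thus ?thesis using ln0 by (intro exI[of _ 0]) auto
    next
      case False
      hence k2: "\<bar>real_of_int k\<bar> \<ge> 2" using k by linarith
      \<comment> \<open>As \<open>5 > exp 1\<close>, this gives \<open>5 ^ T > |k|\<close>, so the first steps end at \<open>T\<close>.\<close>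
      define T where "T = nat \<lceil>ln \<bar>real_of_int k\<bar>\<rceil> + 1"
      have "\<bar>real_of_int k\<bar> = exp (ln \<bar>real_of_int k\<bar>)" using k by simp
      also have "\<dots> < exp (real T)" using ln0 by (simp add: T_def) linarith
      also have "\<dots> = exp 1 ^ T" by (simp add: exp_of_nat_mult[symmetric])
      also have "\<dots> \<le> 5 ^ T" using exp_le by (intro power_mono) auto
      finally have "real_of_int \<bar>k\<bar> < real_of_int (5 ^ T)" by simp
      hence T: "5 ^ T > \<bar>k\<bar>" by (simp only: of_int_less_iff)
      have Tle: "real T \<le> ln \<bar>real_of_int k\<bar> + 2" using ln0 by (simp add: T_def) linarith
      \<comment> \<open>The loss is \<open>\<alpha> T / 2 \<le> T\<close> from the first steps and 9 half powers from the steady phase.\<close>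
      define \<epsilon> where "\<epsilon> = - (real T + 5)"
      have "ln \<bar>real_of_int k\<bar> \<ge> ln 2" using k2 by simp
      moreover have "ln (2::real) \<ge> 2 / 3" by (rule ln2_ge_two_thirds)
      ultimately have "ln \<bar>real_of_int k\<bar> \<ge> 2 / 3" by linarith
      \<comment> \<open>The constant 13: \<open>T + 5 \<le> ln |k| + 7 \<le> 13 ln |k|\<close>, as \<open>ln |k| \<ge> 2 / 3\<close>.\<close>
      hence eps: "\<bar>\<epsilon>\<bar> \<le> 13 * ln \<bar>real_of_int k\<bar>" using Tle by (simp add: \<epsilon>_def)
      have "zero_mod_real_power (two_colour_p l c d n) l (1 / 2 * real (alpha l k) * real r + \<epsilon>)"
        if r: "r > 0" "[24 * n = k] (mod (int l ^ r))" for r n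
      proof (cases "n < 0")
        case False
        define t where "t = (alpha l k * (r - T) - 9 + 1) div 2"
        have "int l ^ t dvd two_colour_p l c d n"
        proof (cases "r \<ge> T")
          case True
          show ?thesis
          proof (rule two_colour_p_divisible[OF l _ r(2)[unfolded k_def]])
            fix w c' x :: int
            assume *: "c' \<ge> 0" "w \<ge> \<bar>c + int l * d\<bar>" "eta_order l w c' = - (c + int l * d)"
            obtain Z z where "alpha l k * (r - T) \<le> Z + 9" "eta_coeff l w c' (int l ^ r * x) = of_int (int l ^ ((Z + 1) div 2) * z)"
              using eta_divisible[OF l a *(1) _ _ T _ True, of w x] * k0 unfolding k_def by auto
            moreover from this have "t \<le> (Z + 1) div 2"
              unfolding t_def by (intro div_le_mono) linarith
            ultimately show "\<exists>(Z::nat) (z::int). t \<le> (Z + 1) div 2 \<and>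
               eta_coeff l w c' (int l ^ r * x) = of_int (int l ^ ((Z + 1) div 2) * z)" by blast
          qed (use False in simp)
        next
          case False
          thus ?thesis by (simp add: t_def)
        qed
        moreover have "1 / 2 * real (alpha l k) * real r + \<epsilon> \<le> real t"
        proof -
          have "alpha l k * r \<le> alpha l k * ((r - T) + T)" by (intro mult_le_mono2) linarith
          hence "alpha l k * r \<le> alpha l k * (r - T) + alpha l k * T" by (simp only: distrib_left)
          moreover have "alpha l k * T \<le> 2 * T" using alpha_le_2 by simp
          moreover have "alpha l k * (r - T) \<le> 2 * t + 9" unfolding t_def by linarith
          ultimately have "alpha l k * r \<le> 2 * t + 2 * T + 9" by linarith
          hence "real (alpha l k * r) \<le> real (2 * t + 2 * T + 9)" by (simp only: of_nat_le_iff)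
          thus ?thesis by (simp add: \<epsilon>_def)
        qed
        ultimately show ?thesis using l1 by (rule zero_mod_real_powerI)
      qed (rule neg)
      thus ?thesis using eps by blast
    qed
  qed
  thus "\<exists>\<epsilon>::real. \<bar>\<epsilon>\<bar> \<le> 13 * ln \<bar>real_of_int (c + int l * d)\<bar> \<and>
        (\<forall>(r::nat) (n::int). r > 0 \<and> [24 * n = c + int l * d] (mod (int l ^ r)) \<longrightarrow>
          zero_mod_real_power (two_colour_p l c d n) l
            (1 / 2 * real (alpha l (c + int l * d)) * real r + \<epsilon>))"
    by (simp only: k_def)
qed simp

end
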